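(* For every positive integer $n$, the fifth moment (about the mean) of the random variable `size' defined on the set of $(2n+1,2n+3)$-core partitions with distinct parts (with the uniform distribution) is $$ \begin{aligned} \frac{n(n+1)}{108825076039680}\big(&4115597238066n^{13}+30331407775461n^{12}+93240357590320n^{11}\\ &+153901186416765n^{10}+154511084293844n^{9}+126787455814599n^{8}\\ &+115227024155664n^{7}+42586120680111n^{6}-95604599727502n^{5}\\ &-105409116317640n^{4}+43165327777096n^{3}+91113907956144n^{2}\\ &-30975685518528n-65049004454400\big). \end{aligned} $$
   Context: A partition is a non-increasing finite sequence $\lambda=(\lambda_1,\dots,\lambda_k)$, $k\ge 0$, of positive integers (the empty partition is allowed); its size is $\lambda_1+\dots+\lambda_k$, and it has distinct parts if the $\lambda_i$ are pairwise distinct. The hook length of a cell $(i,j)$, $1\le j\le\lambda_i$, of its Ferrers (Young) diagram is $\lambda_i-i+\lambda'_j-j+1$, where $\lambda'$ is the conjugate partition. A partition is an $(s,t)$-core partition if none of its hook lengths equals $s$ and none equals $t$. For $s=2n+1$, $t=2n+3$ (relatively prime) the set of $(s,t)$-core partitions is finite. If $Q_n$ is the finite set of $(2n+1,2n+3)$-core partitions with distinct parts and $\mu_n=\frac{1}{|Q_n|}\sum_{\lambda\in Q_n}\mathrm{size}(\lambda)$, the $k$-th moment about the mean is $\frac{1}{|Q_n|}\sum_{\lambda\in Q_n}(\mathrm{size}(\lambda)-\mu_n)^k$. *)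

theory Defs
  imports Complex_Main
begin

definition is_partition :: "nat list \<Rightarrow> bool" where
  "is_partition xs \<longleftrightarrow> sorted_wrt (\<ge>) xs \<and> (\<forall>x\<in>set xs. 0 < x)"

(* Rows and columns are numbered from 1, so part xs i is meant for 1 <= i <= length xs. *)
definition part :: "nat list \<Rightarrow> nat \<Rightarrow> nat" where
  "part xs i = xs ! (i - 1)"

definition cells :: "nat list \<Rightarrow> (nat \<times> nat) set" where
  "cells xs = {(i, j). 1 \<le> i \<and> i \<le> length xs \<and> 1 \<le> j \<and> j \<le> part xs i}"

(* The j-th part of the conjugate partition is the number of cells in column j. *)
definition conj_part :: "nat list \<Rightarrow> nat \<Rightarrow> nat" where
  "conj_part xs j = card {i. (i, j) \<in> cells xs}"

(* Integer-valued, so that the intermediate differences are not truncated. *)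
definition hook_length :: "nat list \<Rightarrow> nat \<Rightarrow> nat \<Rightarrow> int" where
  "hook_length xs i j =
     int (part xs i) - int i + int (conj_part xs j) - int j + 1"

definition is_core :: "nat \<Rightarrow> nat \<Rightarrow> nat list \<Rightarrow> bool" where
  "is_core s t xs \<longleftrightarrow> is_partition xs \<and>
     (\<forall>(i, j)\<in>cells xs. hook_length xs i j \<noteq> int s \<and> hook_length xs i j \<noteq> int t)"

definition distinct_cores :: "nat \<Rightarrow> nat \<Rightarrow> nat list set" where
  "distinct_cores s t = {xs. is_core s t xs \<and> distinct xs}"

definition psize :: "nat list \<Rightarrow> nat" where
  "psize xs = sum_list xs"

(* Mean and central moments of X under the uniform distribution on a finite nonempty set A. *)
definition uniform_mean :: "'a set \<Rightarrow> ('a \<Rightarrow> real) \<Rightarrow> real" where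
  "uniform_mean A X = (\<Sum>a\<in>A. X a) / real (card A)"

definition central_moment :: "nat \<Rightarrow> 'a set \<Rightarrow> ('a \<Rightarrow> real) \<Rightarrow> real" where
  "central_moment k A X = uniform_mean A (\<lambda>a. (X a - uniform_mean A X) ^ k)"

end

theory Submission
  imports Defs "HOL-Computational_Algebra.Formal_Power_Series" "HOL-Computational_Algebra.Polynomial"
begin

text \<open>
The first-column hook lengths of a partition form a finite set \<open>X\<close> of positive integers; being an
\<open>(s, t)\<close>-core with distinct parts means that \<open>X\<close> is closed under subtraction of \<open>s\<close> and \<open>t\<close> and has no
two consecutive elements, and the size of the partition is the sum of \<open>X\<close> minus a triangular number.
Here \<open>s = 2 * n + 1\<close>, \<open>t = 2 * n + 3\<close>, and \<open>w = 2 * n + 2\<close> lies in between. Every raw moment of the size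
turns out to be a polynomial in \<open>n\<close> of degree at most \<open>3 * k\<close> (\<open>k\<close> the order of the moment), and then
finitely many values determine it.

Telescoping: \<open>X \<mapsto> (X + 2) \<union> {1}\<close> maps the admissible sets containing \<open>2 * n\<close> bijectively to those
containing \<open>w\<close>, raises the number \<open>M\<close> of elements by one and fixes the sum minus \<open>M\<^sup>2\<close>. A \<open>k\<close>-th power of
the size is a difference in \<open>M\<close> of a polynomial, so almost everything cancels in the power sum
(\<open>telescope\<close>). The surviving sets contain no multiple of \<open>w\<close>; writing their elements as \<open>m * w + c\<close>
turns them into pyramidal sets of cells \<open>(m, c)\<close>: a cell in row \<open>m + 1\<close> rests on its two neighbours in
row \<open>m\<close> (\<open>core_hooks_eq_label_sets\<close>, \<open>Phi_core_hooks_eq_label_sets\<close>, \<open>bij_label\<close>). Averaging over the reflection of the columns makes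
the summand odd under a change of sign of \<open>M\<close> and of the column sum (\<open>sum_core_hooks\<close>, \<open>size_stat_sgn_flip\<close>).

Polynomiality: pyramidal sets decompose like Dyck paths into primitive blocks (\<open>sum_arch_sets\<close>, \<open>sum_cell_sets\<close>).
For a polynomial statistic \<open>f\<close> the generating function of its sum over the block sequences is a Laurent
polynomial in \<open>rt\<close>, the power series with \<open>rt\<^sup>2 = 1 - 4 * X\<close>, and the Galois conjugation \<open>rt \<mapsto> - rt\<close>
corresponds to the sign change of the statistics (\<open>conj_pair_arch_fps\<close>, \<open>conj_pair_chains\<close>, \<open>conj_pair_signed_fps\<close>). Hence for an odd \<open>f\<close> only even
powers of the inverse of \<open>rt\<close> occur, and the coefficients are \<open>4 ^ n\<close> times a polynomial whose degree is
controlled by the weight of \<open>f\<close> (\<open>signed_sum_polynomial\<close>).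

Evaluation: the same signed sum runs over lattice walks ending at height zero (\<open>signed_sum_walk_sum\<close>). Adding a vertex
translates the three statistics by constants, so the joint moments of all walks of a given length and
starting height obey a linear recursion (\<open>moments_rec\<close>). Running it for up to 31 steps gives the raw moments of
order \<open>k \<le> 5\<close> for \<open>n \<le> 3 * k\<close>, which pins down the moment polynomials (\<open>interpolate\<close>,
\<open>raw_moments\<close>); the fifth central moment is a polynomial combination of them.
\<close>

section \<open>First-column hook lengths\<close>

text \<open>The map sending a partition to its set of first-column hook lengths turns every condition in
  play into a condition on a finite set of positive integers: hook lengths become differences
  between an element and a smaller non-element, so being an \<open>s\<close>-core becomes closure under
  subtracting \<open>s\<close>, and distinctness of the parts becomes absence of consecutive elements.\<close>

definition first_hook :: "nat list \<Rightarrow> nat \<Rightarrow> nat" where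
  "first_hook xs i = xs ! i + (length xs - Suc i)"

definition first_hooks :: "nat list \<Rightarrow> nat set" where
  "first_hooks xs = first_hook xs ` {..<length xs}"

lemma partition_antimono:
  assumes "is_partition xs" "i \<le> j" "j < length xs"
  shows "xs ! j \<le> xs ! i"
  using assms sorted_wrt_nth_less[of "(\<ge>)" xs i j] unfolding is_partition_def
  by (cases "i = j") simp_all

lemma first_hook_strict_antimono:
  assumes "is_partition xs" "i < j" "j < length xs"
  shows "first_hook xs j < first_hook xs i"
  using partition_antimono[OF assms(1), of i j] assms(2,3) unfolding first_hook_def by linarith

lemma inj_on_first_hook:
  assumes "is_partition xs"
  shows "inj_on (first_hook xs) {..<length xs}"
  by (rule inj_onI)
    (metis assms first_hook_strict_antimono lessThan_iff less_irrefl linorder_neqE_nat)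

lemma conj_part_eq:
  assumes "is_partition xs" "1 \<le> j" "c \<le> length xs"
    and "\<And>i. i < c \<Longrightarrow> j \<le> xs ! i" and "\<And>i. c \<le> i \<Longrightarrow> i < length xs \<Longrightarrow> xs ! i < j"
  shows "conj_part xs j = c"
proof -
  have "{i. (i, j) \<in> cells xs} = {1..c}"
  proof (intro set_eqI iffI)
    fix i assume "i \<in> {i. (i, j) \<in> cells xs}"
    then have i: "1 \<le> i" "i \<le> length xs" "j \<le> xs ! (i - 1)"
      by (auto simp: cells_def Defs.part_def)
    have "\<not> c \<le> i - 1"
      using assms(5)[of "i - 1"] i by linarith
    then show "i \<in> {1..c}" using i by auto
  next
    fix i assume "i \<in> {1..c}"
    then show "i \<in> {i. (i, j) \<in> cells xs}"
      using assms(2,3) assms(4)[of "i - 1"] by (auto simp: cells_def Defs.part_def)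
  qed
  then show ?thesis unfolding conj_part_def by simp
qed

text \<open>The index separating the rows whose first hook length exceeds \<open>g\<close> from the others.\<close>

lemma first_hook_cut:
  assumes "is_partition xs"
  obtains c where "c \<le> length xs" "\<And>i. i < c \<Longrightarrow> g < first_hook xs i"
    "\<And>i. c \<le> i \<Longrightarrow> i < length xs \<Longrightarrow> first_hook xs i \<le> g"
proof -
  define c where "c = (LEAST c. c = length xs \<or> first_hook xs c \<le> g)"
  have ex: "c = length xs \<or> first_hook xs c \<le> g"
    unfolding c_def by (rule LeastI[of _ "length xs"]) simp
  have le: "c \<le> length xs" unfolding c_def by (rule Least_le) simp
  have less: "g < first_hook xs i" if "i < c" for i
    using not_less_Least[of i "\<lambda>c. c = length xs \<or> first_hook xs c \<le> g"] that
    unfolding c_def by auto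
  have ge: "first_hook xs i \<le> g" if "c \<le> i" "i < length xs" for i
    using ex that first_hook_strict_antimono[OF assms, of c i]
    by (cases "c = i") auto
  show ?thesis using that[OF le less ge] by blast
qed

text \<open>A non-element \<open>g\<close> below the first hook length of row \<open>i\<close> belongs to exactly one column:
  with \<open>c\<close> rows above the cut at \<open>g\<close>, that column is \<open>g - (length xs - c) + 1\<close>.\<close>

lemma hook_eq_iff_gap:
  assumes p: "is_partition xs" and i: "i < length xs" and s: "0 < s"
  shows "(\<exists>j. (Suc i, j) \<in> cells xs \<and> hook_length xs (Suc i) j = int s) \<longleftrightarrow>
    s \<le> first_hook xs i \<and> first_hook xs i - s \<notin> first_hooks xs"
proof
  assume "\<exists>j. (Suc i, j) \<in> cells xs \<and> hook_length xs (Suc i) j = int s"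
  then obtain j where j: "1 \<le> j" "j \<le> xs ! i" and
    h: "hook_length xs (Suc i) j = int s"
    by (auto simp: cells_def Defs.part_def)
  obtain c where c: "c \<le> length xs" "\<And>i. i < c \<Longrightarrow> j \<le> xs ! i"
    "\<And>i. c \<le> i \<Longrightarrow> i < length xs \<Longrightarrow> xs ! i < j"
  proof -
    define c where "c = (LEAST c. c = length xs \<or> xs ! c < j)"
    have ex: "c = length xs \<or> xs ! c < j"
      unfolding c_def by (rule LeastI[of _ "length xs"]) simp
    have le: "c \<le> length xs" unfolding c_def by (rule Least_le) simp
    have less: "j \<le> xs ! i" if "i < c" for i
      using not_less_Least[of i "\<lambda>c. c = length xs \<or> xs ! c < j"] that
      unfolding c_def by auto
    have ge: "xs ! i < j" if "c \<le> i" "i < length xs" for i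
      using ex that partition_antimono[OF p, of c i] by auto
    show ?thesis using that[OF le less ge] by blast
  qed
  have cp: "conj_part xs j = c" by (rule conj_part_eq[OF p j(1) c])
  have ic: "i < c" using c(3)[of i] i j(2) by (meson leD not_le)
  have s_eq: "int s = int (first_hook xs i) - int (length xs - c + (j - 1))"
    using h cp ic i j(1) c(1) unfolding hook_length_def Defs.part_def first_hook_def
    by (simp add: of_nat_diff)
  have "length xs - c + (j - 1) \<noteq> first_hook xs r" if r: "r < length xs" for r
  proof (cases "r < c")
    case True
    then show ?thesis using c(2)[OF True] j(1) r c(1) unfolding first_hook_def by linarith
  next
    case False
    then show ?thesis using c(3)[of r] j(1) r c(1) unfolding first_hook_def by linarith
  qed
  moreover have "first_hook xs i = s + (length xs - c + (j - 1))"
    using s_eq by linarith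
  ultimately show "s \<le> first_hook xs i \<and> first_hook xs i - s \<notin> first_hooks xs"
    unfolding first_hooks_def by (auto simp: image_iff)
next
  assume "s \<le> first_hook xs i \<and> first_hook xs i - s \<notin> first_hooks xs"
  then have sl: "s \<le> first_hook xs i" and ng: "first_hook xs i - s \<notin> first_hooks xs" by auto
  define g where "g = first_hook xs i - s"
  obtain c where c: "c \<le> length xs" "\<And>i. i < c \<Longrightarrow> g < first_hook xs i"
    "\<And>i. c \<le> i \<Longrightarrow> i < length xs \<Longrightarrow> first_hook xs i \<le> g"
    using first_hook_cut[OF p, of g] by blast
  have lt: "first_hook xs r < g" if "c \<le> r" "r < length xs" for r
    using c(3)[OF that] ng that unfolding g_def first_hooks_def by force
  have ic: "i < c"
  proof (rule ccontr)
    assume "\<not> i < c"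
    then have "first_hook xs i < g" using lt i by simp
    then show False unfolding g_def by simp
  qed
  \<comment> \<open>The \<open>length xs - c\<close> elements below \<open>g\<close> are distinct, hence at most \<open>g\<close> in number.\<close>
  have gc: "length xs - c \<le> g"
  proof -
    have "card (first_hook xs ` {c..<length xs}) = length xs - c"
    proof -
      have "{c..<length xs} \<subseteq> {..<length xs}" by auto
      from card_image[OF inj_on_subset[OF inj_on_first_hook[OF p] this]] show ?thesis by simp
    qed
    moreover have "first_hook xs ` {c..<length xs} \<subseteq> {..<g}" using lt by auto
    ultimately show ?thesis using card_mono[of "{..<g}" "first_hook xs ` {c..<length xs}"] by simp
  qed
  define j where "j = Suc (g - (length xs - c))"
  have up: "j \<le> xs ! r" if "r < c" for r
  proof -
    have "g < first_hook xs (c - 1)" using c(2)[of "c - 1"] that by simp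
    then have "j \<le> xs ! (c - 1)" using that c(1) gc unfolding first_hook_def j_def by simp
    also have "xs ! (c - 1) \<le> xs ! r" using partition_antimono[OF p, of r "c - 1"] that c(1) by simp
    finally show ?thesis .
  qed
  have low: "xs ! r < j" if "c \<le> r" "r < length xs" for r
  proof -
    have "first_hook xs c < g" using lt[of c] that by simp
    then have "xs ! c < j" using that gc unfolding first_hook_def j_def by linarith
    then show ?thesis using partition_antimono[OF p that(1,2)] by simp
  qed
  have cp: "conj_part xs j = c"
    by (rule conj_part_eq[OF p _ c(1) up low]) (simp_all add: j_def)
  have "(Suc i, j) \<in> cells xs" using up[OF ic] i unfolding cells_def Defs.part_def j_def by simp
  moreover have "hook_length xs (Suc i) j = int s"
    using cp ic i gc c(1) sl unfolding hook_length_def Defs.part_def j_def g_def first_hook_def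
    by (simp add: of_nat_diff)
  ultimately show "\<exists>j. (Suc i, j) \<in> cells xs \<and> hook_length xs (Suc i) j = int s" by blast
qed

lemma is_core_iff_first_hooks:
  assumes "0 < s" "0 < t"
  shows "is_core s t xs \<longleftrightarrow> is_partition xs \<and>
    (\<forall>b\<in>first_hooks xs. (s \<le> b \<longrightarrow> b - s \<in> first_hooks xs) \<and> (t \<le> b \<longrightarrow> b - t \<in> first_hooks xs))"
proof (cases "is_partition xs")
  case True
  have row: "(\<forall>(i, j)\<in>cells xs. hook_length xs i j \<noteq> int d) \<longleftrightarrow>
      (\<forall>b\<in>first_hooks xs. d \<le> b \<longrightarrow> b - d \<in> first_hooks xs)" if "0 < d" for d
  proof -
    have "(\<forall>(i, j)\<in>cells xs. hook_length xs i j \<noteq> int d) \<longleftrightarrow>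
        (\<forall>i<length xs. \<not> (\<exists>j. (Suc i, j) \<in> cells xs \<and> hook_length xs (Suc i) j = int d))"
    proof (intro iffI allI impI)
      assume a: "\<forall>i<length xs. \<not> (\<exists>j. (Suc i, j) \<in> cells xs \<and> hook_length xs (Suc i) j = int d)"
      show "\<forall>(i, j)\<in>cells xs. hook_length xs i j \<noteq> int d"
      proof (clarify)
        fix i j assume c: "(i, j) \<in> cells xs" "hook_length xs i j = int d"
        then have "1 \<le> i" "i \<le> length xs" by (auto simp: cells_def)
        then have "i - 1 < length xs" "Suc (i - 1) = i" by simp_all
        with a c show False by metis
      qed
    next
      fix i
      assume a: "\<forall>(i, j)\<in>cells xs. hook_length xs i j \<noteq> int d"
      show "\<not> (\<exists>j. (Suc i, j) \<in> cells xs \<and> hook_length xs (Suc i) j = int d)"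
        using a by fast
    qed
    also have "\<dots> \<longleftrightarrow> (\<forall>i<length xs. d \<le> first_hook xs i \<longrightarrow>
        first_hook xs i - d \<in> first_hooks xs)"
      using hook_eq_iff_gap[OF True _ that] by simp
    also have "\<dots> \<longleftrightarrow> (\<forall>b\<in>first_hooks xs. d \<le> b \<longrightarrow> b - d \<in> first_hooks xs)"
      by (auto simp: first_hooks_def)
    finally show ?thesis .
  qed
  show ?thesis using row[OF assms(1)] row[OF assms(2)] True
    unfolding is_core_def case_prod_unfold ball_conj_distrib by simp
next
  case False
  then show ?thesis unfolding is_core_def by simp
qed

definition hook_sets :: "nat \<Rightarrow> nat \<Rightarrow> nat set set" where
  "hook_sets s t = {X. finite X \<and> 0 \<notin> X \<and>
    (\<forall>x\<in>X. (s \<le> x \<longrightarrow> x - s \<in> X) \<and> (t \<le> x \<longrightarrow> x - t \<in> X) \<and> Suc x \<notin> X)}"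

lemma first_hook_list:
  assumes "is_partition xs"
  shows "sorted_wrt (<) (rev (map (first_hook xs) [0..<length xs]))"
    "set (map (first_hook xs) [0..<length xs]) = first_hooks xs"
proof -
  show "sorted_wrt (<) (rev (map (first_hook xs) [0..<length xs]))"
    unfolding sorted_wrt_rev unfolding sorted_wrt_iff_nth_less
    using first_hook_strict_antimono[OF assms] by simp
  show "set (map (first_hook xs) [0..<length xs]) = first_hooks xs"
    unfolding first_hooks_def by auto
qed

text \<open>Listed downwards, the first-column hook lengths are strictly decreasing, so the set determines the list.\<close>

lemma first_hooks_inject:
  assumes p: "is_partition xs" "is_partition ys" and e: "first_hooks xs = first_hooks ys"
  shows "xs = ys"
proof -
  have "rev (map (first_hook xs) [0..<length xs]) = rev (map (first_hook ys) [0..<length ys])"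
    by (rule sorted_distinct_set_unique)
      (use first_hook_list[OF p(1)] first_hook_list[OF p(2)] e in \<open>auto simp only: strict_sorted_iff set_rev\<close>)
  then have m: "map (first_hook xs) [0..<length xs] = map (first_hook ys) [0..<length ys]" by simp
  then have l: "length xs = length ys" using map_eq_imp_length_eq by fastforce
  show ?thesis
  proof (rule nth_equalityI[OF l])
    fix i assume i: "i < length xs"
    have "first_hook xs i = first_hook ys i"
      using arg_cong[OF m, of "\<lambda>zs. zs ! i"] i l by simp
    then show "xs ! i = ys ! i" using l unfolding first_hook_def by simp
  qed
qed

lemma first_hooks_surj:
  assumes "finite X" "0 \<notin> X"
  obtains xs where "is_partition xs" "first_hooks xs = X"
proof -
  define bs where "bs = rev (sorted_list_of_set X)"
  define k where "k = length bs"
  have bs: "sorted_wrt (<) (rev bs)" "set bs = X" using assms(1) unfolding bs_def by (auto simp: strict_sorted_iff)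
  have step: "bs ! j < bs ! i" if "i < j" "j < k" for i j
    using bs(1) that unfolding sorted_wrt_rev k_def unfolding sorted_wrt_iff_nth_less by auto
  have gap: "i + d < k \<Longrightarrow> bs ! (i + d) + d \<le> bs ! i" for i d
  proof (induction d)
    case (Suc d)
    then show ?case using step[of "i + d" "i + Suc d"] by simp
  qed simp
  have pos: "k - Suc i < bs ! i" if "i < k" for i
  proof -
    have "bs ! (k - 1) \<in> X" using that bs(2) unfolding k_def by (metis diff_less less_nat_zero_code less_one nat_neq_iff not_gr_zero nth_mem)
    then have "0 < bs ! (k - 1)" using assms(2) by (metis gr0I)
    then show ?thesis using gap[of i "k - Suc i"] that by simp
  qed
  define xs where "xs = map (\<lambda>i. bs ! i - (k - Suc i)) [0..<k]"
  have lx: "length xs = k" by (simp add: xs_def)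
  have fh: "first_hook xs i = bs ! i" if "i < k" for i
    using pos[OF that] that unfolding first_hook_def xs_def by simp
  have "xs ! j \<le> xs ! i" if "i < j" "j < k" for i j
    using gap[of i "j - i"] pos[of i] pos[of j] that unfolding xs_def by simp
  moreover have "0 < x" if "x \<in> set xs" for x
  proof -
    obtain i where i: "i < k" "x = bs ! i - (k - Suc i)" using \<open>x \<in> set xs\<close> unfolding xs_def by auto
    show ?thesis unfolding i(2) using pos[OF i(1)] by (simp only: zero_less_diff)
  qed
  ultimately have "is_partition xs"
    unfolding is_partition_def sorted_wrt_iff_nth_less by (simp add: xs_def)
  moreover have "first_hooks xs = X"
  proof -
    have "first_hooks xs = (\<lambda>i. bs ! i) ` {..<k}"
      unfolding first_hooks_def by (rule image_cong) (simp_all add: lx fh)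
    also have "\<dots> = X" using bs(2) unfolding k_def by (auto simp: set_conv_nth)
    finally show ?thesis .
  qed
  ultimately show ?thesis by (rule that)
qed

text \<open>Two equal parts force two equal neighbouring parts, whose first-column hook lengths differ by one.\<close>

lemma distinct_iff_first_hooks:
  assumes p: "is_partition xs"
  shows "distinct xs \<longleftrightarrow> (\<forall>b\<in>first_hooks xs. Suc b \<notin> first_hooks xs)"
proof
  assume d: "distinct xs"
  show "\<forall>b\<in>first_hooks xs. Suc b \<notin> first_hooks xs"
  proof (intro ballI notI)
    fix b assume "b \<in> first_hooks xs" "Suc b \<in> first_hooks xs"
    then obtain i j where ij: "i < length xs" "j < length xs" "b = first_hook xs j" "Suc b = first_hook xs i"
      unfolding first_hooks_def by auto
    have "i < j"
      using first_hook_strict_antimono[OF p, of j i] ij by (cases i j rule: linorder_cases) auto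
    moreover have "xs ! i \<noteq> xs ! j" using d ij \<open>i < j\<close> by (auto simp: distinct_conv_nth)
    ultimately show False
      using partition_antimono[OF p, of i j] ij unfolding first_hook_def by linarith
  qed
next
  assume n: "\<forall>b\<in>first_hooks xs. Suc b \<notin> first_hooks xs"
  show "distinct xs" unfolding distinct_conv_nth
  proof (intro allI impI notI)
    have *: False if "i < j" "j < length xs" "xs ! i = xs ! j" for i j
    proof -
      have "xs ! Suc i = xs ! i"
        using partition_antimono[OF p, of i "Suc i"] partition_antimono[OF p, of "Suc i" j] that by simp
      then have "first_hook xs i = Suc (first_hook xs (Suc i))"
        using that unfolding first_hook_def by simp
      moreover have "first_hook xs i \<in> first_hooks xs" "first_hook xs (Suc i) \<in> first_hooks xs"
        using that unfolding first_hooks_def by auto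
      ultimately show False using n by metis
    qed
    fix i j assume "i < length xs" "j < length xs" "i \<noteq> j" "xs ! i = xs ! j"
    then show False using *[of i j] *[of j i] by (cases i j rule: linorder_cases) auto
  qed
qed

lemma bij_first_hooks:
  assumes "0 < s" "0 < t"
  shows "bij_betw first_hooks (distinct_cores s t) (hook_sets s t)"
proof -
  have p: "is_partition xs" if "xs \<in> distinct_cores s t" for xs
    using that unfolding distinct_cores_def is_core_def by auto
  have iff: "first_hooks xs \<in> hook_sets s t \<longleftrightarrow> xs \<in> distinct_cores s t" if "is_partition xs" for xs
  proof -
    have "finite (first_hooks xs)" unfolding first_hooks_def by simp
    moreover have "0 \<notin> first_hooks xs"
    proof
      assume "0 \<in> first_hooks xs"
      then obtain i where i: "i < length xs" "first_hook xs i = 0"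
        unfolding first_hooks_def by (metis imageE lessThan_iff)
      then have "xs ! i = 0" by (simp add: first_hook_def)
      then show False using that nth_mem[OF i(1)] unfolding is_partition_def by (metis less_irrefl)
    qed
    ultimately show ?thesis
      unfolding hook_sets_def distinct_cores_def mem_Collect_eq is_core_iff_first_hooks[OF assms] distinct_iff_first_hooks[OF that]
      using that by blast
  qed
  show ?thesis
    unfolding bij_betw_def
  proof (intro conjI inj_onI equalityI subsetI)
    fix xs ys assume "xs \<in> distinct_cores s t" "ys \<in> distinct_cores s t" "first_hooks xs = first_hooks ys"
    then show "xs = ys" using first_hooks_inject p by blast
  next
    fix X assume "X \<in> first_hooks ` distinct_cores s t"
    then show "X \<in> hook_sets s t" using iff p by blast
  next
    fix X assume X: "X \<in> hook_sets s t"
    then obtain xs where "is_partition xs" "first_hooks xs = X"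
      using first_hooks_surj[of X] unfolding hook_sets_def by blast
    then show "X \<in> first_hooks ` distinct_cores s t" using iff X by blast
  qed
qed

text \<open>The part of the size that the telescoping map leaves unchanged; the size itself is
\<open>drift X + tri (card X)\<close>.\<close>

definition drift :: "nat set \<Rightarrow> real" where
  "drift X = real (\<Sum>X) - (real (card X))\<^sup>2"
definition tri :: "nat \<Rightarrow> real" where "tri i = real i * (real i + 1) / 2"

lemma sum_tri: "(\<Sum>i<m. real i) = (real m)\<^sup>2 - tri m"
  by (induction m) (auto simp: tri_def power2_eq_square field_simps)

lemma psize_eq:
  assumes "is_partition xs"
  shows "real (psize xs) = drift (first_hooks xs) + tri (card (first_hooks xs))"
proof -
  let ?k = "length xs"
  have c: "card (first_hooks xs) = ?k"
    unfolding first_hooks_def card_image[OF inj_on_first_hook[OF assms]] by simp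
  have "\<Sum>(first_hooks xs) = (\<Sum>i<?k. first_hook xs i)"
    unfolding first_hooks_def using sum.reindex[OF inj_on_first_hook[OF assms], of id] by simp
  also have "\<dots> = (\<Sum>i<?k. xs ! i) + (\<Sum>i<?k. ?k - Suc i)"
    unfolding first_hook_def by (rule sum.distrib)
  also have "(\<Sum>i<?k. xs ! i) = psize xs" unfolding psize_def by (simp add: sum_list_sum_nth atLeast0LessThan)
  also have "(\<Sum>i<?k. ?k - Suc i) = (\<Sum>i<?k. i)" by (rule sum.nat_diff_reindex)
  finally have "real (\<Sum>(first_hooks xs)) = real (psize xs) + (\<Sum>i<?k. real i)" by simp
  then show ?thesis unfolding drift_def c sum_tri by simp
qed

lemma sum_distinct_cores:
  assumes "0 < s" "0 < t"
  shows "(\<Sum>xs\<in>distinct_cores s t. F (real (psize xs))) = (\<Sum>X\<in>hook_sets s t. F (drift X + tri (card X)))"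
proof -
  have "(\<Sum>X\<in>hook_sets s t. F (drift X + tri (card X))) =
      (\<Sum>xs\<in>distinct_cores s t. F (drift (first_hooks xs) + tri (card (first_hooks xs))))"
    by (rule sum.reindex_bij_betw[OF bij_first_hooks[OF assms], symmetric])
  also have "\<dots> = (\<Sum>xs\<in>distinct_cores s t. F (real (psize xs)))"
    by (rule sum.cong[OF refl]) (simp add: psize_eq distinct_cores_def is_core_def)
  finally show ?thesis by simp
qed

section \<open>Block statistics and weighted polynomials\<close>

text \<open>A statistic \<open>(l, m, n, e)\<close> records, for a set of cells occupying \<open>l\<close> consecutive columns, the number
\<open>m\<close> of cells, the sum \<open>n\<close> of their columns and the sum \<open>e\<close> of their rows shifted by one half. Placing two
sets side by side is \<open>cat\<close>; \<open>dip\<close> adds an empty column on either side; \<open>hill\<close> in addition raises the set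
by one row and fills the new bottom row in every second column.

The last three maps serve the conjugation below: \<open>sgn_flip\<close> is the sign change under which the final
statistic is odd, \<open>kap\<close> is the affine map with \<open>hill \<circ> kap = sgn_flip \<circ> dip\<close>, and \<open>stat_m2\<close> is the
fictitious block that both \<open>dip\<close> and \<open>hill\<close> send to the empty one; \<open>eta\<close> is \<open>sgn_flip \<circ> dip\<close> followed by
removal of the two added columns, that is, by concatenation with \<open>stat_m2\<close>.\<close>

type_synonym stat = "real \<times> real \<times> real \<times> real"

fun cat :: "stat \<Rightarrow> stat \<Rightarrow> stat" where
  "cat (l, m, n, e) (l', m', n', e') = (l + l', m + m', n + n' + l * m', e + e')"
fun lift :: "stat \<Rightarrow> stat" where
  "lift (l, m, n, e) = (l, m + l / 2, n + l\<^sup>2 / 4, e + m + l / 4)"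
fun dip :: "stat \<Rightarrow> stat" where
  "dip (l, m, n, e) = (l + 2, m, n + m, e)"
definition hill :: "stat \<Rightarrow> stat" where
  "hill s = lift (dip s)"
fun sgn_flip :: "stat \<Rightarrow> stat" where
  "sgn_flip (l, m, n, e) = (l, - m, - n, e)"
fun kap :: "stat \<Rightarrow> stat" where
  "kap (l, m, n, e) = (l, - m - (l + 2) / 2, - n - (l + 2) * l / 4, e + m + (l + 2) / 4)"
fun eta :: "stat \<Rightarrow> stat" where
  "eta (l, m, n, e) = (l, - m, - n - m, e)"
abbreviation "stat0 \<equiv> (0, 0, 0, 0) :: stat"
abbreviation "stat_m2 \<equiv> (- 2, 0, 0, 0) :: stat"

lemma cat_assoc: "cat (cat a b) c = cat a (cat b c)"
  by (cases a; cases b; cases c) (simp add: algebra_simps)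
lemma cat_stat0 [simp]: "cat stat0 s = s" "cat s stat0 = s"
  by (cases s, simp)+

text \<open>The statistics of all blocks of length \<open>2 * n\<close> that are concatenations of hills, generated by their first
hill; there are Catalan many. In \<open>chains\<close> each outermost piece is either a hill or a dip, and below the
outermost level there are only hills.\<close>

function arches :: "nat \<Rightarrow> stat list" where
  "arches 0 = [stat0]"
| "arches (Suc n) = concat (map (\<lambda>i. concat (map (\<lambda>s. map (\<lambda>s'. cat (hill s) s') (arches (n - i))) (arches i)))
     [0..<Suc n])"
  by pat_completeness auto
termination by (relation "measure id") auto

function chains :: "nat \<Rightarrow> stat list" where
  "chains 0 = [stat0]"
| "chains (Suc n) = concat (map (\<lambda>i. concat (map (\<lambda>s. concat (map (\<lambda>s'. [cat (hill s) s', cat (dip s) s'])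
     (chains (n - i)))) (arches i))) [0..<Suc n])"
  by pat_completeness auto
termination by (relation "measure id") auto

declare arches.simps(2) [simp del] chains.simps(2) [simp del]

lemma sum_list_concat_map: "(\<Sum>x\<leftarrow>concat (map g xs). f x) = (\<Sum>y\<leftarrow>xs. \<Sum>x\<leftarrow>g y. (f x :: real))"
  by (induction xs) auto

lemma sum_list_upt: "(\<Sum>i\<leftarrow>[0..<Suc n]. f i) = (\<Sum>i\<le>n. (f i :: real))"
  by (simp only: interv_sum_list_conv_sum_set_nat atMost_atLeast0 atLeastLessThanSuc_atLeastAtMost set_upt)

lemma sum_arches_Suc:
  "(\<Sum>s\<leftarrow>arches (Suc n). f s) = (\<Sum>i\<le>n. \<Sum>s\<leftarrow>arches i. \<Sum>s'\<leftarrow>arches (n - i). f (cat (hill s) s') :: real)"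
  by (simp only: arches.simps sum_list_concat_map sum_list_upt map_map o_def)

lemma sum_chains_Suc:
  "(\<Sum>s\<leftarrow>chains (Suc n). f s) = (\<Sum>i\<le>n. \<Sum>s\<leftarrow>arches i. \<Sum>s'\<leftarrow>chains (n - i). (f (cat (hill s) s') + f (cat (dip s) s')) :: real)"
  by (simp only: chains.simps sum_list_concat_map sum_list_upt map_map o_def) simp

lemma sum_list_sum_swap: "(\<Sum>x\<leftarrow>xs. \<Sum>i\<in>A. f x i) = (\<Sum>i\<in>A. \<Sum>x\<leftarrow>xs. (f x i :: real))"
  by (induction xs) (auto simp: sum.distrib)

lemma sum_list_swap: "(\<Sum>x\<leftarrow>xs. \<Sum>y\<leftarrow>ys. f x y) = (\<Sum>y\<leftarrow>ys. \<Sum>x\<leftarrow>xs. (f x y :: real))"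
  by (induction xs) (auto simp: sum_list_addf)

lemma triple_reindex:
  fixes k :: nat
  shows "(\<Sum>i\<le>k. \<Sum>j\<le>k - i. (g i j (k - i - j) :: real)) = (\<Sum>i\<le>k. \<Sum>j\<le>i. g j (i - j) (k - i))"
proof -
  have "(\<Sum>i\<le>k. \<Sum>j\<le>k - i. g i j (k - i - j)) = (\<Sum>(i, j)\<in>Sigma {..k} (\<lambda>i. {..k - i}). g i j (k - i - j))"
    by (rule sum.Sigma) auto
  also have "\<dots> = (\<Sum>(i, j)\<in>Sigma {..k} (\<lambda>i. {..i}). g j (i - j) (k - i))"
    by (rule sum.reindex_bij_witness[where i = "\<lambda>(i, j). (j, i - j)" and j = "\<lambda>(i, j). (i + j, i)"])
      (auto simp: algebra_simps)
  also have "\<dots> = (\<Sum>i\<le>k. \<Sum>j\<le>i. g j (i - j) (k - i))"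
    by (rule sum.Sigma[symmetric]) auto
  finally show ?thesis .
qed

text \<open>Splitting off the last hill instead of the first one gives the same sums. Both decompositions are
needed: the first one yields an equation for a generating function, the last one for its conjugate.\<close>

lemma sum_arches_Suc':
  "(\<Sum>s\<leftarrow>arches (Suc n). f s) = (\<Sum>i\<le>n. \<Sum>s\<leftarrow>arches i. \<Sum>s'\<leftarrow>arches (n - i). f (cat s (hill s')) :: real)"
proof (induction n arbitrary: f rule: less_induct)
  case (less n)
  show ?case
  proof (cases n)
    case 0
    then show ?thesis by (simp add: sum_arches_Suc)
  next
    case (Suc k)
    define g where "g = (\<lambda>i j l. \<Sum>s\<leftarrow>arches i. \<Sum>a\<leftarrow>arches j. \<Sum>b\<leftarrow>arches l. f (cat (hill s) (cat a (hill b))))"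
    have "(\<Sum>s\<leftarrow>arches (Suc n). f s) = (\<Sum>i\<le>k. \<Sum>s\<leftarrow>arches i. \<Sum>s'\<leftarrow>arches (Suc k - i). f (cat (hill s) s')) +
        (\<Sum>s\<leftarrow>arches n. f (hill s))"
      using sum_arches_Suc[of f "Suc k"] unfolding Suc sum.atMost_Suc by simp
    also have "(\<Sum>i\<le>k. \<Sum>s\<leftarrow>arches i. \<Sum>s'\<leftarrow>arches (Suc k - i). f (cat (hill s) s')) =
        (\<Sum>i\<le>k. \<Sum>s\<leftarrow>arches i. \<Sum>s'\<leftarrow>arches (Suc (k - i)). f (cat (hill s) s'))"
      by (rule sum.cong[OF refl]) (simp only: Suc_diff_le atMost_iff)
    also have "(\<Sum>i\<le>k. \<Sum>s\<leftarrow>arches i. \<Sum>s'\<leftarrow>arches (Suc (k - i)). f (cat (hill s) s')) =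
        (\<Sum>i\<le>k. \<Sum>j\<le>k - i. g i j (k - i - j))"
    proof (rule sum.cong[OF refl])
      fix i
      have ih: "(\<Sum>s'\<leftarrow>arches (Suc (k - i)). F s') = (\<Sum>j\<le>k - i. \<Sum>a\<leftarrow>arches j. \<Sum>b\<leftarrow>arches (k - i - j). F (cat a (hill b)))" for F :: "stat \<Rightarrow> real"
        using less[of "k - i" F] Suc by simp
      show "(\<Sum>s\<leftarrow>arches i. \<Sum>s'\<leftarrow>arches (Suc (k - i)). f (cat (hill s) s')) = (\<Sum>j\<le>k - i. g i j (k - i - j))"
        unfolding ih g_def by (rule sum_list_sum_swap)
    qed
    also have "\<dots> = (\<Sum>i\<le>k. \<Sum>j\<le>i. g j (i - j) (k - i))"
      by (rule triple_reindex)
    also have "\<dots> = (\<Sum>i\<le>k. \<Sum>s\<leftarrow>arches (Suc i). \<Sum>s'\<leftarrow>arches (k - i). f (cat s (hill s')))"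
      unfolding sum_arches_Suc g_def by (simp add: cat_assoc)
    finally have 1: "(\<Sum>s\<leftarrow>arches (Suc n). f s) = (\<Sum>i\<le>k. \<Sum>s\<leftarrow>arches (Suc i). \<Sum>s'\<leftarrow>arches (k - i). f (cat s (hill s'))) +
        (\<Sum>s\<leftarrow>arches n. f (hill s))" .
    have 2: "(\<Sum>i\<le>n. \<Sum>s\<leftarrow>arches i. \<Sum>s'\<leftarrow>arches (n - i). f (cat s (hill s'))) =
        (\<Sum>s\<leftarrow>arches n. f (hill s)) + (\<Sum>i\<le>k. \<Sum>s\<leftarrow>arches (Suc i). \<Sum>s'\<leftarrow>arches (k - i). f (cat s (hill s')))"
      by (simp only: Suc sum.atMost_Suc_shift diff_Suc_Suc arches.simps(1) diff_zero) simp
    show ?thesis unfolding 1 2 by simp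
  qed
qed

definition "cl = (\<lambda>s::stat. fst s)"
definition "cm = (\<lambda>s::stat. fst (snd s))"
definition "cn = (\<lambda>s::stat. fst (snd (snd s)))"
definition "ce = (\<lambda>s::stat. snd (snd (snd s)))"

lemma coords [simp]: "cl (l, m, n, e) = l" "cm (l, m, n, e) = m" "cn (l, m, n, e) = n" "ce (l, m, n, e) = e"
  by (simp_all add: cl_def cm_def cn_def ce_def)

text \<open>The weights 2, 3, 5, 4 of the coordinates are the orders of growth of \<open>l, m, n, e\<close> in terms of the
square root of the length. They are chosen so that \<open>cat\<close> preserves weights while the
difference between \<open>hill\<close> or \<open>dip\<close> and the identity lowers them.\<close>

inductive coord :: "nat \<Rightarrow> (stat \<Rightarrow> real) \<Rightarrow> bool" where
  "coord 2 cl" | "coord 3 cm" | "coord 5 cn" | "coord 4 ce"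

inductive weighted :: "nat \<Rightarrow> (stat \<Rightarrow> real) \<Rightarrow> bool" where
  weighted_const: "weighted d (\<lambda>s. a)"
| weighted_add: "weighted d f \<Longrightarrow> weighted d g \<Longrightarrow> weighted d (\<lambda>s. f s + g s)"
| weighted_coord: "coord w x \<Longrightarrow> weighted d f \<Longrightarrow> w + d \<le> d' \<Longrightarrow> weighted d' (\<lambda>s. x s * f s)"

lemma weighted_mono: "weighted d f \<Longrightarrow> d \<le> d' \<Longrightarrow> weighted d' f"
proof (induction arbitrary: d' rule: weighted.induct)
  case (weighted_coord w x d f d')
  show ?case by (rule weighted.weighted_coord[OF weighted_coord(1,2)]) (use weighted_coord in simp)
qed (auto intro: weighted.intros)

lemma coord_ge2: "coord w x \<Longrightarrow> 2 \<le> w" by (auto elim: coord.cases)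

lemma weighted_low: "weighted d f \<Longrightarrow> d < 2 \<Longrightarrow> f s = f t"
proof (induction arbitrary: s t rule: weighted.induct)
  case (weighted_add d f g)
  then show ?case by metis
next
  case (weighted_coord w x d f d')
  then show ?case using coord_ge2[OF weighted_coord(1)] by simp
qed simp

lemma weighted_of_coord: "coord w x \<Longrightarrow> weighted w x"
  using weighted_coord[of w x 0 "\<lambda>_. 1" w] weighted_const by auto

lemma weighted_cmult: "weighted d f \<Longrightarrow> weighted d (\<lambda>s. a * f s)"
proof (induction rule: weighted.induct)
  case (weighted_const d b)
  then show ?case by (simp add: weighted.weighted_const)
next
  case (weighted_add d f g)
  then show ?case using weighted.weighted_add[OF weighted_add.IH] by (simp add: algebra_simps)
next
  case (weighted_coord w x d f d')
  then show ?case using weighted.weighted_coord[OF weighted_coord(1) weighted_coord.IH, of d'] by (simp add: algebra_simps)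
qed

lemma weighted_mult: "weighted d f \<Longrightarrow> weighted d' g \<Longrightarrow> weighted (d + d') (\<lambda>s. f s * g s)"
proof (induction rule: weighted.induct)
  case (weighted_const d a)
  then show ?case by (rule weighted_mono[OF weighted_cmult]) simp
next
  case (weighted_add d f g)
  then show ?case using weighted.weighted_add[OF weighted_add.IH] by (simp add: algebra_simps)
next
  case (weighted_coord w x d f d'')
  then show ?case using weighted.weighted_coord[OF weighted_coord(1) weighted_coord.IH, of "d'' + d'"]
    by (simp add: algebra_simps)
qed

lemma weighted_diff: "weighted d f \<Longrightarrow> weighted d g \<Longrightarrow> weighted d (\<lambda>s. f s - g s)"
  using weighted_add[OF _ weighted_cmult[of d g "-1"]] by simp
lemma weighted_sum: "(\<And>i. i \<in> A \<Longrightarrow> weighted d (f i)) \<Longrightarrow> weighted d (\<lambda>s. \<Sum>i\<in>A. f i s)"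
  by (induction A rule: infinite_finite_induct) (auto intro: weighted_const weighted_add)
lemma weighted_power: "weighted d f \<Longrightarrow> weighted (k * d) (\<lambda>s. f s ^ k)"
  by (induction k) (auto intro: weighted_const weighted_mult)

lemma weighted_comp:
  assumes "\<And>w x. coord w x \<Longrightarrow> weighted w (\<lambda>s. x (T s))"
  shows "weighted d f \<Longrightarrow> weighted d (\<lambda>s. f (T s))"
proof (induction rule: weighted.induct)
  case (weighted_coord w x d f d')
  then show ?case using weighted_mono[OF weighted_mult[OF assms[OF weighted_coord(1)] weighted_coord.IH]] by simp
qed (auto intro: weighted.intros)

text \<open>A substitution that changes every coordinate only by terms of lower weight changes a polynomial only by
terms of lower weight. This is what makes inductions on the weight work.\<close>

lemma weighted_comp_diff:
  assumes "\<And>w x. coord w x \<Longrightarrow> weighted (w - 1) (\<lambda>s. x (T s) - x s)"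
  shows "weighted d f \<Longrightarrow> weighted (d - 1) (\<lambda>s. f (T s) - f s)"
proof (induction rule: weighted.induct)
  case (weighted_const d a)
  then show ?case by (simp add: weighted.weighted_const)
next
  case (weighted_add d f g)
  then show ?case using weighted.weighted_add[OF weighted_add.IH] by (simp add: algebra_simps)
next
  case (weighted_coord w x d f d')
  have w: "2 \<le> w" by (rule coord_ge2[OF weighted_coord(1)])
  have T: "weighted w (\<lambda>s. x (T s))"
    using weighted_add[OF weighted_mono[OF assms[OF weighted_coord(1)]] weighted_of_coord[OF weighted_coord(1)]] by simp
  have 1: "weighted (d' - 1) (\<lambda>s. (x (T s) - x s) * f s)"
    using weighted_mono[OF weighted_mult[OF assms[OF weighted_coord(1)] weighted_coord(2)]] weighted_coord w by simp
  have 2: "weighted (d' - 1) (\<lambda>s. x (T s) * (f (T s) - f s))"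
  proof (cases "d = 0")
    case True
    then have "(\<lambda>s. x (T s) * (f (T s) - f s)) = (\<lambda>s. 0)"
      using weighted_low[OF weighted_coord(2)] by (auto simp: fun_eq_iff)
    then show ?thesis by (simp add: weighted_const)
  next
    case False
    then show ?thesis
      using weighted_mono[OF weighted_mult[OF T weighted_coord.IH]] weighted_coord w by simp
  qed
  show ?case using weighted_add[OF 1 2] by (simp add: algebra_simps)
qed

lemma weighted_coords: "weighted 2 cl" "weighted 3 cm" "weighted 5 cn" "weighted 4 ce"
  by (auto intro!: weighted_of_coord coord.intros)

definition tame :: "(stat \<Rightarrow> stat) \<Rightarrow> bool" where
  "tame T \<longleftrightarrow> (\<forall>w x. coord w x \<longrightarrow> weighted w (\<lambda>s. x (T s)))"

lemma weighted_tame: "tame T \<Longrightarrow> weighted d f \<Longrightarrow> weighted d (\<lambda>s. f (T s))"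
  using weighted_comp[of T d f] unfolding tame_def by blast

lemma map_coords:
  "cl (dip s) = cl s + 2" "cm (dip s) = cm s" "cn (dip s) = cn s + cm s" "ce (dip s) = ce s"
  "cl (hill s) = cl s + 2" "cm (hill s) = cm s + (cl s + 2) / 2"
  "cn (hill s) = cn s + cm s + (cl s + 2)\<^sup>2 / 4" "ce (hill s) = ce s + cm s + (cl s + 2) / 4"
  "cl (sgn_flip s) = cl s" "cm (sgn_flip s) = - cm s" "cn (sgn_flip s) = - cn s" "ce (sgn_flip s) = ce s"
  "cl (kap s) = cl s" "cm (kap s) = - cm s - (cl s + 2) / 2" "cn (kap s) = - cn s - (cl s + 2) * cl s / 4"
  "ce (kap s) = ce s + cm s + (cl s + 2) / 4"
  by (cases s, simp add: hill_def)+

lemma weighted_affine: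
  assumes "\<And>s. f s = a * cl s + (b * cm s + (c * cn s + (g * ce s + (h * (cl s * cl s) + k))))"
    and "a = 0 \<or> 2 \<le> d" "b = 0 \<or> 3 \<le> d" "c = 0 \<or> 5 \<le> d" "g = 0 \<or> 4 \<le> d" "h = 0 \<or> 4 \<le> d"
  shows "weighted d f"
proof -
  have z: "weighted d (\<lambda>s. r * x s)" if "r = 0 \<or> w \<le> d" "weighted w x" for r w x
  proof (cases "r = 0")
    case True
    then show ?thesis using weighted_const[of d 0] by simp
  next
    case False
    then show ?thesis using that weighted_mono[OF weighted_cmult[OF that(2)]] by simp
  qed
  have "weighted d (\<lambda>s. a * cl s + (b * cm s + (c * cn s + (g * ce s + (h * (cl s * cl s) + k)))))"
    using assms(2-) weighted_mult[OF weighted_coords(1) weighted_coords(1)] weighted_coords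
    by (intro weighted_add weighted_const z[of _ 2 cl] z[of _ 3 cm] z[of _ 5 cn] z[of _ 4 ce]
        z[of _ 4 "\<lambda>s. cl s * cl s"]) auto
  moreover have "f = (\<lambda>s. a * cl s + (b * cm s + (c * cn s + (g * ce s + (h * (cl s * cl s) + k)))))"
    using assms(1) by (rule ext)
  ultimately show ?thesis by simp
qed

lemma tame_maps: "tame dip" "tame hill" "tame sgn_flip" "tame kap"
proof -
  have t: "tame T" if "weighted 2 (\<lambda>s. cl (T s))" "weighted 3 (\<lambda>s. cm (T s))" "weighted 5 (\<lambda>s. cn (T s))"
    "weighted 4 (\<lambda>s. ce (T s))" for T
    unfolding tame_def using that by (auto elim!: coord.cases)
  show "tame dip"
    by (rule t; unfold map_coords)
      (rule weighted_affine[of _ 1 0 0 0 0 2] weighted_affine[of _ 0 1 0 0 0 0] weighted_affine[of _ 0 1 1 0 0 0]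
        weighted_affine[of _ 0 0 0 1 0 0]; simp; fail)+
  show "tame sgn_flip"
    by (rule t; unfold map_coords)
      (rule weighted_affine[of _ 1 0 0 0 0 0] weighted_affine[of _ 0 "-1" 0 0 0 0] weighted_affine[of _ 0 0 "-1" 0 0 0]
        weighted_affine[of _ 0 0 0 1 0 0]; simp; fail)+
  show "tame hill"
    by (rule t; unfold map_coords)
      (rule weighted_affine[of _ 1 0 0 0 0 2] weighted_affine[of _ "1/2" 1 0 0 0 1] weighted_affine[of _ 1 1 1 0 "1/4" 1]
        weighted_affine[of _ "1/4" 1 0 1 0 "1/2"]; simp add: power2_eq_square field_simps; fail)+
  show "tame kap"
    by (rule t; unfold map_coords)
      (rule weighted_affine[of _ 1 0 0 0 0 0] weighted_affine[of _ "-1/2" "-1" 0 0 0 "-1"] weighted_affine[of _ "-1/2" 0 "-1" 0 "-1/4" 0]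
        weighted_affine[of _ "1/4" 1 0 1 0 "1/2"]; simp add: power2_eq_square field_simps; fail)+
qed

lemma weighted_maps_diff:
  assumes "weighted d f"
  shows "weighted (d - 1) (\<lambda>s. f (hill s) - f s)" "weighted (d - 1) (\<lambda>s. f (hill s) - f (dip s))"
proof -
  have t: "weighted (d - 1) (\<lambda>s. f (T s) - f s)" if "weighted 1 (\<lambda>s. cl (T s) - cl s)" "weighted 2 (\<lambda>s. cm (T s) - cm s)"
    "weighted 4 (\<lambda>s. cn (T s) - cn s)" "weighted 3 (\<lambda>s. ce (T s) - ce s)" for T
    by (rule weighted_comp_diff[OF _ assms]) (use that in \<open>auto elim!: coord.cases\<close>)
  show h: "weighted (d - 1) (\<lambda>s. f (hill s) - f s)"
    by (rule t; unfold map_coords)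
      (rule weighted_affine[of _ 0 0 0 0 0 2] weighted_affine[of _ "1/2" 0 0 0 0 1] weighted_affine[of _ 1 1 0 0 "1/4" 1]
        weighted_affine[of _ "1/4" 1 0 0 0 "1/2"]; simp add: power2_eq_square field_simps; fail)+
  have "weighted (d - 1) (\<lambda>s. f (dip s) - f s)"
    by (rule t; unfold map_coords)
      (rule weighted_affine[of _ 0 0 0 0 0 2] weighted_affine[of _ 0 1 0 0 0 0] weighted_affine[of _ 0 0 0 0 0 0]; simp; fail)+
  from weighted_diff[OF h this] show "weighted (d - 1) (\<lambda>s. f (hill s) - f (dip s))" by simp
qed

text \<open>The inductive step of the splitting below, for a coordinate \<open>x\<close> that is additive under \<open>cat\<close>.\<close>

lemma weighted_split_coord:
  assumes x: "weighted w x" "2 \<le> w" "x stat0 = 0"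
    and f: "weighted d f" "2 \<le> d"
    and ps': "\<forall>(g, h)\<in>set ps. \<exists>d1 d2. weighted d1 g \<and> weighted d2 h \<and> 2 \<le> d1 \<and> 2 \<le> d2 \<and> d1 + d2 \<le> d \<and> g stat0 = 0 \<and> h stat0 = 0"
    and eq': "\<forall>s t. f (cat s t) = f s + f t - f stat0 + (\<Sum>(g, h)\<leftarrow>ps. g s * h t)"
  defines "qs \<equiv> (x, \<lambda>t. f t - f stat0) # (\<lambda>s. f s - f stat0, x) #
      map (\<lambda>(g, h). (\<lambda>s. x s * g s, h)) ps @ map (\<lambda>(g, h). (g, \<lambda>t. x t * h t)) ps"
  shows "\<And>g h. (g, h) \<in> set qs \<Longrightarrow> \<exists>d1 d2. weighted d1 g \<and> weighted d2 h \<and> 2 \<le> d1 \<and> 2 \<le> d2 \<and> d1 + d2 \<le> w + d \<and> g stat0 = 0 \<and> h stat0 = 0"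
    and "(x s + x t) * f (cat s t) = x s * f s + x t * f t + (\<Sum>(g, h)\<leftarrow>qs. g s * h t)"
proof -
  have ps: "\<exists>d1 d2. weighted d1 g \<and> weighted d2 h \<and> 2 \<le> d1 \<and> 2 \<le> d2 \<and> d1 + d2 \<le> d \<and> g stat0 = 0 \<and> h stat0 = 0" if "(g, h) \<in> set ps" for g h
    using ps' that by blast
  fix g h assume "(g, h) \<in> set qs"
  then consider "g = x" "h = (\<lambda>t. f t - f stat0)" | "g = (\<lambda>t. f t - f stat0)" "h = x"
    | g' where "(g', h) \<in> set ps" "g = (\<lambda>s. x s * g' s)" | h' where "(g, h') \<in> set ps" "h = (\<lambda>s. x s * h' s)"
    unfolding qs_def by auto
  then show "\<exists>d1 d2. weighted d1 g \<and> weighted d2 h \<and> 2 \<le> d1 \<and> 2 \<le> d2 \<and> d1 + d2 \<le> w + d \<and> g stat0 = 0 \<and> h stat0 = 0"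
  proof cases
    case 1
    then show ?thesis using x f weighted_diff[OF f(1) weighted_const[of d "f stat0"]] by auto
  next
    case 2
    then show ?thesis using x f weighted_diff[OF f(1) weighted_const[of d "f stat0"]] by (intro exI[of _ d] exI[of _ w]) auto
  next
    case 3
    from ps[OF 3(1)] obtain d1 d2 where "weighted d1 g'" "weighted d2 h" "2 \<le> d1" "2 \<le> d2" "d1 + d2 \<le> d" "g' stat0 = 0" "h stat0 = 0" by blast
    then show ?thesis using weighted_mult[OF x(1), of d1 g'] 3(2) by (intro exI[of _ "w + d1"] exI[of _ d2]) auto
  next
    case 4
    from ps[OF 4(1)] obtain d1 d2 where "weighted d1 g" "weighted d2 h'" "2 \<le> d1" "2 \<le> d2" "d1 + d2 \<le> d" "g stat0 = 0" "h' stat0 = 0" by blast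
    then show ?thesis using weighted_mult[OF x(1), of d2 h'] 4(2) by (intro exI[of _ d1] exI[of _ "w + d2"]) auto
  qed
next
  have 1: "(\<Sum>(g, h)\<leftarrow>map (\<lambda>(g, h). (\<lambda>s. x s * g s, h)) ps. g s * h t) = x s * (\<Sum>(g, h)\<leftarrow>ps. g s * h t)"
    by (simp add: sum_list_const_mult[symmetric] case_prod_unfold o_def mult.assoc)
  have 2: "(\<Sum>(g, h)\<leftarrow>map (\<lambda>(g, h). (g, \<lambda>t. x t * h t)) ps. g s * h t) = x t * (\<Sum>(g, h)\<leftarrow>ps. g s * h t)"
    by (simp add: sum_list_const_mult[symmetric] case_prod_unfold o_def mult.left_commute)
  have eq: "f (cat s t) = f s + f t - f stat0 + (\<Sum>(g, h)\<leftarrow>ps. g s * h t)" for s t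
    using eq' by blast
  show "(x s + x t) * f (cat s t) = x s * f s + x t * f t + (\<Sum>(g, h)\<leftarrow>qs. g s * h t)"
    unfolding qs_def eq list.map sum_list.Cons map_append sum_list_append 1 2 by (simp add: algebra_simps)
qed

lemma cat_coords:
  "cl (cat s t) = cl s + cl t" "cm (cat s t) = cm s + cm t" "cn (cat s t) = cn s + cn t + cl s * cm t"
  "ce (cat s t) = ce s + ce t"
  by (cases s; cases t; simp)+

text \<open>Polynomials are dual to concatenation: \<open>f (cat s t)\<close> is \<open>f s + f t\<close> up to a finite sum of products in
which both factors have strictly smaller weight and vanish at the empty statistic. The only coordinate that
is not additive is the column sum, whose extra term is the product of the length of the left and the number
of cells of the right part.\<close>

lemma weighted_split:
  assumes "weighted d f"
  obtains ps where
    "\<And>g h. (g, h) \<in> set ps \<Longrightarrow> \<exists>d1 d2. weighted d1 g \<and> weighted d2 h \<and> 2 \<le> d1 \<and> 2 \<le> d2 \<and> d1 + d2 \<le> d \<and> g stat0 = 0 \<and> h stat0 = 0"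
    "\<And>s t. f (cat s t) = f s + f t - f stat0 + (\<Sum>(g, h)\<leftarrow>ps. g s * h t)"
proof -
  have "\<exists>ps. (\<forall>(g, h)\<in>set ps. \<exists>d1 d2. weighted d1 g \<and> weighted d2 h \<and> 2 \<le> d1 \<and> 2 \<le> d2 \<and> d1 + d2 \<le> d \<and> g stat0 = 0 \<and> h stat0 = 0) \<and>
    (\<forall>s t. f (cat s t) = f s + f t - f stat0 + (\<Sum>(g, h)\<leftarrow>ps. g s * h t))"
    using assms
  proof (induction rule: weighted.induct)
    case (weighted_const d a)
    then show ?case by (intro exI[of _ "[]"]) simp
  next
    case (weighted_add d f f')
    then obtain ps qs where
      "\<forall>(g, h)\<in>set ps. \<exists>d1 d2. weighted d1 g \<and> weighted d2 h \<and> 2 \<le> d1 \<and> 2 \<le> d2 \<and> d1 + d2 \<le> d \<and> g stat0 = 0 \<and> h stat0 = 0"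
      "\<forall>s t. f (cat s t) = f s + f t - f stat0 + (\<Sum>(g, h)\<leftarrow>ps. g s * h t)"
      "\<forall>(g, h)\<in>set qs. \<exists>d1 d2. weighted d1 g \<and> weighted d2 h \<and> 2 \<le> d1 \<and> 2 \<le> d2 \<and> d1 + d2 \<le> d \<and> g stat0 = 0 \<and> h stat0 = 0"
      "\<forall>s t. f' (cat s t) = f' s + f' t - f' stat0 + (\<Sum>(g, h)\<leftarrow>qs. g s * h t)" by blast
    then show ?case by (intro exI[of _ "ps @ qs"]) auto
  next
    case (weighted_coord w x d f d')
    have x: "weighted w x" "2 \<le> w" "x stat0 = 0"
      using weighted_of_coord[OF weighted_coord(1)] coord_ge2[OF weighted_coord(1)] weighted_coord(1)
      by (auto elim!: coord.cases)
    have cat_x: "x (cat s t) = x s + x t \<or> (x = cn \<and> w = 5 \<and> x (cat s t) = x s + x t + cl s * cm t)" for s t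
      using weighted_coord(1) by (auto elim!: coord.cases simp: cat_coords)
    show ?case
    proof (cases "2 \<le> d")
      case False
      define a where "a = f stat0"
      have f: "f = (\<lambda>_. a)" using weighted_low[OF weighted_coord(2)] False unfolding a_def by (intro ext) simp
      show ?thesis
      proof (cases "x = cn \<and> w = 5")
        case True
        have w: "\<exists>d1 d2. weighted d1 cl \<and> weighted d2 (\<lambda>s. a * cm s) \<and> 2 \<le> d1 \<and> 2 \<le> d2 \<and> d1 + d2 \<le> d' \<and> cl stat0 = 0 \<and> a * cm stat0 = 0"
          using weighted_coord(3) weighted_coords weighted_cmult[OF weighted_coords(2)] True
          by (intro exI[of _ "2::nat"] exI[of _ "3::nat"]) simp
        moreover have "x (cat s t) * f (cat s t) = x s * f s + x t * f t - x stat0 * f stat0 + (\<Sum>(g, h)\<leftarrow>[(cl, \<lambda>s. a * cm s)]. g s * h t)" for s t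
          using True unfolding f by (simp add: cat_coords algebra_simps)
        ultimately show ?thesis
          using w by (intro exI[of _ "[(cl, \<lambda>s. a * cm s)]"] conjI)
            (simp_all only: list.set ball_simps prod.case simp_thms)
      next
        case False
        have "x (cat s t) * f (cat s t) = x s * f s + x t * f t - x stat0 * f stat0" for s t
          using cat_x[of s t] False x(3) unfolding f by (auto simp: algebra_simps)
        then show ?thesis by (intro exI[of _ "[]"]) simp
      qed
    next
      case True
      obtain ps where ps': "\<forall>(g, h)\<in>set ps. \<exists>d1 d2. weighted d1 g \<and> weighted d2 h \<and> 2 \<le> d1 \<and> 2 \<le> d2 \<and> d1 + d2 \<le> d \<and> g stat0 = 0 \<and> h stat0 = 0"
        and eq': "\<forall>s t. f (cat s t) = f s + f t - f stat0 + (\<Sum>(g, h)\<leftarrow>ps. g s * h t)"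
        using weighted_coord.IH by blast
      have ps: "\<exists>d1 d2. weighted d1 g \<and> weighted d2 h \<and> 2 \<le> d1 \<and> 2 \<le> d2 \<and> d1 + d2 \<le> d \<and> g stat0 = 0 \<and> h stat0 = 0" if "(g, h) \<in> set ps" for g h
        using ps' that by blast
      have eq: "f (cat s t) = f s + f t - f stat0 + (\<Sum>(g, h)\<leftarrow>ps. g s * h t)" for s t
        using eq' by blast
      note sp = weighted_split_coord[OF x weighted_coord(2) True ps' eq']
      let ?qs = "(x, \<lambda>t. f t - f stat0) # (\<lambda>s. f s - f stat0, x) #
        map (\<lambda>(g, h). (\<lambda>s. x s * g s, h)) ps @ map (\<lambda>(g, h). (g, \<lambda>t. x t * h t)) ps"
      have q1: "\<exists>d1 d2. weighted d1 g \<and> weighted d2 h \<and> 2 \<le> d1 \<and> 2 \<le> d2 \<and> d1 + d2 \<le> d' \<and> g stat0 = 0 \<and> h stat0 = 0"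
        if gh: "(g, h) \<in> set ?qs" for g h
      proof -
        obtain d1 d2 where "weighted d1 g" "weighted d2 h" "2 \<le> d1" "2 \<le> d2" "d1 + d2 \<le> w + d" "g stat0 = 0" "h stat0 = 0"
          using sp(1)[OF gh] by blast
        then show ?thesis using weighted_coord(3) by (intro exI[of _ d1] exI[of _ d2]) simp
      qed
      show ?thesis
      proof (cases "x = cn \<and> w = 5")
        case cn: True
        let ?rs = "(\<lambda>s. cl s * f s, cm) # (cl, \<lambda>t. cm t * f t) # (\<lambda>s. - f stat0 * cl s, cm) #
          map (\<lambda>(g, h). (\<lambda>s. cl s * g s, \<lambda>t. cm t * h t)) ps"
        have r1: "\<exists>d1 d2. weighted d1 g \<and> weighted d2 h \<and> 2 \<le> d1 \<and> 2 \<le> d2 \<and> d1 + d2 \<le> d' \<and> g stat0 = 0 \<and> h stat0 = 0"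
          if gh: "(g, h) \<in> set ?rs" for g h
        proof -
          from gh consider "g = (\<lambda>s. cl s * f s)" "h = cm" | "g = cl" "h = (\<lambda>t. cm t * f t)"
            | "g = (\<lambda>s. - f stat0 * cl s)" "h = cm"
            | g' h' where "(g', h') \<in> set ps" "g = (\<lambda>s. cl s * g' s)" "h = (\<lambda>t. cm t * h' t)" by auto
          then show ?thesis
          proof cases
            case 1
            then show ?thesis using weighted_mult[OF weighted_coords(1) weighted_coord(2)] weighted_coords(2) weighted_coord(3) cn
              by (intro exI[of _ "2 + d"] exI[of _ 3]) auto
          next
            case 2
            then show ?thesis using weighted_mult[OF weighted_coords(2) weighted_coord(2)] weighted_coords(1) weighted_coord(3) cn
              by (intro exI[of _ 2] exI[of _ "3 + d"]) auto
          next
            case 3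
            then show ?thesis using weighted_cmult[OF weighted_coords(1), of "- f stat0"] weighted_coords(2) weighted_coord(3) cn
              by (intro exI[of _ 2] exI[of _ 3]) auto
          next
            case 4
            from ps[OF 4(1)] obtain d1 d2 where "weighted d1 g'" "weighted d2 h'" "2 \<le> d1" "2 \<le> d2" "d1 + d2 \<le> d" by blast
            then show ?thesis
              using 4 weighted_mult[OF weighted_coords(1), of d1 g'] weighted_mult[OF weighted_coords(2), of d2 h'] weighted_coord(3) cn
              by (intro exI[of _ "2 + d1"] exI[of _ "3 + d2"]) auto
          qed
        qed
        have r2: "(\<Sum>(g, h)\<leftarrow>?rs. g s * h t) = cl s * cm t * f (cat s t)" for s t
        proof -
          have "(\<Sum>(g, h)\<leftarrow>map (\<lambda>(g, h). (\<lambda>s. cl s * g s, \<lambda>t. cm t * h t)) ps. g s * h t) =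
              cl s * cm t * (\<Sum>(g, h)\<leftarrow>ps. g s * h t)"
            by (simp add: sum_list_const_mult[symmetric] case_prod_unfold o_def mult_ac)
          then show ?thesis unfolding eq by (simp add: algebra_simps)
        qed
        have "x (cat s t) * f (cat s t) = x s * f s + x t * f t - x stat0 * f stat0 + (\<Sum>(g, h)\<leftarrow>?qs @ ?rs. g s * h t)" for s t
        proof -
          have "x (cat s t) * f (cat s t) = (x s + x t) * f (cat s t) + cl s * cm t * f (cat s t)"
            using cn by (simp add: cat_coords algebra_simps)
          then show ?thesis unfolding sp(2) r2[symmetric] map_append sum_list_append x(3) by linarith
        qed
        moreover have "\<forall>(g, h)\<in>set (?qs @ ?rs). \<exists>d1 d2. weighted d1 g \<and> weighted d2 h \<and> 2 \<le> d1 \<and> 2 \<le> d2 \<and> d1 + d2 \<le> d' \<and> g stat0 = 0 \<and> h stat0 = 0"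
          using q1 r1 unfolding set_append by blast
        ultimately show ?thesis by blast
      next
        case False
        have "x (cat s t) * f (cat s t) = x s * f s + x t * f t - x stat0 * f stat0 + (\<Sum>(g, h)\<leftarrow>?qs. g s * h t)" for s t
        proof -
          have "x (cat s t) = x s + x t" using cat_x[of s t] False by auto
          then show ?thesis using sp(2)[of s t] x(3) by simp
        qed
        then show ?thesis using q1 by blast
      qed
    qed
  qed
  then show ?thesis using that by blast
qed

section \<open>Generating functions of blocks and the square root\<close>

unbundle fps_syntax

definition stat_fps :: "(nat \<Rightarrow> stat list) \<Rightarrow> (stat \<Rightarrow> real) \<Rightarrow> real fps" where
  "stat_fps P f = Abs_fps (\<lambda>i. \<Sum>s\<leftarrow>P i. f s)"

lemma stat_fps_nth [simp]: "stat_fps P f $ i = (\<Sum>s\<leftarrow>P i. f s)" by (simp add: stat_fps_def)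
lemma stat_fps_add: "stat_fps P (\<lambda>s. f s + g s) = stat_fps P f + stat_fps P g"
  by (rule fps_ext) (simp add: sum_list_addf)
lemma stat_fps_diff: "stat_fps P (\<lambda>s. f s - g s) = stat_fps P f - stat_fps P g"
  by (rule fps_ext) (simp add: sum_list_subtractf)
lemma stat_fps_cmult: "stat_fps P (\<lambda>s. a * f s) = fps_const a * stat_fps P f"
  by (rule fps_ext) (simp add: sum_list_const_mult)

lemma fps_sum_list_nth: "(\<Sum>x\<leftarrow>xs. F x) $ n = (\<Sum>x\<leftarrow>xs. (F x :: real fps) $ n)"
  by (induction xs) auto

lemma stat_fps_sum_list: "stat_fps P (\<lambda>s. \<Sum>x\<leftarrow>xs. F x s) = (\<Sum>x\<leftarrow>xs. stat_fps P (F x))"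
  by (rule fps_ext, simp only: stat_fps_nth fps_sum_list_nth) (rule sum_list_swap)

lemma stat_fps_conv:
  "(\<Sum>i\<le>n. \<Sum>s\<leftarrow>P i. \<Sum>t\<leftarrow>Q (n - i). \<Sum>x\<leftarrow>xs. g x s * h x t) = (\<Sum>x\<leftarrow>xs. stat_fps P (g x) * stat_fps Q (h x)) $ n"
proof -
  have "(\<Sum>i\<le>n. \<Sum>s\<leftarrow>P i. \<Sum>t\<leftarrow>Q (n - i). \<Sum>x\<leftarrow>xs. g x s * h x t) =
      (\<Sum>i\<le>n. \<Sum>x\<leftarrow>xs. (\<Sum>s\<leftarrow>P i. g x s) * (\<Sum>t\<leftarrow>Q (n - i). h x t))"
  proof (rule sum.cong[OF refl])
    fix i
    have "(\<Sum>s\<leftarrow>P i. \<Sum>t\<leftarrow>Q (n - i). \<Sum>x\<leftarrow>xs. g x s * h x t) =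
        (\<Sum>s\<leftarrow>P i. \<Sum>x\<leftarrow>xs. g x s * (\<Sum>t\<leftarrow>Q (n - i). h x t))"
      by (subst sum_list_swap) (simp add: sum_list_const_mult)
    also have "\<dots> = (\<Sum>x\<leftarrow>xs. (\<Sum>s\<leftarrow>P i. g x s) * (\<Sum>t\<leftarrow>Q (n - i). h x t))"
      by (subst sum_list_swap) (simp add: sum_list_mult_const)
    finally show "(\<Sum>s\<leftarrow>P i. \<Sum>t\<leftarrow>Q (n - i). \<Sum>x\<leftarrow>xs. g x s * h x t) =
      (\<Sum>x\<leftarrow>xs. (\<Sum>s\<leftarrow>P i. g x s) * (\<Sum>t\<leftarrow>Q (n - i). h x t))" .
  qed
  also have "\<dots> = (\<Sum>x\<leftarrow>xs. stat_fps P (g x) * stat_fps Q (h x)) $ n"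
    by (simp add: fps_sum_list_nth fps_mult_nth atMost_atLeast0 sum_list_sum_swap)
  finally show ?thesis .
qed

definition arch_fps :: "(stat \<Rightarrow> real) \<Rightarrow> real fps" where "arch_fps f = fps_X * stat_fps arches f"

lemma arch_fps_add: "arch_fps (\<lambda>s. f s + g s) = arch_fps f + arch_fps g" by (simp add: arch_fps_def stat_fps_add algebra_simps)
lemma arch_fps_diff: "arch_fps (\<lambda>s. f s - g s) = arch_fps f - arch_fps g" by (simp add: arch_fps_def stat_fps_diff algebra_simps)
lemma arch_fps_cmult: "arch_fps (\<lambda>s. a * f s) = fps_const a * arch_fps f" by (simp add: arch_fps_def stat_fps_cmult algebra_simps)
lemma arch_fps_sum_list: "arch_fps (\<lambda>s. \<Sum>x\<leftarrow>xs. F x s) = (\<Sum>x\<leftarrow>xs. arch_fps (F x))"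
  by (simp add: arch_fps_def stat_fps_sum_list sum_list_const_mult)
lemma arch_fps_const: "arch_fps (\<lambda>s. a) = fps_const a * arch_fps (\<lambda>s. 1)"
  using arch_fps_cmult[of a "\<lambda>_. 1"] by simp

lemma fps_shift_eqI:
  fixes F :: "real fps"
  assumes "F $ 0 = a" "\<And>n. F $ Suc n = G $ n"
  shows "F = fps_const a + fps_X * G"
proof (rule fps_ext)
  fix n show "F $ n = (fps_const a + fps_X * G) $ n"
    using assms by (cases n) (simp_all add: fps_X_mult_nth)
qed

text \<open>Multiplication of power series mirrors concatenation, so a splitting of \<open>f\<close> along \<open>cat\<close> turns the
decomposition by the first hill into a quadratic equation for the generating functions.\<close>

lemma arch_fps_first:
  assumes "\<And>s t. f (cat s t) = (\<Sum>x\<leftarrow>xs. g x s * h x t)"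
  shows "arch_fps f = fps_X * fps_const (f stat0) + (\<Sum>x\<leftarrow>xs. arch_fps (\<lambda>s. g x (hill s)) * arch_fps (h x))"
proof -
  have "stat_fps arches f = fps_const (f stat0) + fps_X * (\<Sum>x\<leftarrow>xs. stat_fps arches (\<lambda>s. g x (hill s)) * stat_fps arches (h x))"
    by (rule fps_shift_eqI) (simp_all only: stat_fps_nth sum_arches_Suc assms stat_fps_conv[where P = arches and Q = arches], simp)
  then show ?thesis
    by (simp add: arch_fps_def algebra_simps sum_list_const_mult[symmetric])
qed

lemma arch_fps_last:
  assumes "\<And>s t. f (cat s (hill t)) = (\<Sum>x\<leftarrow>xs. g x s * h x t)"
  shows "arch_fps f = fps_X * fps_const (f stat0) + (\<Sum>x\<leftarrow>xs. arch_fps (g x) * arch_fps (h x))"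
proof -
  have "stat_fps arches f = fps_const (f stat0) + fps_X * (\<Sum>x\<leftarrow>xs. stat_fps arches (g x) * stat_fps arches (h x))"
    by (rule fps_shift_eqI) (simp_all only: stat_fps_nth sum_arches_Suc' assms stat_fps_conv[where P = arches and Q = arches], simp)
  then show ?thesis
    by (simp add: arch_fps_def algebra_simps sum_list_const_mult[symmetric])
qed

lemma chains_first:
  assumes "\<And>s t. f (cat s t) = (\<Sum>x\<leftarrow>xs. g x s * h x t)"
  shows "stat_fps chains f = fps_const (f stat0) + (\<Sum>x\<leftarrow>xs. arch_fps (\<lambda>s. g x (hill s) + g x (dip s)) * stat_fps chains (h x))"
proof -
  have "f (cat (hill s) t) + f (cat (dip s) t) = (\<Sum>x\<leftarrow>xs. (g x (hill s) + g x (dip s)) * h x t)" for s t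
    by (simp add: assms sum_list_addf[symmetric] algebra_simps)
  then have "stat_fps chains f = fps_const (f stat0) + fps_X * (\<Sum>x\<leftarrow>xs. stat_fps arches (\<lambda>s. g x (hill s) + g x (dip s)) * stat_fps chains (h x))"
    by (intro fps_shift_eqI) (simp_all only: stat_fps_nth sum_chains_Suc stat_fps_conv[where P = arches and Q = chains], simp)
  then show ?thesis
    by (simp add: arch_fps_def algebra_simps sum_list_const_mult[symmetric])
qed

definition signed_sum :: "(stat \<Rightarrow> real) \<Rightarrow> nat \<Rightarrow> real" where
  "signed_sum f m = (\<Sum>i\<le>m. \<Sum>s\<leftarrow>arches i. \<Sum>t\<leftarrow>chains (m - i). f (cat (hill s) t) - f (cat (dip s) t))"

definition signed_fps :: "(stat \<Rightarrow> real) \<Rightarrow> real fps" where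
  "signed_fps f = fps_X * Abs_fps (signed_sum f)"

lemma signed_fps_eq:
  assumes "\<And>s t. f (cat s t) = (\<Sum>x\<leftarrow>xs. g x s * h x t)"
  shows "signed_fps f = (\<Sum>x\<leftarrow>xs. arch_fps (\<lambda>s. g x (hill s) - g x (dip s)) * stat_fps chains (h x))"
proof -
  have "f (cat (hill s) t) - f (cat (dip s) t) = (\<Sum>x\<leftarrow>xs. (g x (hill s) - g x (dip s)) * h x t)" for s t
    by (simp add: assms sum_list_subtractf[symmetric] algebra_simps)
  then have "Abs_fps (signed_sum f) = (\<Sum>x\<leftarrow>xs. stat_fps arches (\<lambda>s. g x (hill s) - g x (dip s)) * stat_fps chains (h x))"
    by (intro fps_ext) (simp only: signed_sum_def fps_nth_Abs_fps stat_fps_conv[where P = arches and Q = chains])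
  then show ?thesis
    by (simp add: signed_fps_def arch_fps_def algebra_simps sum_list_const_mult[symmetric])
qed

text \<open>For the constant statistic that equation is the one for the Catalan generating function, whose
discriminant is \<open>1 - 4 * X\<close>.\<close>

definition rt :: "real fps" where "rt = 1 - 2 * arch_fps (\<lambda>_. 1)"
definition rt_inv :: "real fps" where "rt_inv = inverse rt"

lemma arch_fps_1: "arch_fps (\<lambda>_. 1) = fps_const (1/2) * (1 - rt)"
proof -
  have "fps_const (1/2) * (2 * x) = x" for x :: "real fps"
  proof -
    have "fps_const (1/2) * (2 * x) = fps_const (1/2) * (fps_const 2 * x)" by (simp add: numeral_fps_const)
    also have "\<dots> = fps_const (1/2 * 2) * x" by (simp only: mult.assoc[symmetric] fps_const_mult)
    finally show ?thesis by simp
  qed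
  then show ?thesis unfolding rt_def by simp
qed

lemma rt_sq: "rt\<^sup>2 = 1 - 4 * fps_X"
proof -
  have "arch_fps (\<lambda>_. 1) = fps_X + arch_fps (\<lambda>_. 1) * arch_fps (\<lambda>_. 1)"
    using arch_fps_first[where f = "\<lambda>_. 1" and xs = "[()]" and g = "\<lambda>_ _. 1" and h = "\<lambda>_ _. 1"] by simp
  then have 1: "arch_fps (\<lambda>_. 1) - arch_fps (\<lambda>_. 1) * arch_fps (\<lambda>_. 1) = fps_X"
    by (metis add_diff_cancel_right')
  have "rt\<^sup>2 = 1 - 4 * (arch_fps (\<lambda>_. 1) - arch_fps (\<lambda>_. 1) * arch_fps (\<lambda>_. 1))"
    unfolding rt_def by (simp add: power2_eq_square algebra_simps)
  then show ?thesis unfolding 1 .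
qed

lemma rt_mult_rt_inv [simp]: "rt * rt_inv = 1" "rt_inv * rt = 1"
proof -
  have "rt $ 0 \<noteq> 0" by (simp add: rt_def arch_fps_def)
  then show "rt * rt_inv = 1" "rt_inv * rt = 1" unfolding rt_inv_def
    by (simp_all add: inverse_mult_eq_1 inverse_mult_eq_1')
qed

text \<open>\<open>conj_pair j k F F'\<close> says that \<open>F\<close> is a combination of \<open>rt * rt_inv ^ i\<close> with \<open>j \<le> i \<le> k\<close> and that \<open>F'\<close> is
its image under \<open>rt \<mapsto> - rt\<close>. Carrying the image along as a second argument avoids the field of fractions
and any question of uniqueness of the representation. The factor \<open>rt\<close> makes the natural product of two
such series \<open>rt_inv * F * G\<close>.\<close>

inductive conj_pair :: "nat \<Rightarrow> nat \<Rightarrow> real fps \<Rightarrow> real fps \<Rightarrow> bool" where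
  conj_pair_base: "j \<le> i \<Longrightarrow> i \<le> k \<Longrightarrow> conj_pair j k (fps_const a * (rt * rt_inv ^ i)) (fps_const a * (- rt * (- rt_inv) ^ i))"
| conj_pair_add: "conj_pair j k F F' \<Longrightarrow> conj_pair j k G G' \<Longrightarrow> conj_pair j k (F + G) (F' + G')"

lemma conj_pair_mono: "conj_pair j k F F' \<Longrightarrow> k \<le> k' \<Longrightarrow> conj_pair j k' F F'"
proof (induction arbitrary: k' rule: conj_pair.induct)
  case (conj_pair_base j i k a)
  show ?case by (rule conj_pair.conj_pair_base) (use conj_pair_base in simp_all)
next
  case (conj_pair_add j k F F' G G')
  show ?case by (rule conj_pair.conj_pair_add) (use conj_pair_add in simp_all)
qed

lemma conj_pair_mult_base:
  "conj_pair j' k' G G' \<Longrightarrow> j \<le> i \<Longrightarrow> i \<le> k \<Longrightarrow>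
    conj_pair (j + j') (k + k') (rt_inv * (fps_const a * (rt * rt_inv ^ i)) * G) (- (rt_inv * (fps_const a * (- rt * (- rt_inv) ^ i)) * G'))"
proof (induction rule: conj_pair.induct)
  case (conj_pair_base j' i' k' b)
  have "rt_inv * (fps_const a * (rt * rt_inv ^ i)) * (fps_const b * (rt * rt_inv ^ i')) = (rt_inv * rt) * (fps_const (a * b) * (rt * rt_inv ^ (i + i')))"
    by (simp only: fps_const_mult[symmetric] power_add mult_ac)
  moreover have "- (rt_inv * (fps_const a * (- rt * (- rt_inv) ^ i)) * (fps_const b * (- rt * (- rt_inv) ^ i'))) =
      (rt_inv * rt) * (fps_const (a * b) * (- rt * (- rt_inv) ^ (i + i')))"
    by (simp only: fps_const_mult[symmetric] power_add mult_ac minus_mult_left[symmetric] minus_mult_right[symmetric] minus_minus)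
  moreover have "conj_pair (j + j') (k + k') (fps_const (a * b) * (rt * rt_inv ^ (i + i'))) (fps_const (a * b) * (- rt * (- rt_inv) ^ (i + i')))"
    using conj_pair_base by (intro conj_pair.conj_pair_base) simp_all
  ultimately show ?case by (simp only: rt_mult_rt_inv(2) mult_1)
next
  case (conj_pair_add j' k' F F' G G')
  then show ?case using conj_pair.conj_pair_add[OF conj_pair_add.IH] by (simp add: algebra_simps)
qed

lemma conj_pair_mult: "conj_pair j k F F' \<Longrightarrow> conj_pair j' k' G G' \<Longrightarrow> conj_pair (j + j') (k + k') (rt_inv * F * G) (- (rt_inv * F' * G'))"
proof (induction rule: conj_pair.induct)
  case (conj_pair_base j i k a)
  then show ?case using conj_pair_mult_base by blast
next
  case (conj_pair_add j k F F' H H')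
  then show ?case using conj_pair.conj_pair_add[OF conj_pair_add.IH] by (simp add: algebra_simps)
qed

lemma conj_pair_times_rt: "conj_pair j (Suc k) F F' \<Longrightarrow> 0 < j \<Longrightarrow> conj_pair (j - 1) k (rt * F) (- rt * F')"
proof (induction j "Suc k" F F' rule: conj_pair.induct)
  case (conj_pair_base j i a)
  then obtain i' where i: "i = Suc i'" by (cases i) auto
  have "rt * (fps_const a * (rt * rt_inv ^ i)) = (rt_inv * rt) * (fps_const a * (rt * rt_inv ^ i'))"
    "- rt * (fps_const a * (- rt * (- rt_inv) ^ i)) = (rt_inv * rt) * (fps_const a * (- rt * (- rt_inv) ^ i'))"
    unfolding i by (simp_all only: power_Suc mult_ac minus_mult_left[symmetric] minus_mult_right[symmetric] minus_minus)
  moreover have "conj_pair (j - 1) k (fps_const a * (rt * rt_inv ^ i')) (fps_const a * (- rt * (- rt_inv) ^ i'))"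
    using conj_pair_base i by (intro conj_pair.conj_pair_base) simp_all
  ultimately show ?case by (simp only: rt_mult_rt_inv(2) mult_1)
next
  case (conj_pair_add j F F' G G')
  then show ?case using conj_pair.conj_pair_add[OF conj_pair_add.hyps(2) conj_pair_add.hyps(4)] by (simp add: algebra_simps)
qed

lemma conj_pair_times:
  assumes "conj_pair j k F F'" "conj_pair (Suc j') (Suc k') G G'"
  shows "conj_pair (j + j') (k + k') (F * G) (F' * G')"
proof -
  have 1: "rt * (rt_inv * F * G) = (rt_inv * rt) * (F * G)" "- rt * (- (rt_inv * F' * G')) = (rt_inv * rt) * (F' * G')"
    by (simp_all only: mult_ac minus_mult_left[symmetric] minus_mult_right[symmetric] minus_minus)
  have 2: "conj_pair (Suc (j + j')) (Suc (k + k')) (rt_inv * F * G) (- (rt_inv * F' * G'))"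
    using conj_pair_mult[OF assms] by simp
  show ?thesis using conj_pair_times_rt[OF 2] unfolding 1 by simp
qed

lemma conj_pair_zero: "j \<le> k \<Longrightarrow> conj_pair j k 0 0"
  using conj_pair_base[of j k k 0] by simp

lemma conj_pair_sum_list: "(\<And>x. x \<in> set xs \<Longrightarrow> conj_pair j k (F x) (F' x)) \<Longrightarrow> j \<le> k \<Longrightarrow> conj_pair j k (\<Sum>x\<leftarrow>xs. F x) (\<Sum>x\<leftarrow>xs. F' x)"
  by (induction xs) (auto intro: conj_pair_zero conj_pair_add)

text \<open>A series that is its own conjugate has only even powers: the odd ones cancel in the sum of the two.\<close>

lemma conj_pair_even:
  assumes "conj_pair 1 k F F'"
  shows "\<exists>a. F + F' = (\<Sum>j\<le>(k - 1) div 2. fps_const (a j) * rt_inv ^ (2 * j))"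
  using assms
proof (induction "1::nat" k F F' rule: conj_pair.induct)
  case (conj_pair_base i k b)
  obtain i' where i: "i = Suc i'" using conj_pair_base by (cases i) auto
  have e: "fps_const b * (rt * rt_inv ^ i) = fps_const b * rt_inv ^ i'" 
    unfolding i power_Suc by (simp add: mult.assoc[symmetric])
  have "- rt * (- rt_inv) ^ i = (rt * rt_inv) * (- rt_inv) ^ i'" unfolding i power_Suc by (simp only: mult_ac minus_mult_left[symmetric] minus_mult_right[symmetric] minus_minus)
  then have o: "fps_const b * (- rt * (- rt_inv) ^ i) = fps_const b * (- rt_inv) ^ i'" by simp
  show ?case
  proof (cases "even i'")
    case True
    then obtain j where j: "i' = 2 * j" by blast
    have "(\<Sum>t\<le>(k - 1) div 2. fps_const (if t = j then 2 * b else 0) * rt_inv ^ (2 * t)) =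
        (\<Sum>t\<le>(k - 1) div 2. if t = j then fps_const (2 * b) * rt_inv ^ (2 * j) else 0)"
      by (rule sum.cong) auto
    also have "\<dots> = fps_const (2 * b) * rt_inv ^ (2 * j)"
      using conj_pair_base i j by simp
    also have "\<dots> = fps_const b * rt_inv ^ i' + fps_const b * (- rt_inv) ^ i'"
    proof -
      have "fps_const (2 * b) = fps_const b + fps_const b" by (simp add: fps_const_add[symmetric])
      moreover have "(- rt_inv) ^ i' = rt_inv ^ i'" using True by simp
      ultimately show ?thesis by (simp only: distrib_right j)
    qed
    finally show ?thesis unfolding e o by (intro exI[of _ "\<lambda>t. if t = j then 2 * b else 0"]) simp
  next
    case False
    then show ?thesis unfolding e o by (intro exI[of _ "\<lambda>_. 0"]) simp
  qed
next
  case (conj_pair_add k F F' G G')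
  then obtain a b where "F + F' = (\<Sum>j\<le>(k - 1) div 2. fps_const (a j) * rt_inv ^ (2 * j))"
    "G + G' = (\<Sum>j\<le>(k - 1) div 2. fps_const (b j) * rt_inv ^ (2 * j))" by blast
  then have "F + G + (F' + G') = (\<Sum>j\<le>(k - 1) div 2. fps_const (a j + b j) * rt_inv ^ (2 * j))"
    by (simp add: fps_const_add[symmetric] distrib_right sum.distrib algebra_simps del: fps_const_add)
  then show ?case by (rule exI[of _ "\<lambda>j. a j + b j"])
qed

section \<open>Conjugate series of arches\<close>

text \<open>The conjugation exchanges hills and dips up to a sign flip; this is where the correspondence between
\<open>rt \<mapsto> - rt\<close> and \<open>sgn_flip\<close> comes from.\<close>

lemma map_comps:
  "hill (kap s) = sgn_flip (dip s)" "dip (kap s) = sgn_flip (hill s)"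
  "eta s = cat (sgn_flip (dip s)) stat_m2" "eta (cat s (hill t)) = cat (sgn_flip (dip s)) (kap t)"
  "hill stat_m2 = stat0" "dip stat_m2 = stat0" "eta stat0 = stat0" "sgn_flip (cat s t) = cat (sgn_flip s) (sgn_flip t)"
  "sgn_flip stat0 = stat0"
  by (cases s; cases t; simp add: hill_def power2_eq_square field_simps)+

abbreviation "arch_fps1 \<equiv> arch_fps (\<lambda>_. 1)"

lemma arch_fps1_eq: "1 - 2 * arch_fps1 = rt" by (simp add: rt_def)

text \<open>The candidate for the conjugate of \<open>arch_fps f\<close>. For \<open>f = 1\<close> it is the second root of the Catalan
equation.\<close>

definition conj_fps :: "(stat \<Rightarrow> real) \<Rightarrow> real fps" where
  "conj_fps f = fps_const (f stat_m2) - arch_fps (\<lambda>s. f (kap s))"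

lemma conj_fps_1: "conj_fps (\<lambda>_. 1) = 1 - arch_fps1" by (simp add: conj_fps_def)

text \<open>Evaluating \<open>f \<circ> eta\<close> once by the last hill and once by splitting off the fictitious block \<open>stat_m2\<close>
gives a linear relation among the candidates for the conjugates.\<close>

lemma conj_fps_last:
  assumes "\<And>s t. f (cat s t) = (\<Sum>x\<leftarrow>xs. g x s * h x t)" and "f stat0 = 0"
  shows "(\<Sum>x\<leftarrow>xs. arch_fps (\<lambda>s. g x (sgn_flip (dip s))) * conj_fps (h x)) = 0"
proof -
  let ?A = "\<lambda>x. arch_fps (\<lambda>s. g x (sgn_flip (dip s)))"
  have 1: "arch_fps (\<lambda>s. f (eta s)) = (\<Sum>x\<leftarrow>xs. ?A x * arch_fps (\<lambda>s. h x (kap s)))"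
  proof -
    have "arch_fps (\<lambda>s. f (eta s)) = fps_X * fps_const (f (eta stat0)) + (\<Sum>x\<leftarrow>xs. ?A x * arch_fps (\<lambda>s. h x (kap s)))"
      by (rule arch_fps_last) (simp only: map_comps(4) assms(1))
    then show ?thesis by (simp add: map_comps(7) assms(2))
  qed
  have 2: "arch_fps (\<lambda>s. f (eta s)) = (\<Sum>x\<leftarrow>xs. ?A x * fps_const (h x stat_m2))"
  proof -
    have c: "arch_fps (\<lambda>s. g x (sgn_flip (dip s)) * a) = ?A x * fps_const a" for x a
      using arch_fps_cmult[of a "\<lambda>s. g x (sgn_flip (dip s))"] by (simp add: mult.commute)
    have "arch_fps (\<lambda>s. f (eta s)) = arch_fps (\<lambda>s. \<Sum>x\<leftarrow>xs. g x (sgn_flip (dip s)) * h x stat_m2)"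
      by (simp only: map_comps(3) assms(1))
    also have "\<dots> = (\<Sum>x\<leftarrow>xs. ?A x * fps_const (h x stat_m2))"
      by (simp only: arch_fps_sum_list c)
    finally show ?thesis .
  qed
  show ?thesis
    using 1 2 by (simp add: conj_fps_def right_diff_distrib sum_list_subtractf)
qed

definition "split_rule d f ps \<longleftrightarrow>
  (\<forall>(g, h)\<in>set ps. \<exists>d1 d2. weighted d1 g \<and> weighted d2 h \<and> 2 \<le> d1 \<and> 2 \<le> d2 \<and> d1 + d2 \<le> d \<and> g stat0 = 0 \<and> h stat0 = 0) \<and>
  (\<forall>s t. f (cat s t) = (\<Sum>(g, h)\<leftarrow>(f, \<lambda>_. 1) # (\<lambda>_. 1, f) # ps. g s * h t))"

lemma split_rule_ex:
  assumes "weighted d f" "f stat0 = 0" obtains ps where "split_rule d f ps"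
proof -
  obtain ps where "\<And>g h. (g, h) \<in> set ps \<Longrightarrow> \<exists>d1 d2. weighted d1 g \<and> weighted d2 h \<and> 2 \<le> d1 \<and> 2 \<le> d2 \<and> d1 + d2 \<le> d \<and> g stat0 = 0 \<and> h stat0 = 0"
    "\<And>s t. f (cat s t) = f s + f t - f stat0 + (\<Sum>(g, h)\<leftarrow>ps. g s * h t)" using weighted_split[OF assms(1)] by blast
  then have "split_rule d f ps" unfolding split_rule_def using assms(2) by auto
  then show ?thesis by (rule that)
qed

lemma split3D:
  assumes "split_rule d f ps" "(g, h) \<in> set ps"
  obtains d1 d2 where "weighted d1 g" "weighted d2 h" "2 \<le> d1" "2 \<le> d2" "d1 + d2 \<le> d" "g stat0 = 0" "h stat0 = 0"
  using assms unfolding split_rule_def by blast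

lemma split_rule_cat:
  assumes "split_rule d f ps"
  shows "f (cat s t) = (\<Sum>x\<leftarrow>(f, \<lambda>_. 1) # (\<lambda>_. 1, f) # ps. fst x s * snd x t)"
  using assms unfolding split_rule_def case_prod_unfold by blast

lemma fps_rt_solve:
  fixes F G :: "real fps"
  assumes "rt * F = G"
  shows "F = rt_inv * G"
proof -
  have "rt_inv * G = (rt_inv * rt) * F" unfolding assms[symmetric] by (simp only: mult.assoc)
  then show ?thesis by simp
qed

lemma rt_inv_distrib_sum_list:
  "rt_inv * (a * b + (\<Sum>x\<leftarrow>xs. F x * G x)) = rt_inv * a * b + (\<Sum>x\<leftarrow>xs. rt_inv * F x * (G x :: real fps))"
  by (simp add: distrib_left mult.assoc sum_list_const_mult)

text \<open>The recursions for \<open>arch_fps f\<close> and \<open>conj_fps f\<close> have the same shape, up to the sign that the conjugation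
of \<open>rt_inv\<close> produces, and involve only statistics of smaller weight on the right. Induction on the weight
therefore shows that the two series are conjugate, which is \<open>conj_pair_arch_fps\<close>.\<close>

lemma arch_fps_rec:
  assumes "split_rule d f ps" "f stat0 = 0"
  shows "arch_fps f = rt_inv * arch_fps1 * arch_fps (\<lambda>s. f (hill s) - f s) +
    (\<Sum>x\<leftarrow>ps. rt_inv * arch_fps (\<lambda>s. fst x (hill s)) * arch_fps (snd x))"
proof -
  let ?R = "\<Sum>x\<leftarrow>ps. arch_fps (\<lambda>s. fst x (hill s)) * arch_fps (snd x)"
  have "arch_fps f = arch_fps (\<lambda>s. f (hill s)) * arch_fps1 + (arch_fps1 * arch_fps f + ?R)"
    using arch_fps_first[where g = fst and h = snd, OF split_rule_cat[OF assms(1)]]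
    unfolding list.map sum_list.Cons fst_conv snd_conv assms(2) fps_const_0_eq_0 mult_zero_right add_0_left add.assoc .
  then have "arch_fps f - (arch_fps (\<lambda>s. f (hill s)) * arch_fps1 + (arch_fps1 * arch_fps f + ?R)) = 0"
    by (rule right_minus_eq[THEN iffD2])
  moreover have "rt * F - (arch_fps1 * (G - F) + R) = F - (G * arch_fps1 + (arch_fps1 * F + R))" for F G R
    unfolding arch_fps1_eq[symmetric] by (simp add: algebra_simps)
  ultimately have "rt * arch_fps f - (arch_fps1 * (arch_fps (\<lambda>s. f (hill s)) - arch_fps f) + ?R) = 0" by (simp only:)
  then have "rt * arch_fps f = arch_fps1 * arch_fps (\<lambda>s. f (hill s) - f s) + ?R"
    unfolding arch_fps_diff by (rule right_minus_eq[THEN iffD1])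
  from fps_rt_solve[OF this] show ?thesis unfolding rt_inv_distrib_sum_list .
qed

lemma conj_fps_rec:
  assumes "split_rule d f ps" "f stat0 = 0"
  shows "conj_fps f = - (rt_inv * conj_fps (\<lambda>_. 1) * conj_fps (\<lambda>s. f (hill s) - f s)) +
    (\<Sum>x\<leftarrow>ps. - (rt_inv * conj_fps (\<lambda>s. fst x (hill s)) * conj_fps (snd x)))"
proof -
  let ?A = "\<lambda>g. arch_fps (\<lambda>s. g (sgn_flip (dip s)))"
  let ?R = "\<Sum>x\<leftarrow>ps. ?A (fst x) * conj_fps (snd x)"
  let ?p = "\<lambda>s. f (hill s) - f s"
  have "?A f * conj_fps (\<lambda>_. 1) + (arch_fps1 * conj_fps f + ?R) = 0"
    using conj_fps_last[where g = fst and h = snd, OF split_rule_cat[OF assms(1)] assms(2)] by simp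
  moreover have "?A f = - conj_fps f - conj_fps ?p"
  proof -
    have "?A f = arch_fps (\<lambda>s. f (kap s) + ?p (kap s))" by (simp add: map_comps)
    also have "\<dots> = arch_fps (\<lambda>s. f (kap s)) + arch_fps (\<lambda>s. ?p (kap s))" by (rule arch_fps_add)
    also have "\<dots> = - conj_fps f - conj_fps ?p + fps_const (f stat_m2 + ?p stat_m2)"
    proof -
      have "X + Z = - (a - X) - (b - Z) + (a + b)" for a b X Z :: "real fps" by simp
      then show ?thesis unfolding conj_fps_def fps_const_add[symmetric] by blast
    qed
    also have "f stat_m2 + ?p stat_m2 = 0" using assms(2) by (simp add: map_comps)
    finally show ?thesis by simp
  qed
  ultimately have "(- conj_fps f - conj_fps ?p) * (1 - arch_fps1) + (arch_fps1 * conj_fps f + ?R) = 0" by (simp only: conj_fps_1)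
  moreover have "rt * F - (- ((1 - arch_fps1) * P) + R) = - ((- F - P) * (1 - arch_fps1) + (arch_fps1 * F + R))" for F P R
    unfolding arch_fps1_eq[symmetric] by (simp add: algebra_simps)
  ultimately have "rt * conj_fps f - (- ((1 - arch_fps1) * conj_fps ?p) + ?R) = 0" by (simp only: minus_zero)
  then have "rt * conj_fps f = - ((1 - arch_fps1) * conj_fps ?p) + ?R" by (rule right_minus_eq[THEN iffD1])
  moreover have "?R = (\<Sum>x\<leftarrow>ps. - conj_fps (\<lambda>s. fst x (hill s)) * conj_fps (snd x))"
  proof (rule arg_cong[where f = sum_list], rule map_cong[OF refl])
    fix x assume x: "x \<in> set ps"
    obtain g h where gh: "x = (g, h)" by (cases x)
    have "g stat0 = 0" using split3D[OF assms(1)] x gh by metis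
    then show "?A (fst x) * conj_fps (snd x) = - conj_fps (\<lambda>s. fst x (hill s)) * conj_fps (snd x)"
      unfolding gh conj_fps_def[of "\<lambda>s. fst (g, h) (hill s)"] by (simp add: map_comps)
  qed
  ultimately have "rt * conj_fps f = - conj_fps (\<lambda>_. 1) * conj_fps ?p + (\<Sum>x\<leftarrow>ps. - conj_fps (\<lambda>s. fst x (hill s)) * conj_fps (snd x))"
    by (simp only: conj_fps_1 minus_mult_left)
  from fps_rt_solve[OF this] show ?thesis
    unfolding rt_inv_distrib_sum_list by (simp only: minus_mult_left[symmetric] minus_mult_right[symmetric])
qed

lemma conj_pair_const:
  "conj_pair 0 1 (arch_fps (\<lambda>_. a)) (conj_fps (\<lambda>_. a))"
proof -
  define k where "k = fps_const (a / 2)"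
  have k: "fps_const a = k + k" "fps_const (- (a / 2)) = - k"
    unfolding k_def fps_const_add[symmetric] fps_const_neg[symmetric] by (simp_all add: fps_const_add)
  have "fps_const a * (fps_const (1 / 2) * (1 - rt)) = k * (1 - rt)"
    unfolding k_def by (simp add: mult.assoc[symmetric])
  then have d: "arch_fps (\<lambda>_. a) = k * (1 - rt)" unfolding arch_fps_const[of a] arch_fps_1 .
  have y: "conj_fps (\<lambda>_. a) = k + k - k * (1 - rt)" unfolding conj_fps_def d k(1) ..
  have 1: "k * (rt * rt_inv ^ 1) + (- k) * (rt * rt_inv ^ 0) = arch_fps (\<lambda>_. a)"
    unfolding d by (simp add: right_diff_distrib)
  have 2: "k * (- rt * (- rt_inv) ^ 1) + (- k) * (- rt * (- rt_inv) ^ 0) = conj_fps (\<lambda>_. a)"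
    unfolding y by (simp add: right_diff_distrib)
  show ?thesis
    using conj_pair_add[OF conj_pair_base[of 0 1 1 "a / 2"] conj_pair_base[of 0 0 1 "- (a / 2)"]]
    unfolding k(2) k_def[symmetric] 1 2 by simp
qed

theorem conj_pair_arch_fps: "weighted d f \<Longrightarrow> conj_pair 0 (max 1 d) (arch_fps f) (conj_fps f)"
proof (induction d arbitrary: f rule: less_induct)
  case (less d)
  show ?case
  proof (cases "d < 2")
    case True
    then have "f = (\<lambda>_. f stat0)" using weighted_low[OF less.prems] by blast
    then show ?thesis using conj_pair_mono[OF conj_pair_const[of "f stat0"], of "max 1 d"] by simp
  next
    case False
    define F where "F = (\<lambda>s. f s - f stat0)"
    have F: "weighted d F" "F stat0 = 0" unfolding F_def using weighted_diff[OF less.prems weighted_const] by simp_all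
    obtain ps where ps: "split_rule d F ps" using split_rule_ex[OF F] by blast
    let ?p = "\<lambda>s. F (hill s) - F s"
    have 1: "conj_pair 0 d (rt_inv * arch_fps1 * arch_fps ?p) (- (rt_inv * conj_fps (\<lambda>_. 1) * conj_fps ?p))"
      using conj_pair_mult[OF conj_pair_const[of 1] less.IH[of "d - 1" ?p]] weighted_maps_diff(1)[OF F(1)] False by simp
    have 2: "conj_pair 0 d (\<Sum>x\<leftarrow>ps. rt_inv * arch_fps (\<lambda>s. fst x (hill s)) * arch_fps (snd x)) (\<Sum>x\<leftarrow>ps. - (rt_inv * conj_fps (\<lambda>s. fst x (hill s)) * conj_fps (snd x)))"
    proof (rule conj_pair_sum_list)
      fix x assume x: "x \<in> set ps"
      obtain g h where gh: "x = (g, h)" by (cases x)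
      obtain d1 d2 where d: "weighted d1 g" "weighted d2 h" "2 \<le> d1" "2 \<le> d2" "d1 + d2 \<le> d"
        using split3D[OF ps] x gh by metis
      have "conj_pair 0 (max 1 d1) (arch_fps (\<lambda>s. g (hill s))) (conj_fps (\<lambda>s. g (hill s)))"
        by (rule less.IH) (use d weighted_tame[OF tame_maps(2) d(1)] in auto)
      moreover have "conj_pair 0 (max 1 d2) (arch_fps h) (conj_fps h)" by (rule less.IH) (use d in auto)
      ultimately have "conj_pair (0 + 0) (max 1 d1 + max 1 d2) (rt_inv * arch_fps (\<lambda>s. g (hill s)) * arch_fps h) (- (rt_inv * conj_fps (\<lambda>s. g (hill s)) * conj_fps h))"
        by (rule conj_pair_mult)
      then show "conj_pair 0 d (rt_inv * arch_fps (\<lambda>s. fst x (hill s)) * arch_fps (snd x)) (- (rt_inv * conj_fps (\<lambda>s. fst x (hill s)) * conj_fps (snd x)))"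
        using conj_pair_mono[of "0 + 0" _ _ _ d] d unfolding gh by (simp add: max_def)
    qed simp
    have 3: "conj_pair 0 d (arch_fps F) (conj_fps F)"
      unfolding arch_fps_rec[OF ps F(2)] conj_fps_rec[OF ps F(2)] by (rule conj_pair_add[OF 1 2])
    have e: "arch_fps f = arch_fps F + arch_fps (\<lambda>_. f stat0)" "conj_fps f = conj_fps F + conj_fps (\<lambda>_. f stat0)"
      unfolding F_def conj_fps_def arch_fps_diff by (simp_all add: fps_const_sub[symmetric] del: fps_const_sub)
    show ?thesis unfolding e
      using conj_pair_add[OF 3 conj_pair_mono[OF conj_pair_const[of "f stat0"]]] False by (simp add: max_def)
  qed
qed

section \<open>Chains, signed sums and polynomiality\<close>

lemma split_rule_sgn:
  assumes "split_rule d f ps"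
  shows "f (sgn_flip (cat s t)) = (\<Sum>x\<leftarrow>(f, \<lambda>_. 1) # (\<lambda>_. 1, f) # ps. fst x (sgn_flip s) * snd x (sgn_flip t))"
  unfolding map_comps by (rule split_rule_cat[OF assms])

definition sum_fps :: "(stat \<Rightarrow> real) \<Rightarrow> real fps" where
  "sum_fps g = arch_fps (\<lambda>s. g (hill s) + g (dip s))"
definition diff_fps :: "(stat \<Rightarrow> real) \<Rightarrow> real fps" where
  "diff_fps g = arch_fps (\<lambda>s. g (hill s) - g (dip s))"

lemma sum_fps_1: "sum_fps (\<lambda>_. 1) = 1 - rt"
proof -
  have "sum_fps (\<lambda>_. 1) = arch_fps1 + arch_fps1" unfolding sum_fps_def by (rule arch_fps_add)
  then show ?thesis unfolding arch_fps1_eq[symmetric] by simp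
qed

lemma stat_fps_chains_1: "stat_fps chains (\<lambda>_. 1) = rt_inv"
proof -
  have "stat_fps chains (\<lambda>_. 1) = 1 + (1 - rt) * stat_fps chains (\<lambda>_. 1)"
    using chains_first[where f = "\<lambda>_. 1" and xs = "[()]" and g = "\<lambda>_ _. 1" and h = "\<lambda>_ _. 1"]
    unfolding sum_fps_1[symmetric] sum_fps_def by simp
  then have "stat_fps chains (\<lambda>_. 1) - (1 + (1 - rt) * stat_fps chains (\<lambda>_. 1)) = 0" by (rule right_minus_eq[THEN iffD2])
  moreover have "F - (1 + (1 - rt) * F) = rt * F - 1" for F by (simp add: algebra_simps)
  ultimately have "rt * stat_fps chains (\<lambda>_. 1) = 1" by simp
  from fps_rt_solve[OF this] show ?thesis by simp
qed

lemma chains_rec: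
  assumes cat_f: "\<And>s t. f (cat s t) = (\<Sum>x\<leftarrow>(f, \<lambda>_. 1) # (\<lambda>_. 1, f) # ps. fst x s * snd x t)"
    and z: "f stat0 = 0"
  shows "stat_fps chains f = rt_inv * sum_fps f * rt_inv + (\<Sum>x\<leftarrow>ps. rt_inv * sum_fps (fst x) * stat_fps chains (snd x))"
proof -
  let ?R = "\<Sum>x\<leftarrow>ps. sum_fps (fst x) * stat_fps chains (snd x)"
  have "stat_fps chains f = sum_fps f * rt_inv + ((1 - rt) * stat_fps chains f + ?R)"
    using chains_first[where g = fst and h = snd, OF cat_f]
    unfolding sum_fps_def[symmetric] list.map sum_list.Cons fst_conv snd_conv z fps_const_0_eq_0 add_0_left
      stat_fps_chains_1 sum_fps_1 .
  then have "stat_fps chains f - (sum_fps f * rt_inv + ((1 - rt) * stat_fps chains f + ?R)) = 0" by (rule right_minus_eq[THEN iffD2])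
  moreover have "rt * F - (G + R) = F - (G + ((1 - rt) * F + R))" for F G R by (simp add: algebra_simps)
  ultimately have "rt * stat_fps chains f - (sum_fps f * rt_inv + ?R) = 0" by (simp only:)
  then have "rt * stat_fps chains f = sum_fps f * rt_inv + ?R" by (rule right_minus_eq[THEN iffD1])
  from fps_rt_solve[OF this] show ?thesis unfolding rt_inv_distrib_sum_list .
qed

lemma conj_pair_sum_fps:
  assumes "weighted d g" "g stat0 = 0"
  shows "conj_pair 0 (max 1 d) (sum_fps g) (- sum_fps (\<lambda>s. g (sgn_flip s)))"
proof -
  have "conj_fps (\<lambda>s. g (hill s) + g (dip s)) = - sum_fps (\<lambda>s. g (sgn_flip s))"
  proof -
    have "conj_fps (\<lambda>s. g (hill s) + g (dip s)) = fps_const 0 - arch_fps (\<lambda>s. g (sgn_flip (dip s)) + g (sgn_flip (hill s)))"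
      by (simp only: conj_fps_def map_comps assms(2) add_0_left)
    also have "(\<lambda>s. g (sgn_flip (dip s)) + g (sgn_flip (hill s))) = (\<lambda>s. g (sgn_flip (hill s)) + g (sgn_flip (dip s)))"
      by (rule ext) (rule add.commute)
    finally show ?thesis unfolding sum_fps_def fps_const_0_eq_0 diff_0 .
  qed
  moreover have "conj_pair 0 (max 1 d) (sum_fps g) (conj_fps (\<lambda>s. g (hill s) + g (dip s)))"
    unfolding sum_fps_def by (rule conj_pair_arch_fps) (intro weighted_add weighted_tame[OF _ assms(1)] tame_maps)
  ultimately show ?thesis by (simp only:)
qed

lemma conj_pair_diff_fps:
  assumes "weighted d g"
  shows "conj_pair 0 (max 1 (d - 1)) (diff_fps g) (diff_fps (\<lambda>s. g (sgn_flip s)))"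
proof -
  have "conj_fps (\<lambda>s. g (hill s) - g (dip s)) = diff_fps (\<lambda>s. g (sgn_flip s))"
    unfolding conj_fps_def diff_fps_def arch_fps_diff by (simp add: map_comps)
  then show ?thesis using conj_pair_arch_fps[OF weighted_maps_diff(2)[OF assms]] unfolding diff_fps_def by metis
qed

lemma conj_pair_rt_inv: "conj_pair 2 2 rt_inv (- rt_inv)"
proof -
  have 1: "fps_const 1 * (rt * rt_inv ^ 2) = (rt * rt_inv) * rt_inv"
    by (simp only: power2_eq_square fps_const_1_eq_1 mult_1_left mult.assoc)
  have 2: "fps_const 1 * (- rt * (- rt_inv) ^ 2) = - ((rt * rt_inv) * rt_inv)"
    by (simp only: power2_eq_square fps_const_1_eq_1 mult_1_left mult.assoc minus_mult_left[symmetric] minus_mult_right[symmetric] minus_minus)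
  show ?thesis using conj_pair_base[of 2 2 2 1] unfolding 1 2 by simp
qed

lemma conj_pair_rt_inv_square: "conj_pair j k F F' \<Longrightarrow> conj_pair (j + 2) (k + 2) (rt_inv * F * rt_inv) (rt_inv * F' * rt_inv)"
  using conj_pair_mult[OF _ conj_pair_rt_inv, of j k F F'] by simp

lemma stat_fps_chains_const: "stat_fps chains (\<lambda>_. a) = fps_const a * rt_inv"
  using stat_fps_cmult[of chains a "\<lambda>_. 1"] stat_fps_chains_1 by simp

lemma conj_pair_const_rt_inv: "conj_pair 2 2 (fps_const a * rt_inv) (- (fps_const a * rt_inv))"
proof -
  have 1: "fps_const a * (rt * rt_inv ^ 2) = (rt * rt_inv) * (fps_const a * rt_inv)"
    by (simp only: power2_eq_square mult_ac)
  have 2: "fps_const a * (- rt * (- rt_inv) ^ 2) = - ((rt * rt_inv) * (fps_const a * rt_inv))"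
    by (simp only: power2_eq_square mult_ac minus_mult_left[symmetric] minus_mult_right[symmetric] minus_minus)
  show ?thesis using conj_pair_base[of 2 2 2 a] unfolding 1 2 by simp
qed

text \<open>The conjugation fixes the set of primitive pieces \<open>{hill s, dip s}\<close> up to a sign flip, so conjugating
the series of all chains amounts to flipping signs in the statistic, up to an overall sign.\<close>

theorem conj_pair_chains: "weighted d f \<Longrightarrow> conj_pair 2 (d + 2) (stat_fps chains f) (- stat_fps chains (\<lambda>s. f (sgn_flip s)))"
proof (induction d arbitrary: f rule: less_induct)
  case (less d)
  show ?case
  proof (cases "d < 2")
    case True
    then have f: "f = (\<lambda>_. f stat0)" using weighted_low[OF less.prems] by blast
    have "(\<lambda>s. f (sgn_flip s)) = (\<lambda>_. f stat0)" by (subst f) simp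
    then have "conj_pair 2 2 (stat_fps chains f) (- stat_fps chains (\<lambda>s. f (sgn_flip s)))"
      using conj_pair_const_rt_inv[of "f stat0"] f stat_fps_chains_const[of "f stat0"] by metis
    then show ?thesis by (rule conj_pair_mono) simp
  next
    case False
    define F where "F = (\<lambda>s. f s - f stat0)"
    have F: "weighted d F" "F stat0 = 0" unfolding F_def using weighted_diff[OF less.prems weighted_const] by simp_all
    obtain ps where ps: "split_rule d F ps" using split_rule_ex[OF F] by blast
    let ?ps = "map (\<lambda>x. (\<lambda>s. fst x (sgn_flip s), \<lambda>s. snd x (sgn_flip s))) ps"
    let ?F = "\<lambda>s. F (sgn_flip s)"
    have r1: "stat_fps chains F = rt_inv * sum_fps F * rt_inv + (\<Sum>x\<leftarrow>ps. rt_inv * sum_fps (fst x) * stat_fps chains (snd x))"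
      by (rule chains_rec[OF split_rule_cat[OF ps] F(2)])
    have r2: "stat_fps chains ?F = rt_inv * sum_fps ?F * rt_inv + (\<Sum>x\<leftarrow>?ps. rt_inv * sum_fps (fst x) * stat_fps chains (snd x))"
    proof (rule chains_rec)
      fix s t
      show "F (sgn_flip (cat s t)) = (\<Sum>x\<leftarrow>(\<lambda>s. F (sgn_flip s), \<lambda>_. 1) # (\<lambda>_. 1, \<lambda>s. F (sgn_flip s)) # ?ps. fst x s * snd x t)"
        unfolding split_rule_sgn[OF ps] by (simp add: o_def)
    qed (simp add: F(2) map_comps)
    have r2': "- stat_fps chains ?F = rt_inv * (- sum_fps ?F) * rt_inv + (\<Sum>x\<leftarrow>ps. - (rt_inv * (- sum_fps (\<lambda>s. fst x (sgn_flip s))) * (- stat_fps chains (\<lambda>s. snd x (sgn_flip s)))))"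
      unfolding r2 by (simp add: o_def uminus_sum_list_map)
    have 1: "conj_pair 2 (d + 2) (rt_inv * sum_fps F * rt_inv) (rt_inv * (- sum_fps ?F) * rt_inv)"
      using conj_pair_rt_inv_square[OF conj_pair_sum_fps[OF F]] False by (simp add: max_def numeral_2_eq_2)
    have 2: "conj_pair 2 (d + 2) (\<Sum>x\<leftarrow>ps. rt_inv * sum_fps (fst x) * stat_fps chains (snd x))
        (\<Sum>x\<leftarrow>ps. - (rt_inv * (- sum_fps (\<lambda>s. fst x (sgn_flip s))) * (- stat_fps chains (\<lambda>s. snd x (sgn_flip s)))))"
    proof (rule conj_pair_sum_list)
      fix x assume x: "x \<in> set ps"
      obtain g h where gh: "x = (g, h)" by (cases x)
      obtain d1 d2 where d: "weighted d1 g" "weighted d2 h" "2 \<le> d1" "2 \<le> d2" "d1 + d2 \<le> d" "g stat0 = 0"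
        using split3D[OF ps] x gh by metis
      have "conj_pair 2 (d2 + 2) (stat_fps chains h) (- stat_fps chains (\<lambda>s. h (sgn_flip s)))" by (rule less.IH) (use d in auto)
      from conj_pair_mult[OF conj_pair_sum_fps[OF d(1,6)] this]
      have "conj_pair 2 (max 1 d1 + (d2 + 2)) (rt_inv * sum_fps g * stat_fps chains h) (- (rt_inv * (- sum_fps (\<lambda>s. g (sgn_flip s))) * (- stat_fps chains (\<lambda>s. h (sgn_flip s)))))"
        by (simp add: numeral_2_eq_2)
      then show "conj_pair 2 (d + 2) (rt_inv * sum_fps (fst x) * stat_fps chains (snd x)) (- (rt_inv * (- sum_fps (\<lambda>s. fst x (sgn_flip s))) * (- stat_fps chains (\<lambda>s. snd x (sgn_flip s)))))"
        unfolding gh fst_conv snd_conv by (rule conj_pair_mono) (use d in simp)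
    qed simp
    have 3: "conj_pair 2 (d + 2) (stat_fps chains F) (- stat_fps chains ?F)"
      unfolding r1 r2' by (rule conj_pair_add[OF 1 2])
    have f: "f = (\<lambda>s. F s + f stat0)" unfolding F_def by simp
    have 4: "stat_fps chains f = stat_fps chains F + fps_const (f stat0) * rt_inv"
      by (subst f) (simp only: stat_fps_add stat_fps_chains_const)
    have "(\<lambda>s. f (sgn_flip s)) = (\<lambda>s. ?F s + f stat0)" unfolding F_def by simp
    then have 5: "- stat_fps chains (\<lambda>s. f (sgn_flip s)) = - stat_fps chains ?F + - (fps_const (f stat0) * rt_inv)"
      by (simp only: stat_fps_add stat_fps_chains_const minus_add_distrib)
    show ?thesis unfolding 4 5
      by (rule conj_pair_add[OF 3 conj_pair_mono[OF conj_pair_const_rt_inv]]) simp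
  qed
qed

text \<open>In the signed sum the first piece counts with opposite signs for a hill and for a dip. This lowers the
weight once more and makes the series of a sign-flipped statistic minus the conjugate.\<close>

theorem conj_pair_signed_fps:
  assumes f: "weighted d f" "f stat0 = 0" and d: "2 \<le> d"
  shows "conj_pair 1 d (signed_fps f) (- signed_fps (\<lambda>s. f (sgn_flip s)))"
proof -
  obtain ps where ps: "split_rule d f ps" using split_rule_ex[OF f] by blast
  let ?f = "\<lambda>s. f (sgn_flip s)"
  have z: "arch_fps (\<lambda>s. 0) = 0" using arch_fps_cmult[of 0 "\<lambda>_. 0"] by simp
  have r1: "signed_fps f = diff_fps f * rt_inv + (\<Sum>x\<leftarrow>ps. diff_fps (fst x) * stat_fps chains (snd x))"
    using signed_fps_eq[where g = fst and h = snd, OF split_rule_cat[OF ps]] by (simp add: diff_fps_def z stat_fps_chains_1)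
  have r2: "- signed_fps ?f = diff_fps ?f * (- rt_inv) + (\<Sum>x\<leftarrow>ps. diff_fps (\<lambda>s. fst x (sgn_flip s)) * (- stat_fps chains (\<lambda>s. snd x (sgn_flip s))))"
    using signed_fps_eq[where f = ?f and g = "\<lambda>x s. fst x (sgn_flip s)" and h = "\<lambda>x s. snd x (sgn_flip s)", OF split_rule_sgn[OF ps]]
    by (simp add: diff_fps_def z stat_fps_chains_1 uminus_sum_list_map o_def)
  have rt_inv: "conj_pair (Suc 1) (Suc 1) rt_inv (- rt_inv)" using conj_pair_rt_inv by (simp add: numeral_2_eq_2)
  have 1: "conj_pair 1 d (diff_fps f * rt_inv) (diff_fps ?f * (- rt_inv))"
    using conj_pair_times[OF conj_pair_diff_fps[OF f(1)] rt_inv] d by (simp add: max_def split: if_splits)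
  have 2: "conj_pair 1 d (\<Sum>x\<leftarrow>ps. diff_fps (fst x) * stat_fps chains (snd x))
     (\<Sum>x\<leftarrow>ps. diff_fps (\<lambda>s. fst x (sgn_flip s)) * (- stat_fps chains (\<lambda>s. snd x (sgn_flip s))))"
  proof (rule conj_pair_sum_list)
    fix x assume x: "x \<in> set ps"
    obtain g h where gh: "x = (g, h)" by (cases x)
    obtain d1 d2 where d: "weighted d1 g" "weighted d2 h" "2 \<le> d1" "2 \<le> d2" "d1 + d2 \<le> d" "g stat0 = 0"
      using split3D[OF ps] x gh by metis
    have "conj_pair (Suc 1) (Suc (d2 + 1)) (stat_fps chains h) (- stat_fps chains (\<lambda>s. h (sgn_flip s)))"
      using conj_pair_chains[OF d(2)] by (simp add: numeral_2_eq_2)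
    from conj_pair_times[OF conj_pair_diff_fps[OF d(1)] this]
    have "conj_pair 1 (max 1 (d1 - 1) + (d2 + 1)) (diff_fps g * stat_fps chains h) (diff_fps (\<lambda>s. g (sgn_flip s)) * (- stat_fps chains (\<lambda>s. h (sgn_flip s))))"
      by simp
    then show "conj_pair 1 d (diff_fps (fst x) * stat_fps chains (snd x)) (diff_fps (\<lambda>s. fst x (sgn_flip s)) * (- stat_fps chains (\<lambda>s. snd x (sgn_flip s))))"
      unfolding gh fst_conv snd_conv by (rule conj_pair_mono) (use d in simp)
  qed (use d in simp)
  show ?thesis unfolding r1 r2 by (rule conj_pair_add[OF 1 2])
qed

lemma signed_fps_odd:
  assumes f: "weighted d f" "f stat0 = 0" "2 \<le> d" and odd: "\<And>s. f (sgn_flip s) = - f s"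
  obtains a where "signed_fps f = (\<Sum>j\<le>(d - 1) div 2. fps_const (a j) * rt_inv ^ (2 * j))"
proof -
  have "signed_sum (\<lambda>s. - f s) m = - signed_sum f m" for m
    unfolding signed_sum_def by (simp add: sum_negf[symmetric] uminus_sum_list_map o_def del: sum_negf)
  then have "signed_fps (\<lambda>s. - f s) = - signed_fps f"
    unfolding signed_fps_def by (intro fps_ext) (simp add: fps_X_mult_nth)
  then have "- signed_fps (\<lambda>s. f (sgn_flip s)) = signed_fps f" by (simp add: odd)
  then have "conj_pair 1 d (signed_fps f) (signed_fps f)" using conj_pair_signed_fps[OF f] by simp
  from conj_pair_even[OF this] obtain a where a: "signed_fps f + signed_fps f = (\<Sum>j\<le>(d - 1) div 2. fps_const (a j) * rt_inv ^ (2 * j))" by blast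
  have "signed_fps f = fps_const (1/2) * (signed_fps f + signed_fps f)"
    by (rule fps_ext) (simp only: fps_mult_left_const_nth fps_add_nth, simp)
  also have "\<dots> = (\<Sum>j\<le>(d - 1) div 2. fps_const (a j / 2) * rt_inv ^ (2 * j))"
    unfolding a sum_distrib_left by (rule sum.cong) (simp_all add: mult.assoc[symmetric])
  finally show ?thesis by (rule that)
qed

text \<open>The expansion of \<open>1 / (1 - 4 * X) ^ (j + 1)\<close>.\<close>

definition binom_fps :: "nat \<Rightarrow> real fps" where
  "binom_fps j = Abs_fps (\<lambda>m. 4 ^ m * real ((m + j) choose j))"

lemma v2_binom_fps: "rt\<^sup>2 * binom_fps 0 = 1" "rt\<^sup>2 * binom_fps (Suc j) = binom_fps j"
proof -
  have nth: "(rt\<^sup>2 * F) $ m = F $ m - (if m = 0 then 0 else 4 * F $ (m - 1))" for F m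
  proof -
    have "rt\<^sup>2 * F = F - fps_const 4 * (fps_X * F)"
      unfolding rt_sq numeral_fps_const by (simp add: algebra_simps)
    then show ?thesis by (simp only: fps_sub_nth fps_mult_left_const_nth fps_X_mult_nth) simp
  qed
  show "rt\<^sup>2 * binom_fps 0 = 1"
  proof (rule fps_ext)
    fix m show "(rt\<^sup>2 * binom_fps 0) $ m = 1 $ m" unfolding nth by (cases m) (simp_all add: binom_fps_def)
  qed
  show "rt\<^sup>2 * binom_fps (Suc j) = binom_fps j"
  proof (rule fps_ext)
    fix m show "(rt\<^sup>2 * binom_fps (Suc j)) $ m = binom_fps j $ m"
      unfolding nth by (cases m) (simp_all add: binom_fps_def algebra_simps)
  qed
qed

lemma rt_inv_power_even: "rt_inv ^ (2 * Suc j) = binom_fps j"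
proof -
  have uv: "rt_inv\<^sup>2 * (rt\<^sup>2 * F) = F" for F
  proof -
    have "rt_inv\<^sup>2 * (rt\<^sup>2 * F) = (rt_inv * rt)\<^sup>2 * F" by (simp only: power_mult_distrib mult.assoc)
    then show ?thesis by simp
  qed
  show ?thesis
  proof (induction j)
    case 0
    then show ?case using uv[of "binom_fps 0"] by (simp add: v2_binom_fps)
  next
    case (Suc j)
    have "rt_inv ^ (2 * Suc (Suc j)) = rt_inv\<^sup>2 * rt_inv ^ (2 * Suc j)" by (simp add: power_add[symmetric])
    also have "\<dots> = rt_inv\<^sup>2 * (rt\<^sup>2 * binom_fps (Suc j))" unfolding Suc v2_binom_fps ..
    finally show ?case unfolding uv .
  qed
qed

lemma binomial_poly: "\<exists>p :: real poly. degree p \<le> j \<and> (\<forall>m. poly p (real m) = real ((m + j) choose j))"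
proof (induction j)
  case 0
  then show ?case by (intro exI[of _ 1]) simp
next
  case (Suc j)
  then obtain p :: "real poly" where p: "degree p \<le> j" "\<And>m. poly p (real m) = real ((m + j) choose j)" by blast
  let ?q = "smult (1 / real (Suc j)) (p * [:real (Suc j), 1:])"
  have "degree ?q \<le> degree p + degree [:real (Suc j), 1:]"
    by (rule order_trans[OF degree_smult_le degree_mult_le])
  then have "degree ?q \<le> Suc j" using p(1) by simp
  moreover have "poly ?q (real m) = real ((m + Suc j) choose Suc j)" for m
  proof -
    have "real (Suc (m + j)) * real ((m + j) choose j) = real ((m + Suc j) choose Suc j) * real (Suc j)"
      using Suc_times_binomial_eq[of "m + j" j] by (simp only: of_nat_mult[symmetric] add_Suc_right)
    then show ?thesis using p(2)[of m] by (simp add: field_simps)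
  qed
  ultimately show ?case by blast
qed

text \<open>The constant term \<open>j = 0\<close> of the expansion in powers of \<open>rt_inv\<^sup>2\<close> only affects the coefficient of
\<open>X ^ 0\<close>, and \<open>signed_sum f n\<close> is the coefficient of \<open>X ^ Suc n\<close>. Each further power contributes one to the
degree, starting from zero.\<close>

theorem signed_sum_polynomial:
  assumes f: "weighted d f" "f stat0 = 0" "2 \<le> d" and odd: "\<And>s. f (sgn_flip s) = - f s"
  shows "\<exists>p :: real poly. degree p \<le> (d - 3) div 2 \<and> (\<forall>n. signed_sum f n = 4 ^ n * poly p (real n))"
proof -
  obtain a where a: "signed_fps f = (\<Sum>j\<le>(d - 1) div 2. fps_const (a j) * rt_inv ^ (2 * j))"
    using signed_fps_odd[OF f odd] by metis
  define r where "r = (d - 1) div 2"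
  obtain p :: "nat \<Rightarrow> real poly" where p: "\<And>j. degree (p j) \<le> j" "\<And>j m. poly (p j) (real m) = real ((m + j) choose j)"
    using binomial_poly by metis
  \<comment> \<open>The index is shifted because the power with exponent \<open>2 * Suc j\<close> has a polynomial of degree \<open>j\<close>.\<close>
  define q where "q = (\<Sum>j<r. smult (a (Suc j)) (p j))"
  have dq: "degree q \<le> (d - 3) div 2"
    unfolding q_def
  proof (rule degree_sum_le)
    fix j assume "j \<in> {..<r}"
    then have "j \<le> (d - 3) div 2" unfolding r_def by auto
    then show "degree (smult (a (Suc j)) (p j)) \<le> (d - 3) div 2"
      using order_trans[OF degree_smult_le p(1)] order_trans by blast
  qed simp
  have "signed_sum f n = 4 ^ Suc n * poly q (real (Suc n))" for n
  proof -
    have "signed_sum f n = signed_fps f $ Suc n" by (simp add: signed_fps_def fps_X_mult_nth)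
    also have "\<dots> = (\<Sum>j<Suc r. a j * (rt_inv ^ (2 * j)) $ Suc n)"
      unfolding a r_def[symmetric] by (simp add: fps_sum_nth lessThan_Suc_atMost)
    also have "\<dots> = (\<Sum>j<r. a (Suc j) * (rt_inv ^ (2 * Suc j)) $ Suc n)"
      unfolding sum.lessThan_Suc_shift by simp
    also have "\<dots> = (\<Sum>j<r. 4 ^ Suc n * (a (Suc j) * poly (p j) (real (Suc n))))"
      unfolding rt_inv_power_even binom_fps_def p(2) by (simp add: mult_ac)
    finally show ?thesis unfolding q_def by (simp add: poly_sum sum_distrib_left)
  qed
  then have "signed_sum f n = 4 ^ n * poly (smult 4 (pcompose q [:1, 1:])) (real n)" for n
    by (simp add: poly_pcompose)
  moreover have "degree (smult 4 (pcompose q [:1, 1:])) \<le> (d - 3) div 2"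
    using dq order_trans[OF degree_pcompose_le, of q "[:1, 1:]"] by simp
  ultimately show ?thesis by blast
qed

section \<open>Pyramidal sets of cells\<close>

type_synonym cell = "nat \<times> nat"

text \<open>A cell \<open>(m, c)\<close> lies in row \<open>m\<close> and column \<open>c\<close>, and every cell above the bottom row rests on the two cells
diagonally below it.\<close>

definition supported :: "cell set \<Rightarrow> bool" where
  "supported A \<longleftrightarrow> (\<forall>m c. (Suc m, c) \<in> A \<longrightarrow> 1 \<le> c \<and> (m, c - 1) \<in> A \<and> (m, c + 1) \<in> A)"

definition cell_sets :: "nat \<Rightarrow> cell set set" where
  "cell_sets t = {A. supported A \<and> (\<forall>c. (0, c) \<in> A \<longrightarrow> 1 \<le> c \<and> c + 2 \<le> t \<and> (0, c + 1) \<notin> A)}"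

definition arch_sets :: "nat \<Rightarrow> cell set set" where
  "arch_sets i = {A. supported A \<and> (\<forall>c. (0, c) \<in> A \<longleftrightarrow> odd c \<and> c < 2 * i)}"

definition cell_stat :: "nat \<Rightarrow> cell set \<Rightarrow> stat" where
  "cell_stat l A = (real l, real (card A), (\<Sum>(m, c)\<in>A. real c), (\<Sum>(m, c)\<in>A. real m + 1 / 2))"

lemma odd_ge1: "odd (c :: nat) \<Longrightarrow> 1 \<le> c" by (cases c) simp_all

lemma closedD:
  assumes "supported A" "(Suc m, c) \<in> A"
  shows "1 \<le> c" "(m, c - 1) \<in> A" "(m, c + 1) \<in> A"
  using assms unfolding supported_def by auto

lemma closed_bounds:
  assumes "supported A" "\<And>c. (0, c) \<in> A \<Longrightarrow> a \<le> c \<and> c \<le> b"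
  shows "(m, c) \<in> A \<Longrightarrow> a + m \<le> c \<and> c + m \<le> b"
proof (induction m arbitrary: c)
  case 0
  then show ?case using assms(2) by auto
next
  case (Suc m)
  note d = closedD[OF assms(1) Suc.prems]
  show ?case using d(1) Suc.IH[OF d(2)] Suc.IH[OF d(3)] by linarith
qed

lemma cell_sets_bounds: "A \<in> cell_sets t \<Longrightarrow> (m, c) \<in> A \<Longrightarrow> m + 1 \<le> c \<and> c + m + 2 \<le> t"
proof -
  assume A: "A \<in> cell_sets t" "(m, c) \<in> A"
  then have *: "\<And>c. (0, c) \<in> A \<Longrightarrow> 1 \<le> c \<and> c \<le> t - 2 \<and> 2 \<le> t" unfolding cell_sets_def by fastforce
  have "1 + m \<le> c \<and> c + m \<le> t - 2"
    by (rule closed_bounds[OF _ _ A(2)]) (use A * in \<open>auto simp: cell_sets_def\<close>)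
  moreover have "2 \<le> t"
  proof -
    have "\<exists>c. (0, c) \<in> A" using A(2)
    proof (induction m arbitrary: c)
      case (Suc m)
      then show ?case using closedD(2)[of A m c] A(1) unfolding cell_sets_def by blast
    qed blast
    then show ?thesis using * by blast
  qed
  ultimately show ?thesis by auto
qed

lemma arch_sets_bounds: "A \<in> arch_sets i \<Longrightarrow> (m, c) \<in> A \<Longrightarrow> m + 1 \<le> c \<and> c + m < 2 * i"
proof -
  assume A: "A \<in> arch_sets i" "(m, c) \<in> A"
  have r: "1 \<le> c \<and> c \<le> 2 * i - 1" if "(0, c) \<in> A" for c
  proof -
    have "odd c" "c < 2 * i" using that A(1) unfolding arch_sets_def by blast+
    then show ?thesis using odd_pos[of c] by linarith
  qed
  have "supported A" using A(1) unfolding arch_sets_def by blast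
  from closed_bounds[OF this r A(2)] have "1 + m \<le> c \<and> c + m \<le> 2 * i - 1" .
  then show ?thesis by linarith
qed

lemma finite_cell_sets: "finite (cell_sets t)" "A \<in> cell_sets t \<Longrightarrow> finite A"
proof -
  have *: "A \<subseteq> {..t} \<times> {..t}" if "A \<in> cell_sets t" for A using cell_sets_bounds[OF that] by fastforce
  then have "cell_sets t \<subseteq> Pow ({..t} \<times> {..t})" by blast
  then show "finite (cell_sets t)" by (rule finite_subset) simp
  show "A \<in> cell_sets t \<Longrightarrow> finite A" using * finite_subset[of A "{..t} \<times> {..t}"] by blast
qed

lemma finite_arch_sets: "finite (arch_sets i)" "A \<in> arch_sets i \<Longrightarrow> finite A"
proof -
  have *: "A \<subseteq> {..2 * i} \<times> {..2 * i}" if "A \<in> arch_sets i" for A using arch_sets_bounds[OF that] by fastforce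
  then have "arch_sets i \<subseteq> Pow ({..2 * i} \<times> {..2 * i})" by blast
  then show "finite (arch_sets i)" by (rule finite_subset) simp
  show "A \<in> arch_sets i \<Longrightarrow> finite A" using * finite_subset[of A "{..2 * i} \<times> {..2 * i}"] by blast
qed

definition left :: "nat \<Rightarrow> cell set" where "left q = {(m, c). c + m < q}"
definition right :: "nat \<Rightarrow> cell set" where "right q = {(m, c). q + m < c}"
definition shift :: "nat \<Rightarrow> cell set \<Rightarrow> cell set" where "shift q R = {(m, c). q \<le> c \<and> (m, c - q) \<in> R}"
definition unshift :: "nat \<Rightarrow> cell set \<Rightarrow> cell set" where "unshift q A = {(m, c). m < c \<and> (m, c + q) \<in> A}"
definition raise :: "nat \<Rightarrow> cell set \<Rightarrow> cell set" where
  "raise i L = {(m, c). if m = 0 then odd c \<and> c < 2 * i + 2 else 1 \<le> c \<and> (m - 1, c - 1) \<in> L}"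

text \<open>If column \<open>q\<close> is empty in the two bottom rows, then it separates the set: a cell that neither lies to the
left nor to the right of the two diagonals through \<open>(0, q)\<close> would need support at \<open>(0, q)\<close> or \<open>(1, q)\<close>.\<close>

lemma dichotomy:
  assumes "supported A" "(0, q) \<notin> A" "(1, q) \<notin> A"
  shows "(m, c) \<in> A \<Longrightarrow> (m, c) \<in> left q \<union> right q"
proof (induction m arbitrary: c)
  case 0
  then have "c \<noteq> q" using assms by auto
  then show ?case by (auto simp: left_def right_def)
next
  case (Suc m)
  note d = closedD[OF assms(1) Suc.prems]
  have "m \<noteq> 0 \<or> c \<noteq> q" using Suc.prems assms(3) by auto
  then show ?case using Suc.IH[OF d(2)] Suc.IH[OF d(3)] d(1) by (auto simp: left_def right_def)
qed

lemma closed_left: "supported A \<Longrightarrow> supported (A \<inter> left q)"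
  unfolding supported_def left_def by fastforce

lemma closed_unshift: "supported A \<Longrightarrow> supported (unshift q A)"
proof -
  assume A: "supported A"
  show ?thesis unfolding supported_def
  proof (intro allI impI)
    fix m c assume "(Suc m, c) \<in> unshift q A"
    then have 1: "Suc m < c" "(Suc m, c + q) \<in> A" by (auto simp: unshift_def)
    have "c - 1 + q = c + q - 1" using 1(1) by simp
    then show "1 \<le> c \<and> (m, c - 1) \<in> unshift q A \<and> (m, c + 1) \<in> unshift q A"
      using closedD[OF A 1(2)] 1(1) by (auto simp: unshift_def)
  qed
qed

lemma closed_shift: "supported R \<Longrightarrow> supported (shift q R)"
proof -
  assume R: "supported R"
  show ?thesis unfolding supported_def
  proof (intro allI impI)
    fix m c assume "(Suc m, c) \<in> shift q R"
    then have 1: "q \<le> c" "(Suc m, c - q) \<in> R" by (auto simp: shift_def)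
    note d = closedD[OF R 1(2)]
    have "c - q - 1 = c - 1 - q" "c - q + 1 = c + 1 - q" using d(1) 1(1) by auto
    then show "1 \<le> c \<and> (m, c - 1) \<in> shift q R \<and> (m, c + 1) \<in> shift q R"
      using d 1(1) by (auto simp: shift_def)
  qed
qed

lemma closed_Un: "supported A \<Longrightarrow> supported A' \<Longrightarrow> supported (A \<union> A')"
  unfolding supported_def by blast

lemma shift_right: "R \<subseteq> right 0 \<Longrightarrow> shift q R \<subseteq> right q"
  unfolding shift_def right_def by fastforce

lemma left_right_disjoint: "left q \<inter> right q = {}"
  unfolding left_def right_def by auto

lemma glue_parts:
  assumes "P \<subseteq> left q" "R \<subseteq> right 0"
  shows "(P \<union> shift q R) \<inter> left q = P" "unshift q (P \<union> shift q R) = R"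
proof -
  show "(P \<union> shift q R) \<inter> left q = P"
    using assms(1) shift_right[OF assms(2), of q] left_right_disjoint[of q] by blast
  show "unshift q (P \<union> shift q R) = R"
  proof (intro set_eqI)
    fix x :: cell
    obtain m c where x: "x = (m, c)" by (cases x)
    have "(m, c + q) \<notin> P" using assms(1) by (auto simp: left_def)
    moreover have "(m, c) \<in> R \<Longrightarrow> m < c" using assms(2) by (auto simp: right_def)
    ultimately show "x \<in> unshift q (P \<union> shift q R) \<longleftrightarrow> x \<in> R" unfolding x by (auto simp: unshift_def shift_def)
  qed
qed

lemma glue_split:
  assumes "A \<subseteq> left q \<union> right q"
  shows "A = (A \<inter> left q) \<union> shift q (unshift q A)"
proof (intro set_eqI)
  fix x :: cell
  obtain m c where x: "x = (m, c)" by (cases x)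
  have "(m, c) \<in> A \<Longrightarrow> (m, c) \<in> left q \<union> right q" using assms by auto
  then show "x \<in> A \<longleftrightarrow> x \<in> (A \<inter> left q) \<union> shift q (unshift q A)"
    unfolding x by (auto simp: left_def right_def shift_def unshift_def)
qed

text \<open>The pattern common to the three block decompositions below. The cut is at the first even column
\<open>2 * i + 2\<close> that is missing in row \<open>r\<close>; left and right part can then be chosen independently, and the cut
can be read off from the glued set because the left part occupies all earlier even columns of row \<open>r\<close>.\<close>

lemma sum_glue:
  fixes F :: "cell set \<Rightarrow> real"
  assumes fin: "\<And>i. finite (\<P> i)" "\<And>i. finite (\<R> i)"
    and sub: "\<And>i P. P \<in> \<P> i \<Longrightarrow> P \<subseteq> left (2 * i + 2)" "\<And>i R. R \<in> \<R> i \<Longrightarrow> R \<subseteq> right 0"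
    and glue: "\<And>i P R. i \<le> n \<Longrightarrow> P \<in> \<P> i \<Longrightarrow> R \<in> \<R> i \<Longrightarrow> P \<union> shift (2 * i + 2) R \<in> \<A>"
    and mark: "\<And>i P j. P \<in> \<P> i \<Longrightarrow> j < i \<Longrightarrow> (r, 2 * j + 2) \<in> P"
    and cut: "\<And>A i. A \<in> \<A> \<Longrightarrow> (r, 2 * i + 2) \<notin> A \<Longrightarrow> (\<And>j. j < i \<Longrightarrow> (r, 2 * j + 2) \<in> A) \<Longrightarrow>
      i \<le> n \<and> A \<subseteq> left (2 * i + 2) \<union> right (2 * i + 2) \<and> A \<inter> left (2 * i + 2) \<in> \<P> i \<and> unshift (2 * i + 2) A \<in> \<R> i"
    and fA: "\<And>A. A \<in> \<A> \<Longrightarrow> finite A"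
  shows "(\<Sum>A\<in>\<A>. F A) = (\<Sum>i\<le>n. \<Sum>P\<in>\<P> i. \<Sum>R\<in>\<R> i. F (P \<union> shift (2 * i + 2) R))"
proof -
  define \<iota> where "\<iota> = (\<lambda>A :: cell set. LEAST i. (r, 2 * i + 2) \<notin> A)"
  have least: "(r, 2 * \<iota> A + 2) \<notin> A" "\<And>j. j < \<iota> A \<Longrightarrow> (r, 2 * j + 2) \<in> A" if A: "A \<in> \<A>" for A
  proof -
    have "finite ((\<lambda>j. (r, 2 * j + 2)) -` A)"
      by (rule finite_vimageI[OF fA[OF A]]) (auto simp: inj_def)
    then obtain j where "j \<notin> (\<lambda>j. (r, 2 * j + 2)) -` A" using ex_new_if_finite[of "(\<lambda>j. (r, 2 * j + 2)) -` A"] by auto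
    then have "(r, 2 * j + 2) \<notin> A" by simp
    then show "(r, 2 * \<iota> A + 2) \<notin> A" unfolding \<iota>_def by (rule LeastI)
    show "\<And>j. j < \<iota> A \<Longrightarrow> (r, 2 * j + 2) \<in> A" unfolding \<iota>_def using not_less_Least by blast
  qed
  note c = cut[OF _ least]
  have io: "\<iota> (P \<union> shift (2 * i + 2) R) = i" if P: "P \<in> \<P> i" and R: "R \<in> \<R> i" for i P R
    unfolding \<iota>_def
  proof (rule Least_equality)
    have "(r, 2 * i + 2) \<notin> left (2 * i + 2) \<union> right (2 * i + 2)" by (auto simp: left_def right_def)
    then show "(r, 2 * i + 2) \<notin> P \<union> shift (2 * i + 2) R"
      using sub(1)[OF P] shift_right[OF sub(2)[OF R], of "2 * i + 2"] by blast
    fix j assume "(r, 2 * j + 2) \<notin> P \<union> shift (2 * i + 2) R"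
    then show "i \<le> j" using mark[OF P, of j] by (meson UnI1 not_le)
  qed
  have "(\<Sum>i\<le>n. \<Sum>P\<in>\<P> i. \<Sum>R\<in>\<R> i. F (P \<union> shift (2 * i + 2) R)) =
      (\<Sum>i\<le>n. \<Sum>(P, R)\<in>\<P> i \<times> \<R> i. F (P \<union> shift (2 * i + 2) R))"
    by (rule sum.cong[OF refl]) (rule sum.cartesian_product)
  also have "\<dots> = (\<Sum>(i, P, R)\<in>Sigma {..n} (\<lambda>i. \<P> i \<times> \<R> i). F (P \<union> shift (2 * i + 2) R))"
    by (subst sum.Sigma) (auto simp: fin case_prod_unfold)
  also have "\<dots> = (\<Sum>A\<in>\<A>. F A)"
  proof (rule sum.reindex_bij_witness[where
        i = "\<lambda>A. (\<iota> A, A \<inter> left (2 * \<iota> A + 2), unshift (2 * \<iota> A + 2) A)" and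
        j = "\<lambda>(i, P, R). P \<union> shift (2 * i + 2) R"]; (clarsimp simp: case_prod_unfold)?)
    fix i P R assume a: "i \<le> n" "P \<in> \<P> i" "R \<in> \<R> i"
    show "\<iota> (P \<union> shift (Suc (Suc (2 * i))) R) = i \<and>
       (P \<union> shift (Suc (Suc (2 * i))) R) \<inter> left (Suc (Suc (2 * \<iota> (P \<union> shift (Suc (Suc (2 * i))) R)))) = P \<and>
       unshift (Suc (Suc (2 * \<iota> (P \<union> shift (Suc (Suc (2 * i))) R)))) (P \<union> shift (Suc (Suc (2 * i))) R) = R"
      using io[OF a(2,3)] glue_parts[OF sub(1)[OF a(2)] sub(2)[OF a(3)]] by simp
    show "P \<union> shift (Suc (Suc (2 * i))) R \<in> \<A>" using glue[OF a] by simp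
  next
    fix A assume A: "A \<in> \<A>"
    show "A \<inter> left (Suc (Suc (2 * \<iota> A))) \<union> shift (Suc (Suc (2 * \<iota> A))) (unshift (Suc (Suc (2 * \<iota> A))) A) = A"
      using glue_split[of A "2 * \<iota> A + 2"] c[OF A A A] by simp
    show "\<iota> A \<le> n \<and> A \<inter> left (Suc (Suc (2 * \<iota> A))) \<in> \<P> (\<iota> A) \<and> unshift (Suc (Suc (2 * \<iota> A))) A \<in> \<R> (\<iota> A)"
      using c[OF A A A] by simp
  qed
  finally show ?thesis by simp
qed

lemma up_mem: "(0, c) \<in> raise i L \<longleftrightarrow> odd c \<and> c < 2 * i + 2" "(Suc m, c) \<in> raise i L \<longleftrightarrow> 1 \<le> c \<and> (m, c - 1) \<in> L"
  by (auto simp: raise_def)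

text \<open>The left part starting with a cell in column 1 has every odd column in the bottom row; removing that row
leaves a block of the same kind, moved one column to the left. The left part starting in column 2 is such a
block moved one column to the right.\<close>

lemma up_char:
  "P \<in> raise i ` arch_sets i \<longleftrightarrow> supported P \<and> P \<subseteq> left (2 * i + 2) \<and> (\<forall>c. (0, c) \<in> P \<longleftrightarrow> odd c \<and> c < 2 * i + 2) \<and>
    (\<forall>j<i. (1, 2 * j + 2) \<in> P)" (is "_ \<longleftrightarrow> ?R")
proof
  assume "P \<in> raise i ` arch_sets i"
  then obtain L where P: "P = raise i L" and L: "L \<in> arch_sets i" by blast
  note b = arch_sets_bounds[OF L]
  have "supported P" unfolding supported_def
  proof (intro allI impI)
    fix m c assume "(Suc m, c) \<in> P"
    then have 1: "1 \<le> c" "(m, c - 1) \<in> L" unfolding P up_mem by auto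
    show "1 \<le> c \<and> (m, c - 1) \<in> P \<and> (m, c + 1) \<in> P"
    proof (cases m)
      case 0
      then have "odd (c - 1)" "c - 1 < 2 * i" using 1 L unfolding arch_sets_def by auto
      then show ?thesis using 1(1) unfolding 0 P up_mem by auto
    next
      case (Suc k)
      have "supported L" using L unfolding arch_sets_def by auto
      from closedD[OF this 1(2)[unfolded Suc]] show ?thesis unfolding Suc P up_mem using 1(1) by auto
    qed
  qed
  moreover have "P \<subseteq> left (2 * i + 2)"
  proof
    fix x assume x: "x \<in> P"
    obtain m c where mc: "x = (m, c)" by (cases x)
    show "x \<in> left (2 * i + 2)"
      using x b[of "m - 1" "c - 1"] unfolding mc P by (cases m) (auto simp: up_mem left_def)
  qed
  moreover have "(1, 2 * j + 2) \<in> P" if "j < i" for j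
    using that L up_mem(2)[of 0 "2 * j + 2" i L] unfolding P arch_sets_def by auto
  ultimately show ?R unfolding P by (simp add: up_mem)
next
  assume R: ?R
  define L where "L = {(m, c). (Suc m, Suc c) \<in> P}"
  have cl: "supported P" using R by auto
  have P: "P = raise i L"
  proof (intro set_eqI)
    fix x :: cell
    obtain m c where mc: "x = (m, c)" by (cases x)
    show "x \<in> P \<longleftrightarrow> x \<in> raise i L"
    proof (cases m)
      case 0
      then show ?thesis using R unfolding mc by (simp add: up_mem)
    next
      case (Suc k)
      then show ?thesis using closedD(1)[OF cl, of k c] unfolding mc by (auto simp: up_mem L_def)
    qed
  qed
  have row: "1 \<le> c \<and> c \<le> 2 * i + 2" if "(0, c) \<in> P" for c
  proof -
    have "odd c" "c < 2 * i + 2" using R that by blast+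
    then show ?thesis using odd_ge1[of c] by simp
  qed
  have bd: "1 + m \<le> c" if "(m, c) \<in> P" for m c
    using closed_bounds[OF cl row that] by simp
  have "supported L" unfolding supported_def
  proof (intro allI impI)
    fix m c assume "(Suc m, c) \<in> L"
    then have 1: "(Suc (Suc m), Suc c) \<in> P" by (simp add: L_def)
    have "1 \<le> c" using bd[OF 1] by simp
    then show "1 \<le> c \<and> (m, c - 1) \<in> L \<and> (m, c + 1) \<in> L"
      using closedD[OF cl 1] by (simp add: L_def)
  qed
  moreover have "(0, c) \<in> L \<longleftrightarrow> odd c \<and> c < 2 * i" for c
  proof
    assume "(0, c) \<in> L"
    then have 1: "(Suc 0, Suc c) \<in> P" by (simp add: L_def)
    then have "odd (c + 2)" "(Suc 0, Suc c) \<in> left (2 * i + 2)" using closedD[OF cl 1] R by auto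
    then show "odd c \<and> c < 2 * i" by (auto simp: left_def)
  next
    assume "odd c \<and> c < 2 * i"
    then obtain j where "c = 2 * j + 1" "j < i" by (auto elim!: oddE)
    then show "(0, c) \<in> L" using R by (auto simp: L_def)
  qed
  ultimately have "L \<in> arch_sets i" unfolding arch_sets_def by simp
  then show "P \<in> raise i ` arch_sets i" using P by blast
qed

lemma shift_mem: "(m, c) \<in> shift q R \<longleftrightarrow> q \<le> c \<and> (m, c - q) \<in> R"
  by (simp add: shift_def)

lemma dip_char:
  "P \<in> shift 1 ` arch_sets i \<longleftrightarrow> supported P \<and> P \<subseteq> left (2 * i + 2) \<and> (\<forall>c. (0, c) \<in> P \<longleftrightarrow> even c \<and> 2 \<le> c \<and> c < 2 * i + 2)"
  (is "_ \<longleftrightarrow> ?R")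
proof
  assume "P \<in> shift 1 ` arch_sets i"
  then obtain L where P: "P = shift 1 L" and L: "L \<in> arch_sets i" by blast
  have "supported P" unfolding P using L closed_shift unfolding arch_sets_def by auto
  moreover have "P \<subseteq> left (2 * i + 2)"
    using arch_sets_bounds[OF L] unfolding P shift_def left_def by fastforce
  moreover have "(0, c) \<in> P \<longleftrightarrow> even c \<and> 2 \<le> c \<and> c < 2 * i + 2" for c
  proof (cases c)
    case (Suc d)
    have "(0, d) \<in> L \<longleftrightarrow> odd d \<and> d < 2 * i" using L unfolding arch_sets_def by blast
    moreover have "odd d \<Longrightarrow> 1 \<le> d" by (rule odd_ge1)
    moreover have "odd d \<Longrightarrow> d < Suc (2 * i) \<Longrightarrow> d < 2 * i" by presburger
    ultimately show ?thesis unfolding P shift_mem Suc by auto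
  qed (simp add: P shift_mem)
  ultimately show ?R by blast
next
  assume R: ?R
  define L where "L = {(m, c). (m, Suc c) \<in> P}"
  have cl: "supported P" using R by auto
  have bd: "2 + m \<le> c" if "(m, c) \<in> P" for m c
    using closed_bounds[OF cl _ that, of 2 "2 * i + 2"] R by auto
  have P: "P = shift 1 L" using bd unfolding L_def shift_def by fastforce
  have "supported L" unfolding supported_def
  proof (intro allI impI)
    fix m c assume "(Suc m, c) \<in> L"
    then have 1: "(Suc m, Suc c) \<in> P" by (simp add: L_def)
    have "1 \<le> c" using bd[OF 1] by simp
    then show "1 \<le> c \<and> (m, c - 1) \<in> L \<and> (m, c + 1) \<in> L"
      using closedD[OF cl 1] by (simp add: L_def)
  qed
  moreover have "(0, c) \<in> L \<longleftrightarrow> odd c \<and> c < 2 * i" for c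
  proof -
    have "(0, c) \<in> L \<longleftrightarrow> even (Suc c) \<and> 2 \<le> Suc c \<and> Suc c < 2 * i + 2" using R unfolding L_def by auto
    also have "\<dots> \<longleftrightarrow> odd c \<and> c < 2 * i" by presburger
    finally show ?thesis .
  qed
  ultimately have "L \<in> arch_sets i" unfolding arch_sets_def by simp
  then show "P \<in> shift 1 ` arch_sets i" using P by blast
qed

lemma inj_shift: "inj (shift q)"
proof (rule injI)
  fix A A' assume e: "shift q A = shift q A'"
  have "(m, c) \<in> A \<longleftrightarrow> (m, c) \<in> A'" for m c
    using shift_mem[of m "c + q" q A] shift_mem[of m "c + q" q A'] e by simp
  then show "A = A'" by auto
qed

lemma inj_up: "inj (raise i)"
proof (rule injI)
  fix A A' assume e: "raise i A = raise i A'"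
  have "(m, c) \<in> A \<longleftrightarrow> (m, c) \<in> A'" for m c
    using up_mem(2)[of m "c + 1" i A] up_mem(2)[of m "c + 1" i A'] e by simp
  then show "A = A'" by auto
qed

lemma shift_image: "shift q R = (\<lambda>(m, c). (m, c + q)) ` R"
  unfolding shift_def by force

lemma sum_shift: "(\<Sum>x\<in>shift q R. h x) = (\<Sum>(m, c)\<in>R. h (m, c + q))"
  unfolding shift_image by (subst sum.reindex) (auto simp: inj_on_def case_prod_unfold)

lemma card_shift: "card (shift q R) = card R"
  unfolding shift_image by (rule card_image) (auto simp: inj_on_def)

lemma finite_shift: "finite R \<Longrightarrow> finite (shift q R)"
  unfolding shift_image by simp

lemma cell_stat_glue:
  assumes "finite P" "finite R" "P \<subseteq> left q" "R \<subseteq> right 0"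
  shows "cell_stat (q + l) (P \<union> shift q R) = cat (cell_stat q P) (cell_stat l R)"
proof -
  have d: "P \<inter> shift q R = {}" using assms(3) shift_right[OF assms(4), of q] left_right_disjoint[of q] by blast
  have s: "(\<Sum>x\<in>P \<union> shift q R. h x) = (\<Sum>x\<in>P. h x) + (\<Sum>(m, c)\<in>R. h (m, c + q))" for h :: "cell \<Rightarrow> real"
    using sum.union_disjoint[OF assms(1) finite_shift[OF assms(2), of q] d, of h] by (simp add: sum_shift)
  have "card (P \<union> shift q R) = card P + card R"
    using card_Un_disjoint[OF assms(1) finite_shift[OF assms(2), of q] d] by (simp add: card_shift)
  moreover have "(\<Sum>(m, c)\<in>R. real c + real q) = (\<Sum>(m, c)\<in>R. real c) + real q * real (card R)"
    by (simp add: case_prod_unfold sum.distrib)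
  ultimately show ?thesis unfolding cell_stat_def s by (simp add: case_prod_unfold algebra_simps)
qed

lemma cell_stat_dip: "cell_stat (2 * i + 2) (shift 1 L) = dip (cell_stat (2 * i) L)"
  unfolding cell_stat_def sum_shift card_shift by (simp add: case_prod_unfold sum.distrib)

lemma sum_odds: "(\<Sum>t<n. 2 * real t + 1) = real n ^ 2"
  by (induction n) (auto simp: power2_eq_square algebra_simps)

lemma cell_stat_up:
  assumes "finite L"
  shows "cell_stat (2 * i + 2) (raise i L) = hill (cell_stat (2 * i) L)"
proof -
  let ?r = "(\<lambda>t. (0, 2 * t + 1)) ` {..<Suc i} :: cell set" and ?u = "(\<lambda>(m, c). (Suc m, Suc c)) ` L"
  have e: "raise i L = ?r \<union> ?u"
  proof (intro set_eqI)
    fix x :: cell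
    obtain m c where x: "x = (m, c)" by (cases x)
    show "x \<in> raise i L \<longleftrightarrow> x \<in> ?r \<union> ?u"
    proof (cases m)
      case 0
      have "odd c \<and> c < 2 * i + 2 \<longleftrightarrow> (\<exists>t<Suc i. c = 2 * t + 1)" by (auto elim!: oddE)
      then show ?thesis unfolding x 0 up_mem by auto
    next
      case (Suc k)
      have "1 \<le> c \<and> (k, c - 1) \<in> L \<longleftrightarrow> (\<exists>d. c = Suc d \<and> (k, d) \<in> L)" by (cases c) auto
      then show ?thesis unfolding x Suc up_mem by force
    qed
  qed
  have i1: "inj_on (\<lambda>t. (0, 2 * t + 1) :: cell) {..<Suc i}" by (auto simp: inj_on_def)
  have i2: "inj_on (\<lambda>(m, c). (Suc m, Suc c)) L" by (auto simp: inj_on_def)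
  have s: "(\<Sum>x\<in>raise i L. h x) = (\<Sum>t<Suc i. h (0, 2 * t + 1)) + (\<Sum>(m, c)\<in>L. h (Suc m, Suc c))" for h :: "cell \<Rightarrow> real"
  proof -
    have "(\<Sum>x\<in>raise i L. h x) = (\<Sum>x\<in>?r. h x) + (\<Sum>x\<in>?u. h x)"
      unfolding e by (rule sum.union_disjoint) (use assms in auto)
    then show ?thesis unfolding sum.reindex[OF i1] sum.reindex[OF i2] by (simp add: case_prod_unfold)
  qed
  have "card (raise i L) = card ?r + card ?u" unfolding e by (rule card_Un_disjoint) (use assms in auto)
  then have c: "card (raise i L) = Suc i + card L" by (simp only: card_image[OF i1] card_image[OF i2] card_lessThan)
  have o: "(\<Sum>t<Suc i. real (2 * t + 1)) = (real i + 1)\<^sup>2" using sum_odds[of "Suc i"] by (simp add: add.commute)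
  have e1: "(\<Sum>(m, c)\<in>L. real (Suc m) + 1 / 2) = (\<Sum>(m, c)\<in>L. real m + 1 / 2) + real (card L)"
    and e2: "(\<Sum>(m, c)\<in>L. real (Suc c)) = (\<Sum>(m, c)\<in>L. real c) + real (card L)"
    by (simp_all add: case_prod_unfold sum.distrib)
  have e3: "(\<Sum>t<Suc i. real 0 + 1 / 2) = (real i + 1) / 2" by simp
  show ?thesis
    unfolding cell_stat_def s c hill_def prod.case o e1 e2 e3
    by (simp add: power2_eq_square field_simps)
qed

lemma up_marks: "P \<in> raise i ` arch_sets i \<Longrightarrow> j < i \<Longrightarrow> (1, 2 * j + 2) \<in> P"
  unfolding up_char by blast

lemma arch_sets_right: "R \<in> arch_sets i \<Longrightarrow> R \<subseteq> right 0"
  using arch_sets_bounds unfolding right_def by fastforce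
lemma cell_sets_right: "R \<in> cell_sets t \<Longrightarrow> R \<subseteq> right 0"
  using cell_sets_bounds unfolding right_def by fastforce

lemma sum_arch_sets_Suc:
  fixes F :: "cell set \<Rightarrow> real"
  shows "(\<Sum>A\<in>arch_sets (Suc n). F A) = (\<Sum>i\<le>n. \<Sum>L\<in>arch_sets i. \<Sum>R\<in>arch_sets (n - i). F (raise i L \<union> shift (2 * i + 2) R))"
proof -
  have "(\<Sum>A\<in>arch_sets (Suc n). F A) = (\<Sum>i\<le>n. \<Sum>P\<in>raise i ` arch_sets i. \<Sum>R\<in>arch_sets (n - i). F (P \<union> shift (2 * i + 2) R))"
  proof (rule sum_glue[where r = 1])
    fix i P R assume a: "i \<le> n" "P \<in> raise i ` arch_sets i" "R \<in> arch_sets (n - i)"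
    have "supported P" using a(2) unfolding up_char by blast
    moreover have "supported (shift (2 * i + 2) R)" using a(3) closed_shift unfolding arch_sets_def by blast
    moreover have "(0, c) \<in> P \<union> shift (2 * i + 2) R \<longleftrightarrow> odd c \<and> c < 2 * Suc n" for c
    proof -
      have "(0, c) \<in> P \<longleftrightarrow> odd c \<and> c < 2 * i + 2" using a(2) unfolding up_char by blast
      moreover have "(0, c) \<in> shift (2 * i + 2) R \<longleftrightarrow> 2 * i + 2 \<le> c \<and> odd (c - (2 * i + 2)) \<and> c - (2 * i + 2) < 2 * (n - i)"
        using a(3) unfolding shift_mem arch_sets_def by blast
      moreover have "odd (c - (2 * i + 2)) \<longleftrightarrow> odd c" if "2 * i + 2 \<le> c" using that by simp
      ultimately show ?thesis using a(1) by (cases "2 * i + 2 \<le> c") auto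
    qed
    ultimately show "P \<union> shift (2 * i + 2) R \<in> arch_sets (Suc n)" unfolding arch_sets_def mem_Collect_eq using closed_Un by blast
  next
    fix A i assume A: "A \<in> arch_sets (Suc n)" "(1, 2 * i + 2) \<notin> A" and m: "\<And>j. j < i \<Longrightarrow> (1, 2 * j + 2) \<in> A"
    have cl: "supported A" and r0: "\<And>c. (0, c) \<in> A \<longleftrightarrow> odd c \<and> c < 2 * Suc n" using A(1) unfolding arch_sets_def by auto
    have i: "i \<le> n"
    proof (cases i)
      case (Suc j)
      then have "(Suc 0, 2 * j + 2) \<in> A" using m[of j] by simp
      from closedD(3)[OF cl this] show ?thesis unfolding r0 Suc by simp
    qed simp
    have "(0, 2 * i + 2) \<notin> A" unfolding r0 by simp
    from dichotomy[OF cl this A(2)] have d: "A \<subseteq> left (2 * i + 2) \<union> right (2 * i + 2)" by auto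
    have "A \<inter> left (2 * i + 2) \<in> raise i ` arch_sets i"
      unfolding up_char
    proof (intro conjI allI impI closed_left[OF cl])
      fix c show "(0, c) \<in> A \<inter> left (2 * i + 2) \<longleftrightarrow> odd c \<and> c < 2 * i + 2"
        using i by (auto simp: r0 left_def)
    next
      fix j assume "j < i"
      then show "(1, 2 * j + 2) \<in> A \<inter> left (2 * i + 2)" using m by (simp add: left_def)
    qed simp
    moreover have "unshift (2 * i + 2) A \<in> arch_sets (n - i)"
    proof -
      have "(0, c) \<in> unshift (2 * i + 2) A \<longleftrightarrow> odd c \<and> c < 2 * (n - i)" for c
        using i odd_ge1[of c] by (auto simp: unshift_def r0)
      then show ?thesis using closed_unshift[OF cl, of "2 * i + 2"] unfolding arch_sets_def by blast
    qed
    ultimately show "i \<le> n \<and> A \<subseteq> left (2 * i + 2) \<union> right (2 * i + 2) \<and> A \<inter> left (2 * i + 2) \<in> raise i ` arch_sets i \<and>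
      unshift (2 * i + 2) A \<in> arch_sets (n - i)" using i d by blast
  qed (use finite_arch_sets up_marks arch_sets_right in \<open>auto simp: up_char\<close>)
  also have "\<dots> = (\<Sum>i\<le>n. \<Sum>L\<in>arch_sets i. \<Sum>R\<in>arch_sets (n - i). F (raise i L \<union> shift (2 * i + 2) R))"
    by (simp add: sum.reindex[OF inj_on_subset[OF inj_up]])
  finally show ?thesis .
qed

lemma row_cell_sets:
  assumes P: "supported P" "\<And>c. (0, c) \<in> P \<Longrightarrow> 1 \<le> c \<and> c < 2 * i + 2 \<and> (0, c + 1) \<notin> P"
    and R: "R \<in> cell_sets (2 * (n - i) + 1)" and i: "i \<le> n"
  shows "P \<union> shift (2 * i + 2) R \<in> cell_sets (2 * n + 3)"
proof -
  have "supported R" using R unfolding cell_sets_def by auto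
  then have "supported (P \<union> shift (2 * i + 2) R)" using P(1) closed_shift closed_Un by blast
  moreover have "1 \<le> c \<and> c + 2 \<le> 2 * n + 3 \<and> (0, c + 1) \<notin> P \<union> shift (2 * i + 2) R" if c: "(0, c) \<in> P \<union> shift (2 * i + 2) R" for c
  proof (cases "(0, c) \<in> P")
    case True
    have "(0, c + 1) \<notin> shift (2 * i + 2) R"
      using P(2)[OF True] cell_sets_bounds[OF R, of 0 "c + 1 - (2 * i + 2)"] by (auto simp: shift_mem)
    then show ?thesis using P(2)[OF True] i by auto
  next
    case False
    then have s: "2 * i + 2 \<le> c" "(0, c - (2 * i + 2)) \<in> R" using c by (auto simp: shift_mem)
    have "(0, c + 1) \<notin> P" using P(2)[of "c + 1"] s(1) by auto
    moreover have "(0, c - (2 * i + 2) + 1) \<notin> R" "c - (2 * i + 2) + 2 \<le> 2 * (n - i) + 1"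
      using R s(2) unfolding cell_sets_def by blast+
    moreover have "c + 1 - (2 * i + 2) = c - (2 * i + 2) + 1" using s(1) by simp
    ultimately show ?thesis using s(1) i by (auto simp: shift_mem)
  qed
  ultimately show ?thesis unfolding cell_sets_def by blast
qed

lemma unshift_cell_sets:
  assumes A: "A \<in> cell_sets (2 * n + 3)" and i: "i \<le> n"
  shows "unshift (2 * i + 2) A \<in> cell_sets (2 * (n - i) + 1)"
proof -
  have "supported (unshift (2 * i + 2) A)" using A closed_unshift unfolding cell_sets_def by auto
  moreover have "1 \<le> c \<and> c + 2 \<le> 2 * (n - i) + 1 \<and> (0, c + 1) \<notin> unshift (2 * i + 2) A" if "(0, c) \<in> unshift (2 * i + 2) A" for c
  proof -
    have c: "0 < c" "(0, c + (2 * i + 2)) \<in> A" using that by (auto simp: unshift_def)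
    then have "c + (2 * i + 2) + 2 \<le> 2 * n + 3" "(0, c + (2 * i + 2) + 1) \<notin> A" using A unfolding cell_sets_def by blast+
    then show ?thesis using c(1) i by (auto simp: unshift_def)
  qed
  ultimately show ?thesis unfolding cell_sets_def by blast
qed

lemma sum_cell_sets_hill:
  fixes F :: "cell set \<Rightarrow> real"
  shows "(\<Sum>A\<in>{A \<in> cell_sets (2 * n + 3). (0, 1) \<in> A}. F A) =
    (\<Sum>i\<le>n. \<Sum>L\<in>arch_sets i. \<Sum>R\<in>cell_sets (2 * (n - i) + 1). F (raise i L \<union> shift (2 * i + 2) R))"
proof -
  have "(\<Sum>A\<in>{A \<in> cell_sets (2 * n + 3). (0, 1) \<in> A}. F A) =
    (\<Sum>i\<le>n. \<Sum>P\<in>raise i ` arch_sets i. \<Sum>R\<in>cell_sets (2 * (n - i) + 1). F (P \<union> shift (2 * i + 2) R))"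
  proof (rule sum_glue[where r = 1])
    fix i P R assume a: "i \<le> n" "P \<in> raise i ` arch_sets i" "R \<in> cell_sets (2 * (n - i) + 1)"
    have P: "supported P" "\<And>c. (0, c) \<in> P \<longleftrightarrow> odd c \<and> c < 2 * i + 2" using a(2) unfolding up_char by blast+
    have "P \<union> shift (2 * i + 2) R \<in> cell_sets (2 * n + 3)"
      by (rule row_cell_sets[OF P(1) _ a(3,1)]) (auto simp: P(2) dest: odd_pos)
    then show "P \<union> shift (2 * i + 2) R \<in> {A \<in> cell_sets (2 * n + 3). (0, 1) \<in> A}" using P(2)[of 1] by auto
  next
    fix A i assume "A \<in> {A \<in> cell_sets (2 * n + 3). (0, 1) \<in> A}" and q: "(1, 2 * i + 2) \<notin> A"
      and m: "\<And>j. j < i \<Longrightarrow> (1, 2 * j + 2) \<in> A"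
    then have A: "A \<in> cell_sets (2 * n + 3)" "(0, 1) \<in> A" by auto
    have cl: "supported A" and r0: "\<And>c. (0, c) \<in> A \<Longrightarrow> 1 \<le> c \<and> c + 2 \<le> 2 * n + 3 \<and> (0, c + 1) \<notin> A"
      using A(1) unfolding cell_sets_def by auto
    have od: "(0, 2 * j + 1) \<in> A" if "j \<le> i" for j
    proof (cases j)
      case (Suc k)
      then have "(Suc 0, 2 * k + 2) \<in> A" using m[of k] that by simp
      from closedD(3)[OF cl this] show ?thesis unfolding Suc by simp
    qed (use A(2) in simp)
    have i: "i \<le> n" using r0[OF od[of i]] by simp
    have r: "(0, c) \<in> A \<longleftrightarrow> odd c" if "c < 2 * i + 3" for c
    proof (cases "odd c")
      case True
      then obtain j where "c = 2 * j + 1" by (auto elim: oddE)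
      then show ?thesis using od[of j] that True by simp
    next
      case False
      then obtain j where j: "c = 2 * j" by (auto elim: evenE)
      show ?thesis
      proof (cases j)
        case 0
        then show ?thesis using r0[of 0] j by auto
      next
        case (Suc k)
        have "(0, 2 * k + 1 + 1) \<notin> A" using od[of k] r0[of "2 * k + 1"] that j Suc by auto
        then show ?thesis using j Suc False by simp
      qed
    qed
    have "(0, 2 * i + 2) \<notin> A" using r[of "2 * i + 2"] by simp
    from dichotomy[OF cl this q] have d: "A \<subseteq> left (2 * i + 2) \<union> right (2 * i + 2)" by auto
    have "A \<inter> left (2 * i + 2) \<in> raise i ` arch_sets i"
      unfolding up_char
    proof (intro conjI allI impI closed_left[OF cl])
      fix c show "(0, c) \<in> A \<inter> left (2 * i + 2) \<longleftrightarrow> odd c \<and> c < 2 * i + 2"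
        using r[of c] by (auto simp: left_def)
    next
      fix j assume "j < i"
      then show "(1, 2 * j + 2) \<in> A \<inter> left (2 * i + 2)" using m by (simp add: left_def)
    qed simp
    then show "i \<le> n \<and> A \<subseteq> left (2 * i + 2) \<union> right (2 * i + 2) \<and> A \<inter> left (2 * i + 2) \<in> raise i ` arch_sets i \<and>
      unshift (2 * i + 2) A \<in> cell_sets (2 * (n - i) + 1)" using i d unshift_cell_sets[OF A(1) i] by blast
  qed (use finite_arch_sets finite_cell_sets up_marks cell_sets_right in \<open>auto simp: up_char\<close>)
  also have "\<dots> = (\<Sum>i\<le>n. \<Sum>L\<in>arch_sets i. \<Sum>R\<in>cell_sets (2 * (n - i) + 1). F (raise i L \<union> shift (2 * i + 2) R))"
    by (simp add: sum.reindex[OF inj_on_subset[OF inj_up]])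
  finally show ?thesis .
qed

lemma sum_cell_sets_dip:
  fixes F :: "cell set \<Rightarrow> real"
  shows "(\<Sum>A\<in>{A \<in> cell_sets (2 * n + 3). (0, 1) \<notin> A}. F A) =
    (\<Sum>i\<le>n. \<Sum>L\<in>arch_sets i. \<Sum>R\<in>cell_sets (2 * (n - i) + 1). F (shift 1 L \<union> shift (2 * i + 2) R))"
proof -
  have "(\<Sum>A\<in>{A \<in> cell_sets (2 * n + 3). (0, 1) \<notin> A}. F A) =
    (\<Sum>i\<le>n. \<Sum>P\<in>shift 1 ` arch_sets i. \<Sum>R\<in>cell_sets (2 * (n - i) + 1). F (P \<union> shift (2 * i + 2) R))"
  proof (rule sum_glue[where r = 0])
    fix i P R assume a: "i \<le> n" "P \<in> shift 1 ` arch_sets i" "R \<in> cell_sets (2 * (n - i) + 1)"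
    have P: "supported P" "\<And>c. (0, c) \<in> P \<longleftrightarrow> even c \<and> 2 \<le> c \<and> c < 2 * i + 2" using a(2) unfolding dip_char by blast+
    have "P \<union> shift (2 * i + 2) R \<in> cell_sets (2 * n + 3)"
      by (rule row_cell_sets[OF P(1) _ a(3,1)]) (auto simp: P(2))
    moreover have "(0, 1) \<notin> P \<union> shift (2 * i + 2) R" using P(2)[of 1] by (auto simp: shift_mem)
    ultimately show "P \<union> shift (2 * i + 2) R \<in> {A \<in> cell_sets (2 * n + 3). (0, 1) \<notin> A}" by auto
  next
    fix i P j assume "P \<in> shift 1 ` arch_sets i" "j < i"
    then show "(0, 2 * j + 2) \<in> P" unfolding dip_char by auto
  next
    fix A i assume "A \<in> {A \<in> cell_sets (2 * n + 3). (0, 1) \<notin> A}" and q: "(0, 2 * i + 2) \<notin> A"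
      and m: "\<And>j. j < i \<Longrightarrow> (0, 2 * j + 2) \<in> A"
    then have A: "A \<in> cell_sets (2 * n + 3)" "(0, 1) \<notin> A" by auto
    have cl: "supported A" and r0: "\<And>c. (0, c) \<in> A \<Longrightarrow> 1 \<le> c \<and> c + 2 \<le> 2 * n + 3 \<and> (0, c + 1) \<notin> A"
      using A(1) unfolding cell_sets_def by auto
    have i: "i \<le> n"
    proof (cases i)
      case (Suc j)
      then show ?thesis using r0[OF m[of j]] by simp
    qed simp
    have r: "(0, c) \<in> A \<longleftrightarrow> even c \<and> 2 \<le> c" if "c < 2 * i + 2" for c
    proof (cases "odd c")
      case True
      then obtain j where j: "c = 2 * j + 1" by (auto elim: oddE)
      show ?thesis
      proof (cases j)
        case 0
        then show ?thesis using A(2) j by auto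
      next
        case (Suc k)
        have "(0, 2 * k + 2 + 1) \<notin> A" using r0[OF m[of k]] that j Suc by auto
        then show ?thesis using j Suc True by simp
      qed
    next
      case False
      then obtain j where j: "c = 2 * j" by (auto elim: evenE)
      show ?thesis
      proof (cases j)
        case 0
        then show ?thesis using r0[of 0] j by auto
      next
        case (Suc k)
        then show ?thesis using m[of k] that j by simp
      qed
    qed
    have "(1, 2 * i + 2) \<notin> A"
      using closedD(2)[OF cl, of 0 "2 * i + 2"] r[of "2 * i + 1"] by auto
    from dichotomy[OF cl q this] have d: "A \<subseteq> left (2 * i + 2) \<union> right (2 * i + 2)" by auto
    have "A \<inter> left (2 * i + 2) \<in> shift 1 ` arch_sets i"
      unfolding dip_char
    proof (intro conjI allI impI closed_left[OF cl])
      fix c show "(0, c) \<in> A \<inter> left (2 * i + 2) \<longleftrightarrow> even c \<and> 2 \<le> c \<and> c < 2 * i + 2"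
        using r[of c] by (auto simp: left_def)
    qed simp
    then show "i \<le> n \<and> A \<subseteq> left (2 * i + 2) \<union> right (2 * i + 2) \<and> A \<inter> left (2 * i + 2) \<in> shift 1 ` arch_sets i \<and>
      unshift (2 * i + 2) A \<in> cell_sets (2 * (n - i) + 1)" using i d unshift_cell_sets[OF A(1) i] by blast
  next
    fix i P assume "P \<in> shift 1 ` arch_sets i"
    then show "P \<subseteq> left (2 * i + 2)" unfolding dip_char by blast
  qed (use finite_arch_sets finite_cell_sets cell_sets_right in auto)
  also have "\<dots> = (\<Sum>i\<le>n. \<Sum>L\<in>arch_sets i. \<Sum>R\<in>cell_sets (2 * (n - i) + 1). F (shift 1 L \<union> shift (2 * i + 2) R))"
    by (simp add: sum.reindex[OF inj_on_subset[OF inj_shift]])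
  finally show ?thesis .
qed

lemma cell_stat_hill_glue:
  assumes "L \<in> arch_sets i" "R \<subseteq> right 0" "finite R" "i \<le> n"
  shows "cell_stat (2 * Suc n) (raise i L \<union> shift (2 * i + 2) R) = cat (hill (cell_stat (2 * i) L)) (cell_stat (2 * (n - i)) R)"
    "cell_stat (2 * Suc n) (shift 1 L \<union> shift (2 * i + 2) R) = cat (dip (cell_stat (2 * i) L)) (cell_stat (2 * (n - i)) R)"
proof -
  have l: "2 * Suc n = 2 * i + 2 + 2 * (n - i)" using assms(4) by simp
  have u: "raise i L \<subseteq> left (2 * i + 2)" "shift 1 L \<subseteq> left (2 * i + 2)"
  proof -
    have "raise i L \<in> raise i ` arch_sets i" "shift 1 L \<in> shift 1 ` arch_sets i" using assms(1) by blast+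
    then show "raise i L \<subseteq> left (2 * i + 2)" "shift 1 L \<subseteq> left (2 * i + 2)"
      unfolding up_char[of "raise i L"] dip_char[of "shift 1 L"] by blast+
  qed
  have "finite L" using finite_arch_sets(2)[OF assms(1)] .
  moreover have "finite (raise i L)" by (rule finite_subset[of _ "{..2 * i + 2} \<times> {..2 * i + 2}"]) (use u(1) in \<open>auto simp: left_def\<close>)
  ultimately show
    "cell_stat (2 * Suc n) (raise i L \<union> shift (2 * i + 2) R) = cat (hill (cell_stat (2 * i) L)) (cell_stat (2 * (n - i)) R)"
    "cell_stat (2 * Suc n) (shift 1 L \<union> shift (2 * i + 2) R) = cat (dip (cell_stat (2 * i) L)) (cell_stat (2 * (n - i)) R)"
    using cell_stat_glue[OF _ assms(3) u(1) assms(2)] cell_stat_glue[OF _ assms(3) u(2) assms(2)] finite_shift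
    unfolding l by (simp_all add: cell_stat_up[simplified] cell_stat_dip[simplified])
qed

lemma arch_sets_0: "arch_sets 0 = {{}}"
proof -
  have "A = {}" if "A \<in> arch_sets 0" for A using arch_sets_bounds[OF that] by (cases "A = {}") auto
  moreover have "{} \<in> arch_sets 0" by (simp add: arch_sets_def supported_def)
  ultimately show ?thesis by blast
qed

lemma cell_sets_1: "cell_sets 1 = {{}}"
proof -
  have "A = {}" if "A \<in> cell_sets 1" for A using cell_sets_bounds[OF that] by (cases "A = {}") auto
  moreover have "{} \<in> cell_sets 1" by (simp add: cell_sets_def supported_def)
  ultimately show ?thesis by blast
qed

theorem sum_arch_sets: "(\<Sum>A\<in>arch_sets n. f (cell_stat (2 * n) A)) = (\<Sum>s\<leftarrow>arches n. f s :: real)"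
proof (induction n arbitrary: f rule: less_induct)
  case (less n)
  show ?case
  proof (cases n)
    case 0
    then show ?thesis by (simp add: arch_sets_0 cell_stat_def)
  next
    case (Suc k)
    have "(\<Sum>A\<in>arch_sets n. f (cell_stat (2 * n) A)) =
        (\<Sum>i\<le>k. \<Sum>L\<in>arch_sets i. \<Sum>R\<in>arch_sets (k - i). f (cat (hill (cell_stat (2 * i) L)) (cell_stat (2 * (k - i)) R)))"
      unfolding Suc sum_arch_sets_Suc by (intro sum.cong refl) (simp only: atMost_iff cell_stat_hill_glue(1) arch_sets_right finite_arch_sets(2))
    also have "\<dots> = (\<Sum>i\<le>k. \<Sum>s\<leftarrow>arches i. \<Sum>t\<leftarrow>arches (k - i). f (cat (hill s) t))"
    proof (rule sum.cong[OF refl])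
      fix i assume "i \<in> {..k}"
      then have i: "i < n" "k - i < n" using Suc by auto
      show "(\<Sum>L\<in>arch_sets i. \<Sum>R\<in>arch_sets (k - i). f (cat (hill (cell_stat (2 * i) L)) (cell_stat (2 * (k - i)) R))) =
          (\<Sum>s\<leftarrow>arches i. \<Sum>t\<leftarrow>arches (k - i). f (cat (hill s) t))"
        using less.IH[OF i(2), of "\<lambda>t. f (cat (hill s) t)" for s] less.IH[OF i(1), of "\<lambda>s. \<Sum>t\<leftarrow>arches (k - i). f (cat (hill s) t)"]
        by simp
    qed
    finally show ?thesis unfolding Suc sum_arches_Suc .
  qed
qed

lemma sum_cell_sets_hill_lists:
  fixes f :: "stat \<Rightarrow> real"
  assumes "\<And>j g. j \<le> n \<Longrightarrow> (\<Sum>A\<in>cell_sets (2 * j + 1). g (cell_stat (2 * j) A)) = (\<Sum>s\<leftarrow>chains j. g s :: real)"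
  shows "(\<Sum>A\<in>{A \<in> cell_sets (2 * n + 3). (0, 1) \<in> A}. f (cell_stat (2 * Suc n) A)) =
      (\<Sum>i\<le>n. \<Sum>s\<leftarrow>arches i. \<Sum>t\<leftarrow>chains (n - i). f (cat (hill s) t))"
    and "(\<Sum>A\<in>{A \<in> cell_sets (2 * n + 3). (0, 1) \<notin> A}. f (cell_stat (2 * Suc n) A)) =
      (\<Sum>i\<le>n. \<Sum>s\<leftarrow>arches i. \<Sum>t\<leftarrow>chains (n - i). f (cat (dip s) t))"
proof -
  have c: "(\<Sum>L\<in>arch_sets i. \<Sum>R\<in>cell_sets (2 * (n - i) + 1). f (cat (h (cell_stat (2 * i) L)) (cell_stat (2 * (n - i)) R))) =
      (\<Sum>s\<leftarrow>arches i. \<Sum>t\<leftarrow>chains (n - i). f (cat (h s) t))" for i and h :: "stat \<Rightarrow> stat"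
    using assms[of "n - i" "\<lambda>t. f (cat (h s) t)" for s] sum_arch_sets[of "\<lambda>s. \<Sum>t\<leftarrow>chains (n - i). f (cat (h s) t)" i] by simp
  show "(\<Sum>A\<in>{A \<in> cell_sets (2 * n + 3). (0, 1) \<in> A}. f (cell_stat (2 * Suc n) A)) =
      (\<Sum>i\<le>n. \<Sum>s\<leftarrow>arches i. \<Sum>t\<leftarrow>chains (n - i). f (cat (hill s) t))"
    unfolding sum_cell_sets_hill c[symmetric]
    by (intro sum.cong refl) (simp only: atMost_iff cell_stat_hill_glue(1) cell_sets_right finite_cell_sets(2))
  show "(\<Sum>A\<in>{A \<in> cell_sets (2 * n + 3). (0, 1) \<notin> A}. f (cell_stat (2 * Suc n) A)) =
      (\<Sum>i\<le>n. \<Sum>s\<leftarrow>arches i. \<Sum>t\<leftarrow>chains (n - i). f (cat (dip s) t))"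
    unfolding sum_cell_sets_dip c[symmetric]
    by (intro sum.cong refl) (simp only: atMost_iff cell_stat_hill_glue(2) cell_sets_right finite_cell_sets(2))
qed

lemma sum_list_add2: "(\<Sum>s\<leftarrow>xs. \<Sum>t\<leftarrow>ys. f s t + g s t) = (\<Sum>s\<leftarrow>xs. \<Sum>t\<leftarrow>ys. f s t) + (\<Sum>s\<leftarrow>xs. \<Sum>t\<leftarrow>ys. g s t :: real)"
  "(\<Sum>s\<leftarrow>xs. \<Sum>t\<leftarrow>ys. f s t - g s t) = (\<Sum>s\<leftarrow>xs. \<Sum>t\<leftarrow>ys. f s t) - (\<Sum>s\<leftarrow>xs. \<Sum>t\<leftarrow>ys. g s t :: real)"
  by (simp_all add: sum_list_addf sum_list_subtractf)

theorem sum_cell_sets: "(\<Sum>A\<in>cell_sets (2 * n + 1). f (cell_stat (2 * n) A)) = (\<Sum>s\<leftarrow>chains n. f s :: real)"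
proof (induction n arbitrary: f rule: less_induct)
  case (less n)
  show ?case
  proof (cases n)
    case 0
    then show ?thesis using cell_sets_1 by (simp add: cell_stat_def)
  next
    case (Suc k)
    have ih: "(\<Sum>A\<in>cell_sets (2 * j + 1). g (cell_stat (2 * j) A)) = (\<Sum>s\<leftarrow>chains j. g s :: real)" if "j \<le> k" for j g
      using less.IH[of j g] that Suc by simp
    have "cell_sets (2 * n + 1) = {A \<in> cell_sets (2 * k + 3). (0, 1) \<in> A} \<union> {A \<in> cell_sets (2 * k + 3). (0, 1) \<notin> A}"
      unfolding Suc by (auto simp: numeral_3_eq_3)
    then have "(\<Sum>A\<in>cell_sets (2 * n + 1). f (cell_stat (2 * n) A)) =
        (\<Sum>A\<in>{A \<in> cell_sets (2 * k + 3). (0, 1) \<in> A}. f (cell_stat (2 * Suc k) A)) +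
        (\<Sum>A\<in>{A \<in> cell_sets (2 * k + 3). (0, 1) \<notin> A}. f (cell_stat (2 * Suc k) A))"
      unfolding Suc by (simp only:) (rule sum.union_disjoint, auto simp: finite_cell_sets)
    moreover have "(\<Sum>s\<leftarrow>chains (Suc k). f s) = (\<Sum>i\<le>k. \<Sum>s\<leftarrow>arches i. \<Sum>t\<leftarrow>chains (k - i). f (cat (hill s) t)) +
        (\<Sum>i\<le>k. \<Sum>s\<leftarrow>arches i. \<Sum>t\<leftarrow>chains (k - i). f (cat (dip s) t))"
      by (simp only: sum_chains_Suc sum_list_add2 sum.distrib)
    ultimately show ?thesis
      using sum_cell_sets_hill_lists[where f = f and n = k, OF ih] unfolding Suc by linarith
  qed
qed

text \<open>The sign \<open>+\<close> belongs to the sets whose first block is a hill, that is, those containing the cell \<open>(0, 1)\<close>.\<close>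

theorem sum_cell_sets_signed:
  fixes f :: "stat \<Rightarrow> real"
  shows "(\<Sum>A\<in>{A \<in> cell_sets (2 * n + 3). (0, 1) \<in> A}. f (cell_stat (2 * Suc n) A)) -
   (\<Sum>A\<in>{A \<in> cell_sets (2 * n + 3). (0, 1) \<notin> A}. f (cell_stat (2 * Suc n) A)) = signed_sum f n"
proof -
  have "signed_sum f n = (\<Sum>i\<le>n. \<Sum>s\<leftarrow>arches i. \<Sum>t\<leftarrow>chains (n - i). f (cat (hill s) t)) -
      (\<Sum>i\<le>n. \<Sum>s\<leftarrow>arches i. \<Sum>t\<leftarrow>chains (n - i). f (cat (dip s) t))"
    by (simp only: signed_sum_def sum_list_add2 sum_subtractf)
  then show ?thesis using sum_cell_sets_hill_lists[where f = f and n = n, OF sum_cell_sets] by linarith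
qed

section \<open>Telescoping\<close>

abbreviation "core_hooks n \<equiv> hook_sets (2 * n + 1) (2 * n + 3)"

lemma core_hooks_D:
  assumes "X \<in> core_hooks n"
  shows "finite X" "0 \<notin> X" "x \<in> X \<Longrightarrow> 2 * n + 1 \<le> x \<Longrightarrow> x - (2 * n + 1) \<in> X"
    "x \<in> X \<Longrightarrow> 2 * n + 3 \<le> x \<Longrightarrow> x - (2 * n + 3) \<in> X" "x \<in> X \<Longrightarrow> Suc x \<notin> X"
  using assms unfolding hook_sets_def by auto

lemma core_hooks_I:
  assumes "finite X" "0 \<notin> X" "\<And>x. x \<in> X \<Longrightarrow> 2 * n + 1 \<le> x \<Longrightarrow> x - (2 * n + 1) \<in> X"
    "\<And>x. x \<in> X \<Longrightarrow> 2 * n + 3 \<le> x \<Longrightarrow> x - (2 * n + 3) \<in> X" "\<And>x. x \<in> X \<Longrightarrow> Suc x \<notin> X"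
  shows "X \<in> core_hooks n"
  using assms unfolding hook_sets_def by auto

lemma core_hooks_sub:
  assumes X: "X \<in> core_hooks n"
  shows "x \<in> X \<Longrightarrow> a * (2 * n + 1) + b * (2 * n + 3) \<le> x \<Longrightarrow> x - (a * (2 * n + 1) + b * (2 * n + 3)) \<in> X"
proof (induction a)
  case 0
  have "b * (2 * n + 3) \<le> x \<Longrightarrow> x - b * (2 * n + 3) \<in> X" for b
  proof (induction b)
    case (Suc b)
    then have "x - b * (2 * n + 3) - (2 * n + 3) \<in> X" by (intro core_hooks_D(4)[OF X]) auto
    then show ?case by (simp add: algebra_simps)
  qed (use 0 in simp)
  then show ?case using 0 by simp
next
  case (Suc a)
  then have "x - (a * (2 * n + 1) + b * (2 * n + 3)) - (2 * n + 1) \<in> X" by (intro core_hooks_D(3)[OF X]) auto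
  then show ?case by (simp add: algebra_simps)
qed

text \<open>Since \<open>t = s + 2\<close> and \<open>s\<close> is odd, every residue modulo \<open>s\<close> is a multiple of \<open>t\<close>; an element above
\<open>s * t\<close> would lead down to zero.\<close>

lemma core_hooks_bound:
  assumes X: "X \<in> core_hooks n" and x: "x \<in> X"
  shows "x < (2 * n + 1) * (2 * n + 3)"
proof (rule ccontr)
  assume "\<not> ?thesis"
  then have big: "(2 * n + 1) * (2 * n + 3) \<le> x" by simp
  define s r q where "s = 2 * n + 1" and "r = x mod s" and "q = x div s"
  have s: "0 < s" unfolding s_def by simp
  have r: "r < s" "x = s * q + r" using s unfolding r_def q_def by simp_all
  \<comment> \<open>As \<open>t\<close> is 2 modulo \<open>s\<close>, the multiple of \<open>t\<close> congruent to \<open>r\<close> comes from halving \<open>r\<close> or \<open>r + s\<close>.\<close>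
  have "\<exists>b d. 2 * b = r + d * s \<and> b \<le> s"
  proof (cases "even r")
    case True
    then show ?thesis using r(1) by (intro exI[of _ "r div 2"] exI[of _ 0]) simp
  next
    case False
    then have "even (r + 1 * s)" unfolding s_def by simp
    then show ?thesis using r(1) by (intro exI[of _ "(r + 1 * s) div 2"] exI[of _ 1]) simp
  qed
  then obtain b d where b: "2 * b = r + d * s" "b \<le> s" by blast
  have t: "b * (2 * n + 3) = s * (b + d) + r"
  proof -
    have "b * (2 * n + 3) = b * s + 2 * b" unfolding s_def by (simp add: algebra_simps)
    then show ?thesis unfolding b(1) by (simp add: algebra_simps)
  qed
  have "b * (2 * n + 3) \<le> s * (2 * n + 3)" using b(2) by (rule mult_le_mono1)
  then have "s * (b + d) + r \<le> s * q + r" using big r(2) t unfolding s_def by simp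
  then have "s * (b + d) \<le> s * q" by simp
  then have bd: "b + d \<le> q" using s by (simp only: mult_le_cancel1)
  have "(q - (b + d)) * (2 * n + 1) + b * (2 * n + 3) = x"
  proof -
    have "s * q = s * (b + d) + s * (q - (b + d))"
      unfolding add_mult_distrib2[symmetric] using bd by simp
    then have "(q - (b + d)) * s + (s * (b + d) + r) = x" unfolding r(2) by (simp only: mult.commute add_ac)
    then show ?thesis unfolding t by (simp only: s_def)
  qed
  then have "x - x \<in> X" using core_hooks_sub[OF X x, of "q - (b + d)" b] by simp
  then show False using core_hooks_D(2)[OF X] by simp
qed

lemma finite_core_hooks: "finite (core_hooks n)"
  by (rule finite_subset[of _ "Pow {..<(2 * n + 1) * (2 * n + 3)}"]) (use core_hooks_bound in blast, simp)

definition Phi :: "nat set \<Rightarrow> nat set" where "Phi X = insert 1 ((\<lambda>x. x + 2) ` X)"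
definition unPhi :: "nat set \<Rightarrow> nat set" where "unPhi Z = {y. y + 2 \<in> Z}"

lemma Phi_mem: "y \<in> Phi X \<longleftrightarrow> y = 1 \<or> 2 \<le> y \<and> y - 2 \<in> X"
  unfolding Phi_def by (force simp: image_iff)

lemma unPhi_Phi: "unPhi (Phi X) = X" unfolding unPhi_def by (auto simp: Phi_mem)
lemma Phi_unPhi: "1 \<in> Z \<Longrightarrow> 0 \<notin> Z \<Longrightarrow> Phi (unPhi Z) = Z"
proof (intro set_eqI)
  fix y assume "1 \<in> Z" "0 \<notin> Z"
  then show "y \<in> Phi (unPhi Z) \<longleftrightarrow> y \<in> Z"
    by (cases y; cases "y - 1") (auto simp: Phi_mem unPhi_def numeral_2_eq_2)
qed

lemma Phi_stats:
  assumes "finite X"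
  shows "card (Phi X) = Suc (card X)" "drift (Phi X) = drift X"
proof -
  have i: "inj_on (\<lambda>x. x + 2) X" by (simp add: inj_on_def)
  have n: "1 \<notin> (\<lambda>x. x + 2) ` X" by auto
  show c: "card (Phi X) = Suc (card X)" unfolding Phi_def using assms n card_image[OF i] by simp
  have "\<Sum>(Phi X) = 1 + (\<Sum>x\<in>X. x + 2)"
    unfolding Phi_def using assms n sum.reindex[OF i, of id] by simp
  then have "real (\<Sum>(Phi X)) = 1 + real (\<Sum>X) + 2 * real (card X)" by (simp add: sum.distrib)
  then show "drift (Phi X) = drift X" unfolding drift_def c by (simp add: power2_eq_square algebra_simps)
qed

lemma unPhi_core_hooks:
  assumes n: "1 \<le> n" and Z: "finite Z" "1 \<in> Z" "2 \<notin> Z" and nc: "\<And>y. y \<in> Z \<Longrightarrow> Suc y \<notin> Z"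
    and s: "\<And>y. y \<in> Z \<Longrightarrow> 2 * n + 3 \<le> y \<Longrightarrow> y - (2 * n + 1) \<in> Z"
    and t: "\<And>y. y \<in> Z \<Longrightarrow> 2 * n + 5 \<le> y \<Longrightarrow> y - (2 * n + 3) \<in> Z"
  shows "unPhi Z \<in> core_hooks n"
proof (rule core_hooks_I)
  show "finite (unPhi Z)" unfolding unPhi_def using finite_vimageI[OF Z(1), of "\<lambda>y. y + 2"] by (simp add: vimage_def inj_def)
  show "0 \<notin> unPhi Z" unfolding unPhi_def using Z(3) by (simp add: numeral_2_eq_2)
  fix x assume x: "x \<in> unPhi Z"
  then show "Suc x \<notin> unPhi Z" using nc[of "x + 2"] unfolding unPhi_def by simp
  { assume le: "2 * n + 1 \<le> x"
    then have "x + 2 - (2 * n + 1) = x - (2 * n + 1) + 2" by simp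
    moreover have "x + 2 - (2 * n + 1) \<in> Z" by (rule s) (use x le in \<open>auto simp: unPhi_def\<close>)
    ultimately show "x - (2 * n + 1) \<in> unPhi Z" by (simp only: unPhi_def mem_Collect_eq) }
  { assume le: "2 * n + 3 \<le> x"
    then have "x + 2 - (2 * n + 3) = x - (2 * n + 3) + 2" by simp
    moreover have "x + 2 - (2 * n + 3) \<in> Z" by (rule t) (use x le in \<open>auto simp: unPhi_def\<close>)
    ultimately show "x - (2 * n + 3) \<in> unPhi Z" by (simp only: unPhi_def mem_Collect_eq) }
qed

lemma Phi_bij:
  assumes n: "1 \<le> n"
  shows "bij_betw Phi {X \<in> core_hooks n. 2 * n \<in> X} {X \<in> core_hooks n. 2 * n + 2 \<in> X}"
proof (rule bij_betw_byWitness[where f' = unPhi])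
  show "\<forall>X\<in>{X \<in> core_hooks n. 2 * n \<in> X}. unPhi (Phi X) = X" by (simp add: unPhi_Phi)
  have one: "1 \<in> Z" if "Z \<in> core_hooks n" "2 * n + 2 \<in> Z" for Z
    using core_hooks_D(3)[OF that] by simp
  show "\<forall>Z\<in>{X \<in> core_hooks n. 2 * n + 2 \<in> X}. Phi (unPhi Z) = Z"
    using one core_hooks_D(2) Phi_unPhi by blast
  show "Phi ` {X \<in> core_hooks n. 2 * n \<in> X} \<subseteq> {X \<in> core_hooks n. 2 * n + 2 \<in> X}"
  proof (intro image_subsetI)
    fix X assume "X \<in> {X \<in> core_hooks n. 2 * n \<in> X}"
    then have X: "X \<in> core_hooks n" "2 * n \<in> X" by auto
    note d = core_hooks_D[OF X(1)]
    have e: "2 * n + 1 \<notin> X" "2 * n - 1 \<notin> X" using d(5)[OF X(2)] d(5)[of "2 * n - 1"] X(2) n by auto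
    have "Phi X \<in> core_hooks n"
    proof (rule core_hooks_I)
      show "finite (Phi X)" unfolding Phi_def using d(1) by simp
      show "0 \<notin> Phi X" unfolding Phi_mem by simp
      fix x assume x: "x \<in> Phi X"
      show "Suc x \<notin> Phi X"
      proof (cases "x = 1")
        case True
        then show ?thesis using d(2) by (simp add: Phi_mem)
      next
        case False
        then have "2 \<le> x" "x - 2 \<in> X" using x by (auto simp: Phi_mem)
        then have e: "Suc x - 2 = Suc (x - 2)" "x - 2 \<in> X" "Suc x \<noteq> 1" by auto
        show ?thesis unfolding Phi_mem e(1) using d(5)[OF e(2)] e(3) by blast
      qed
      { assume le: "2 * n + 1 \<le> x"
        then have x2: "x - 2 \<in> X" "2 \<le> x" using x n by (auto simp: Phi_mem)
        show "x - (2 * n + 1) \<in> Phi X"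
        proof (cases "2 * n + 1 \<le> x - 2")
          case True
          have e: "x - 2 - (2 * n + 1) = x - (2 * n + 1) - 2" by simp
          have "2 \<le> x - (2 * n + 1)" using True by arith
          then show ?thesis using d(3)[OF x2(1) True] unfolding Phi_mem e by blast
        next
          case False
          then have "x = 2 * n + 1 \<or> x = 2 * n + 2" using le by auto
          then show ?thesis using x2 e by (auto simp: Phi_mem)
        qed }
      { assume le: "2 * n + 3 \<le> x"
        then have x2: "x - 2 \<in> X" "2 \<le> x" using x n by (auto simp: Phi_mem)
        show "x - (2 * n + 3) \<in> Phi X"
        proof (cases "2 * n + 3 \<le> x - 2")
          case True
          have e: "x - 2 - (2 * n + 3) = x - (2 * n + 3) - 2" by simp
          have "2 \<le> x - (2 * n + 3)" using True by arith
          then show ?thesis using d(4)[OF x2(1) True] unfolding Phi_mem e by blast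
        next
          case False
          then have "x = 2 * n + 3 \<or> x = 2 * n + 4" using le by auto
          then show ?thesis using x2 e by (auto simp: Phi_mem)
        qed }
    qed
    moreover have "2 * n + 2 \<in> Phi X" using X(2) by (simp add: Phi_mem)
    ultimately show "Phi X \<in> {X \<in> core_hooks n. 2 * n + 2 \<in> X}" by simp
  qed
  show "unPhi ` {X \<in> core_hooks n. 2 * n + 2 \<in> X} \<subseteq> {X \<in> core_hooks n. 2 * n \<in> X}"
  proof (intro image_subsetI)
    fix Z assume "Z \<in> {X \<in> core_hooks n. 2 * n + 2 \<in> X}"
    then have Z: "Z \<in> core_hooks n" "2 * n + 2 \<in> Z" by auto
    note d = core_hooks_D[OF Z(1)]
    have "2 \<notin> Z" using d(5)[OF one[OF Z]] by (simp add: numeral_2_eq_2)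
    then have "unPhi Z \<in> core_hooks n" using unPhi_core_hooks[OF n d(1) one[OF Z] _ d(5)] d(3,4) by auto
    then show "unPhi Z \<in> {X \<in> core_hooks n. 2 * n \<in> X}" using Z(2) by (simp add: unPhi_def)
  qed
qed

definition tri_sum :: "nat \<Rightarrow> real \<Rightarrow> nat \<Rightarrow> real" where
  "tri_sum k J M = (\<Sum>i<M. (J + tri i) ^ k)"

lemma sum_split_mem:
  assumes "finite S"
  shows "(\<Sum>X\<in>S. h X) = (\<Sum>X\<in>{X \<in> S. P X}. h X) + (\<Sum>X\<in>{X \<in> S. \<not> P X}. (h X :: real))"
  using sum.union_disjoint[of "{X \<in> S. P X}" "{X \<in> S. \<not> P X}" h] assms
  by (simp add: Collect_disj_eq[symmetric] conj_disj_distribL[symmetric] disjoint_iff)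

text \<open>With \<open>J\<close> the drift and \<open>M\<close> the number of elements, the \<open>k\<close>-th power of the size is
\<open>tri_sum k J (M + 1) - tri_sum k J M\<close>. The first term at \<open>X\<close> is the second one at \<open>Phi X\<close>, hence the terms of
sets containing \<open>2 * n\<close> cancel against those of sets containing \<open>w\<close>.\<close>

lemma telescope:
  assumes n: "1 \<le> n"
  shows "(\<Sum>X\<in>core_hooks n. (drift X + tri (card X)) ^ k) =
    (\<Sum>Z\<in>Phi ` {X \<in> core_hooks n. 2 * n \<notin> X}. tri_sum k (drift Z) (card Z)) -
    (\<Sum>X\<in>{X \<in> core_hooks n. 2 * n + 2 \<notin> X}. tri_sum k (drift X) (card X))"
proof -
  let ?g = "\<lambda>X. tri_sum k (drift X) (card X)" and ?h = "\<lambda>X. tri_sum k (drift X) (Suc (card X))"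
  have h: "?g (Phi X) = ?h X" if "X \<in> core_hooks n" for X
    using Phi_stats[OF core_hooks_D(1)[OF that]] by simp
  have inj: "inj_on Phi S" for S by (metis inj_onI unPhi_Phi)
  have "(\<Sum>X\<in>core_hooks n. (drift X + tri (card X)) ^ k) = (\<Sum>X\<in>core_hooks n. ?h X) - (\<Sum>X\<in>core_hooks n. ?g X)"
    unfolding sum_subtractf[symmetric] by (rule sum.cong) (simp_all add: tri_sum_def)
  moreover have "(\<Sum>X\<in>core_hooks n. ?h X) = (\<Sum>X\<in>{X \<in> core_hooks n. 2 * n \<in> X}. ?h X) + (\<Sum>X\<in>{X \<in> core_hooks n. 2 * n \<notin> X}. ?h X)"
    by (rule sum_split_mem[OF finite_core_hooks])
  moreover have "(\<Sum>X\<in>core_hooks n. ?g X) = (\<Sum>X\<in>{X \<in> core_hooks n. 2 * n + 2 \<in> X}. ?g X) + (\<Sum>X\<in>{X \<in> core_hooks n. 2 * n + 2 \<notin> X}. ?g X)"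
    by (rule sum_split_mem[OF finite_core_hooks])
  moreover have "(\<Sum>X\<in>{X \<in> core_hooks n. 2 * n + 2 \<in> X}. ?g X) = (\<Sum>X\<in>{X \<in> core_hooks n. 2 * n \<in> X}. ?h X)"
    unfolding sum.reindex_bij_betw[OF Phi_bij[OF n], symmetric] by (rule sum.cong) (simp_all add: h)
  moreover have "(\<Sum>Z\<in>Phi ` {X \<in> core_hooks n. 2 * n \<notin> X}. ?g Z) = (\<Sum>X\<in>{X \<in> core_hooks n. 2 * n \<notin> X}. ?h X)"
    unfolding sum.reindex[OF inj] by (rule sum.cong) (simp_all add: h)
  ultimately show ?thesis by linarith
qed

section \<open>Cells as labels of hook lengths\<close>

text \<open>Subtracting \<open>w - 1\<close> or \<open>w + 1\<close> from \<open>m * w + c\<close> moves one row down and one column to the right or left, so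
sets of labels closed under both are pyramidal sets of cells as long as no multiple of \<open>w\<close> interferes.\<close>

definition label_sets :: "nat \<Rightarrow> nat \<Rightarrow> nat set set" where
  "label_sets w t = {Z. finite Z \<and> (\<forall>y\<in>Z. y mod w \<noteq> 0 \<and> (w \<le> y \<longrightarrow> y - (w - 1) \<in> Z \<and> y - (w + 1) \<in> Z) \<and>
    (y < w \<longrightarrow> y + 2 \<le> t \<and> Suc y \<notin> Z))}"

lemma label_sets_D:
  assumes "Z \<in> label_sets w t"
  shows "finite Z" "y \<in> Z \<Longrightarrow> y mod w \<noteq> 0" "y \<in> Z \<Longrightarrow> w \<le> y \<Longrightarrow> y - (w - 1) \<in> Z" "y \<in> Z \<Longrightarrow> w \<le> y \<Longrightarrow> y - (w + 1) \<in> Z"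
    "y \<in> Z \<Longrightarrow> y < w \<Longrightarrow> y + 2 \<le> t" "y \<in> Z \<Longrightarrow> y < w \<Longrightarrow> Suc y \<notin> Z"
  using assms unfolding label_sets_def by auto

lemma label_sets_no_consec:
  assumes Z: "Z \<in> label_sets w t" and w: "2 \<le> w"
  shows "y \<in> Z \<Longrightarrow> Suc y \<notin> Z"
proof (induction y rule: less_induct)
  case (less y)
  show ?case
  proof (cases "y < w")
    case False
    have "Suc y - (w - 1) = Suc (y - (w - 1))" using False by simp
    then show ?thesis
      using less.IH[of "y - (w - 1)"] label_sets_D(3)[OF Z less.prems] label_sets_D(3)[OF Z, of "Suc y"] False w by auto
  qed (use label_sets_D(6)[OF Z less.prems] in simp)
qed

definition label :: "nat \<Rightarrow> cell \<Rightarrow> nat" where "label w = (\<lambda>(m, c). m * w + c)"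

lemma label_inj: "c < w \<Longrightarrow> c' < w \<Longrightarrow> m * w + c = m' * w + c' \<longleftrightarrow> m = m' \<and> c = c'" for c w :: nat
proof
  assume a: "c < w" "c' < w" "m * w + c = m' * w + c'"
  have "(m * w + c) div w = m" using a(1) by simp
  moreover have "(m' * w + c') div w = m'" using a(2) by simp
  ultimately have "m = m'" using a(3) by simp
  then show "m = m' \<and> c = c'" using a(3) by simp
qed simp

lemma label_mem:
  assumes "A \<in> cell_sets t" "t \<le> w + 1" "c < w"
  shows "m * w + c \<in> label w ` A \<longleftrightarrow> (m, c) \<in> A"
proof
  assume "m * w + c \<in> label w ` A"
  then obtain m' c' where mc: "(m', c') \<in> A" "m * w + c = m' * w + c'" by (auto simp: label_def)
  have "c' < w" using cell_sets_bounds[OF assms(1) mc(1)] assms(2) by simp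
  then show "(m, c) \<in> A" using mc label_inj[OF assms(3)] by metis
qed (force simp: label_def)

lemma bij_label:
  assumes w: "2 \<le> w" and t: "t \<le> w + 1"
  shows "bij_betw ((`) (label w)) (cell_sets t) (label_sets w t)"
proof (rule bij_betw_byWitness[where f' = "\<lambda>Z. {(m, c). c < w \<and> m * w + c \<in> Z}"])
  have b: "1 \<le> c" "c < w" if "A \<in> cell_sets t" "(m, c) \<in> A" for A m c
    using cell_sets_bounds[OF that] t by auto
  show "\<forall>A\<in>cell_sets t. {(m, c). c < w \<and> m * w + c \<in> label w ` A} = A"
    using label_mem[OF _ t] b by auto
  show "\<forall>Z\<in>label_sets w t. label w ` {(m, c). c < w \<and> m * w + c \<in> Z} = Z"
  proof (intro ballI equalityI subsetI)
    fix Z :: "nat set" and y assume "y \<in> Z"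
    then have "(y div w, y mod w) \<in> {(m, c). c < w \<and> m * w + c \<in> Z}" using w by simp
    then show "y \<in> label w ` {(m, c). c < w \<and> m * w + c \<in> Z}"
      by (rule rev_image_eqI) (simp add: label_def)
  qed (auto simp: label_def)
  show "(`) (label w) ` cell_sets t \<subseteq> label_sets w t"
  proof (intro image_subsetI)
    fix A assume A: "A \<in> cell_sets t"
    have cl: "supported A" using A unfolding cell_sets_def by auto
    show "label w ` A \<in> label_sets w t"
      unfolding label_sets_def mem_Collect_eq
    proof (intro conjI ballI impI)
      show "finite (label w ` A)" using finite_cell_sets(2)[OF A] by simp
      fix y assume "y \<in> label w ` A"
      then obtain m c where mc: "(m, c) \<in> A" "y = m * w + c" by (auto simp: label_def)
      note bb = b[OF A mc(1)]
      show "y mod w \<noteq> 0" using mc(2) bb by simp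
      { assume "w \<le> y"
        then obtain k where k: "m = Suc k" using mc(2) bb by (cases m) auto
        note d = closedD[OF cl mc(1)[unfolded k]]
        have e: "y - (w - 1) = k * w + (c + 1)" "y - (w + 1) = k * w + (c - 1)"
          using mc(2) k bb w by auto
        show "y - (w - 1) \<in> label w ` A" "y - (w + 1) \<in> label w ` A"
          unfolding e using imageI[OF d(3), of "label w"] imageI[OF d(2), of "label w"] by (simp_all add: label_def) }
      { assume "y < w"
        then have m: "m = 0" using mc(2) by (cases m) auto
        have r: "c + 2 \<le> t" "(0, c + 1) \<notin> A" using A mc(1) unfolding m cell_sets_def by auto
        show "y + 2 \<le> t" using r(1) mc(2) m by simp
        show "Suc y \<notin> label w ` A"
        proof (cases "c + 1 < w")
          case True
          then show ?thesis using label_mem[OF A t True, of 0] r(2) mc(2) m by simp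
        next
          case False
          show ?thesis
          proof
            assume "Suc y \<in> label w ` A"
            then obtain m' c' where mc': "(m', c') \<in> A" "Suc y = m' * w + c'" by (auto simp: label_def)
            have "Suc y = 1 * w + 0" using False bb mc(2) m by simp
            then show False using label_inj[of 0 w c' 1 m'] b[OF A mc'(1)] mc'(2) by auto
          qed
        qed }
    qed
  qed
  show "(\<lambda>Z. {(m, c). c < w \<and> m * w + c \<in> Z}) ` label_sets w t \<subseteq> cell_sets t"
  proof (intro image_subsetI)
    fix Z assume Z: "Z \<in> label_sets w t"
    note d = label_sets_D[OF Z]
    let ?A = "{(m, c). c < w \<and> m * w + c \<in> Z}"
    have "supported ?A" unfolding supported_def
    proof (intro allI impI)
      fix m c assume "(Suc m, c) \<in> ?A"
      then have mc: "c < w" "Suc m * w + c \<in> Z" by auto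
      have c: "1 \<le> c" using d(2)[OF mc(2)] mc(1) by (cases c) auto
      have e: "Suc m * w + c - (w - 1) = m * w + (c + 1)" "Suc m * w + c - (w + 1) = m * w + (c - 1)" using w c by auto
      have 1: "m * w + (c + 1) \<in> Z" using d(3)[OF mc(2)] unfolding e by simp
      moreover have 2: "m * w + (c - 1) \<in> Z" using d(4)[OF mc(2)] unfolding e by simp
      moreover have "c + 1 < w"
      proof (rule ccontr)
        assume "\<not> c + 1 < w"
        then have "m * w + (c + 1) = Suc m * w" using mc(1) by simp
        then show False using d(2)[OF 1] by (metis mod_mult_self2_is_0)
      qed
      ultimately show "1 \<le> c \<and> (m, c - 1) \<in> ?A \<and> (m, c + 1) \<in> ?A" using c by auto
    qed
    moreover have "1 \<le> c \<and> c + 2 \<le> t \<and> (0, c + 1) \<notin> ?A" if "(0, c) \<in> ?A" for c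
      using that d(2)[of c] d(5)[of c] d(6)[of c] by (cases c) auto
    ultimately show "?A \<in> cell_sets t" unfolding cell_sets_def by auto
  qed
qed

text \<open>Subtracting both \<open>s\<close> and \<open>t\<close> subtracts \<open>2 * w\<close>, so a multiple of \<open>w\<close> would descend to \<open>w\<close> or to zero.\<close>

lemma core_hooks_multiples:
  assumes X: "X \<in> core_hooks n" and "2 * n + 2 \<notin> X"
  shows "m * (2 * n + 2) \<notin> X"
proof (induction m rule: less_induct)
  case (less m)
  consider "m = 0" | "m = 1" | k where "m = k + 2" by (metis add_2_eq_Suc' not0_implies_Suc One_nat_def)
  then show ?case
  proof cases
    case 3
    show ?thesis
    proof
      assume "m * (2 * n + 2) \<in> X"
      from core_hooks_sub[OF X this, of 1 1] 3 have "k * (2 * n + 2) \<in> X" by (simp add: algebra_simps)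
      then show False using less[of k] 3 by simp
    qed
  qed (use core_hooks_D(2)[OF X] assms(2) in auto)
qed

lemma core_hooks_eq_label_sets:
  assumes n: "1 \<le> n" and w: "w = 2 * n + 2"
  shows "{X \<in> core_hooks n. w \<notin> X} = label_sets w w"
proof (intro equalityI subsetI)
  fix X assume "X \<in> {X \<in> core_hooks n. w \<notin> X}"
  then have X: "X \<in> core_hooks n" "w \<notin> X" by auto
  note d = core_hooks_D[OF X(1)]
  show "X \<in> label_sets w w" unfolding label_sets_def mem_Collect_eq
  proof (intro conjI ballI impI)
    fix y assume y: "y \<in> X"
    show m: "y mod w \<noteq> 0"
      using core_hooks_multiples[OF X(1), of "y div w"] X(2) y w by (metis div_mult_mod_eq add_0_right)
    { assume "w \<le> y"
      then have "2 * n + 3 \<le> y" using m w by (cases "y = w") auto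
      then show "y - (w - 1) \<in> X" "y - (w + 1) \<in> X" using d(3,4)[OF y] w by (simp_all add: numeral_3_eq_3) }
    assume "y < w"
    moreover have "y \<noteq> 2 * n + 1" using d(3)[OF y] d(2) by auto
    ultimately show "y + 2 \<le> w" "Suc y \<notin> X" using d(5)[OF y] w by auto
  qed (rule d(1))
next
  fix Z assume Z: "Z \<in> label_sets w w"
  note d = label_sets_D[OF Z]
  have "Z \<in> core_hooks n"
  proof (rule core_hooks_I)
    fix x assume x: "x \<in> Z"
    { assume "2 * n + 1 \<le> x"
      then have "w \<le> x" using d(5)[OF x] w by (cases "x < w") auto
      then show "x - (2 * n + 1) \<in> Z" using d(3)[OF x] w by simp }
    { assume "2 * n + 3 \<le> x"
      then show "x - (2 * n + 3) \<in> Z" using d(4)[OF x] w by (simp add: numeral_3_eq_3) }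
    show "Suc x \<notin> Z" by (rule label_sets_no_consec[OF Z _ x]) (use w in simp)
  qed (use d(1) d(2)[of 0] in auto)
  then show "Z \<in> {X \<in> core_hooks n. w \<notin> X}" using d(2)[of w] by auto
qed

lemma Phi_core_hooks_eq_label_sets:
  assumes n: "1 \<le> n" and w: "w = 2 * n + 2"
  shows "Phi ` {X \<in> core_hooks n. 2 * n \<notin> X} = {Z \<in> label_sets w (w + 1). 1 \<in> Z}"
proof (intro equalityI subsetI)
  fix Z assume "Z \<in> Phi ` {X \<in> core_hooks n. 2 * n \<notin> X}"
  then obtain X where X: "X \<in> core_hooks n" "2 * n \<notin> X" and Z: "Z = Phi X" by auto
  note d = core_hooks_D[OF X(1)]
  have s: "2 * n + 1 \<notin> X" using d(3)[of "2 * n + 1"] d(2) by auto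
  have mult: "m * w \<notin> Z" for m
  proof -
    consider "m = 0" | "m = 1" | "m = 2" | k where "m = k + 3" by (metis One_nat_def add_2_eq_Suc' numeral_3_eq_3 numeral_2_eq_2 add_Suc_right add_0_right not0_implies_Suc)
    then show ?thesis
    proof cases
      case 3
      have "4 * n + 2 \<notin> X"
        using core_hooks_sub[OF X(1), of "4 * n + 2" 2 0] d(2) by auto
      then show ?thesis unfolding Z Phi_mem 3 w by auto
    next
      case 4
      show ?thesis
      proof
        assume "m * w \<in> Z"
        moreover have "m * w \<noteq> 1" using w nat_mult_eq_1_iff[of m w] by linarith
        ultimately have "m * w - 2 \<in> X" unfolding Z Phi_mem by blast
        moreover have "m * w - 2 = (k + 1) * w - 2 + (1 * (2 * n + 1) + 1 * (2 * n + 3))"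
          unfolding 4 w by (simp add: algebra_simps)
        ultimately have *: "(k + 1) * w - 2 \<in> X" using core_hooks_sub[OF X(1), of "m * w - 2" 1 1] by simp
        have "(j + 1) * w - 2 \<notin> X" for j
        proof (induction j rule: less_induct)
          case (less j)
          consider "j = 0" | "j = 1" | i where "j = i + 2" by (metis add_2_eq_Suc' not0_implies_Suc One_nat_def)
          then show ?case
          proof cases
            case 1
            then show ?thesis using X(2) w by simp
          next
            case 2
            then show ?thesis using core_hooks_sub[OF X(1), of "4 * n + 2" 2 0] d(2) w by auto
          next
            case 3
            have "(j + 1) * w - 2 = (i + 1) * w - 2 + (1 * (2 * n + 1) + 1 * (2 * n + 3))"
              unfolding 3 w by (simp add: algebra_simps)
            then have "(i + 1) * w - 2 \<in> X" if "(j + 1) * w - 2 \<in> X"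
              using core_hooks_sub[OF X(1) that, of 1 1] by simp
            moreover have "(i + 1) * w - 2 \<notin> X" using less[of i] 3 by simp
            ultimately show ?thesis by blast
          qed
        qed
        then show False using * by blast
      qed
    qed (use X(2) in \<open>auto simp: Z Phi_mem w\<close>)
  qed
  have "Z \<in> label_sets w (w + 1)" unfolding label_sets_def mem_Collect_eq
  proof (intro conjI ballI impI)
    show "finite Z" unfolding Z Phi_def using d(1) by simp
    fix y assume y: "y \<in> Z"
    show m: "y mod w \<noteq> 0"
      using mult[of "y div w"] y by (metis div_mult_mod_eq add_0_right)
    have y1: "y = 1 \<or> 2 \<le> y \<and> y - 2 \<in> X" using y unfolding Z Phi_mem .
    { assume "w \<le> y"
      then have y2: "2 * n + 3 \<le> y" using m w by (cases "y = w") auto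
      then have x: "y - 2 \<in> X" using y1 by auto
      have "y - 2 - (2 * n + 1) \<in> X" using d(3)[OF x] y2 by simp
      moreover have "y - 2 - (2 * n + 1) = y - (w - 1) - 2" using w by simp
      ultimately show "y - (w - 1) \<in> Z" unfolding Z Phi_mem using y2 w by auto
      have "y \<noteq> 2 * n + 3" using x s by auto
      then consider "y = 2 * n + 4" | "2 * n + 5 \<le> y" using y2 by linarith
      then show "y - (w + 1) \<in> Z"
      proof cases
        case 2
        then have "y - 2 - (2 * n + 3) \<in> X" using d(4)[OF x] by simp
        moreover have "y - 2 - (2 * n + 3) = y - (w + 1) - 2" using w by simp
        ultimately show ?thesis unfolding Z Phi_mem using 2 w by auto
      qed (simp add: Z Phi_mem w) }
    assume "y < w"
    then show "y + 2 \<le> w + 1" by simp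
    show "Suc y \<notin> Z"
    proof (cases "y = 1")
      case True
      then show ?thesis using d(2) by (simp add: Z Phi_mem)
    next
      case False
      then have "2 \<le> y" "y - 2 \<in> X" using y1 by auto
      then have e: "Suc y - 2 = Suc (y - 2)" "y - 2 \<in> X" "Suc y \<noteq> 1" by auto
      show ?thesis unfolding Z Phi_mem e(1) using d(5)[OF e(2)] e(3) by blast
    qed
  qed
  then show "Z \<in> {Z \<in> label_sets w (w + 1). 1 \<in> Z}" by (simp add: Z Phi_mem)
next
  fix Z assume "Z \<in> {Z \<in> label_sets w (w + 1). 1 \<in> Z}"
  then have Z: "Z \<in> label_sets w (w + 1)" and one: "1 \<in> Z" by auto
  note d = label_sets_D[OF Z]
  have nc: "Suc y \<notin> Z" if "y \<in> Z" for y by (rule label_sets_no_consec[OF Z _ that]) (use w in simp)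
  have "unPhi Z \<in> core_hooks n"
  proof (rule unPhi_core_hooks[OF n d(1) one _ nc])
    show "2 \<notin> Z" using nc[OF one] by (simp add: numeral_2_eq_2)
    show "y - (2 * n + 1) \<in> Z" if "y \<in> Z" "2 * n + 3 \<le> y" for y using d(3)[OF that(1)] that(2) w by simp
    show "y - (2 * n + 3) \<in> Z" if "y \<in> Z" "2 * n + 5 \<le> y" for y using d(4)[OF that(1)] that(2) w by (simp add: numeral_3_eq_3)
  qed
  moreover have "2 * n \<notin> unPhi Z" using d(2)[of w] w by (auto simp: unPhi_def)
  moreover have "Phi (unPhi Z) = Z" using Phi_unPhi[OF one] d(2)[of 0] by auto
  ultimately show "Z \<in> Phi ` {X \<in> core_hooks n. 2 * n \<notin> X}" by (metis (mono_tags, lifting) image_eqI mem_Collect_eq)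
qed

section \<open>Sizes as statistics of cell sets\<close>

text \<open>Under the reflection of the columns \<open>q_stat\<close> is invariant and \<open>l_stat\<close> changes its sign; their sum is the
drift of the set of labels.\<close>

definition q_stat :: "stat \<Rightarrow> real" where "q_stat s = cl s * ce s - cm s * cm s"
definition l_stat :: "stat \<Rightarrow> real" where "l_stat s = cn s - 1 / 2 * (cl s * cm s)"

lemma label_stats:
  assumes A: "A \<in> cell_sets t" and t: "t \<le> w + 1"
  shows "card (label w ` A) = card A" "drift (label w ` A) = q_stat (cell_stat w A) + l_stat (cell_stat w A)"
proof -
  have f: "finite A" by (rule finite_cell_sets(2)[OF A])
  have i: "inj_on (label w) A"
  proof (rule inj_onI, clarify)
    fix m c m' c' assume a: "(m, c) \<in> A" "(m', c') \<in> A" "label w (m, c) = label w (m', c')"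
    then have "c < w" "c' < w" using cell_sets_bounds[OF A] t by fastforce+
    then show "m = m' \<and> c = c'" using a(3) label_inj[of c w c' m m'] by (simp add: label_def)
  qed
  show c: "card (label w ` A) = card A" by (rule card_image[OF i])
  have "\<Sum>(label w ` A) = (\<Sum>(m, c)\<in>A. m * w + c)"
    using sum.reindex[OF i, of id] by (simp add: label_def case_prod_unfold)
  then have "real (\<Sum>(label w ` A)) = (\<Sum>(m, c)\<in>A. real w * (real m + 1 / 2) + real c - real w / 2)"
    by (simp add: case_prod_unfold algebra_simps)
  also have "\<dots> = real w * (\<Sum>(m, c)\<in>A. real m + 1 / 2) + (\<Sum>(m, c)\<in>A. real c) - real w / 2 * real (card A)"
  proof -
    have "(\<Sum>(m, c)\<in>A. real w * (real m + 1 / 2)) = real w * (\<Sum>(m, c)\<in>A. real m + 1 / 2)"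
      unfolding case_prod_unfold by (rule sum_distrib_left[symmetric])
    moreover have "(\<Sum>(m, c)\<in>A. real w * (real m + 1 / 2) + real c - real w / 2) =
        (\<Sum>(m, c)\<in>A. real w * (real m + 1 / 2)) + (\<Sum>(m, c)\<in>A. real c) - real (card A) * (real w / 2)"
      by (simp only: case_prod_unfold sum_subtractf sum.distrib sum_constant)
    ultimately show ?thesis by simp
  qed
  finally show "drift (label w ` A) = q_stat (cell_stat w A) + l_stat (cell_stat w A)"
    unfolding drift_def c q_stat_def l_stat_def cell_stat_def by (simp add: power2_eq_square)
qed

definition mirror :: "nat \<Rightarrow> cell set \<Rightarrow> cell set" where
  "mirror w A = {(m, c). c \<le> w \<and> (m, w - c) \<in> A}"

lemma mirror_cell_sets:
  assumes A: "A \<in> cell_sets (w + 1)"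
  shows "mirror w A \<in> cell_sets (w + 1)" "mirror w (mirror w A) = A" "(0, 1) \<in> mirror w A \<longleftrightarrow> (0, w - 1) \<in> A"
proof -
  note b = cell_sets_bounds[OF A]
  have cl: "supported A" using A unfolding cell_sets_def by auto
  have "supported (mirror w A)" unfolding supported_def
  proof (intro allI impI)
    fix m c assume "(Suc m, c) \<in> mirror w A"
    then have 1: "c \<le> w" "(Suc m, w - c) \<in> A" by (auto simp: mirror_def)
    note d = closedD[OF cl 1(2)]
    have "w - c - 1 = w - (c + 1)" "w - c + 1 = w - (c - 1)" "1 \<le> c" "c + 1 \<le> w" using b[OF 1(2)] 1(1) by auto
    then show "1 \<le> c \<and> (m, c - 1) \<in> mirror w A \<and> (m, c + 1) \<in> mirror w A" using d by (simp add: mirror_def)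
  qed
  moreover have "1 \<le> c \<and> c + 2 \<le> w + 1 \<and> (0, c + 1) \<notin> mirror w A" if c: "(0, c) \<in> mirror w A" for c
  proof -
    have 1: "c \<le> w" "(0, w - c) \<in> A" using c by (auto simp: mirror_def)
    have "(0, w - (c + 1)) \<notin> A" if "c + 1 \<le> w"
    proof
      assume "(0, w - (c + 1)) \<in> A"
      then have "(0, w - (c + 1) + 1) \<notin> A" using A unfolding cell_sets_def by blast
      moreover have "w - (c + 1) + 1 = w - c" using that by simp
      ultimately show False using 1(2) by simp
    qed
    then show ?thesis using b[OF 1(2)] 1(1) by (auto simp: mirror_def)
  qed
  ultimately show "mirror w A \<in> cell_sets (w + 1)" unfolding cell_sets_def by blast
  show "mirror w (mirror w A) = A" using b by (fastforce simp: mirror_def)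
  show "(0, 1) \<in> mirror w A \<longleftrightarrow> (0, w - 1) \<in> A" using b[of 0 "w - 1"] by (auto simp: mirror_def)
qed

lemma mirror_stats:
  assumes A: "A \<in> cell_sets (w + 1)"
  shows "cm (cell_stat w (mirror w A)) = cm (cell_stat w A)" "q_stat (cell_stat w (mirror w A)) = q_stat (cell_stat w A)" "l_stat (cell_stat w (mirror w A)) = - l_stat (cell_stat w A)"
proof -
  note b = cell_sets_bounds[OF A]
  have le: "c \<le> w" if "(m, c) \<in> A" for m c using b[OF that] by simp
  have e: "mirror w A = (\<lambda>(m, c). (m, w - c)) ` A"
    unfolding mirror_def using le by force
  have i: "inj_on (\<lambda>(m, c). (m, w - c)) A"
  proof (rule inj_onI)
    fix x y assume a: "x \<in> A" "y \<in> A" "(\<lambda>(m, c). (m, w - c)) x = (\<lambda>(m, c). (m, w - c)) y"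
    obtain m c m' c' where xy: "x = (m, c)" "y = (m', c')" by (cases x; cases y)
    show "x = y" using a le[of m c] le[of m' c'] unfolding xy by auto
  qed
  have c: "card (mirror w A) = card A" unfolding e by (rule card_image[OF i])
  have s: "(\<Sum>x\<in>mirror w A. h x) = (\<Sum>(m, c)\<in>A. h (m, w - c))" for h :: "cell \<Rightarrow> real"
    unfolding e sum.reindex[OF i] by (simp add: case_prod_unfold)
  have n: "(\<Sum>(m, c)\<in>A. real (w - c)) = real w * real (card A) - (\<Sum>(m, c)\<in>A. real c)"
  proof -
    have "(\<Sum>(m, c)\<in>A. real (w - c)) = (\<Sum>(m, c)\<in>A. real w - real c)"
      by (rule sum.cong) (use le in \<open>auto simp: of_nat_diff\<close>)
    then show ?thesis by (simp add: case_prod_unfold sum_subtractf)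
  qed
  show "cm (cell_stat w (mirror w A)) = cm (cell_stat w A)" "q_stat (cell_stat w (mirror w A)) = q_stat (cell_stat w A)"
    unfolding q_stat_def cell_stat_def c s by (simp_all add: case_prod_unfold)
  show "l_stat (cell_stat w (mirror w A)) = - l_stat (cell_stat w A)"
    using n unfolding l_stat_def cell_stat_def c s by (simp add: case_prod_unfold algebra_simps)
qed

text \<open>Row \<open>j\<close> lists the coefficients of \<open>x, x ^ 3, \<dots>\<close> in the polynomial that sums the \<open>j\<close>-th powers of the
triangular numbers below \<open>x\<close>. Only odd exponents occur because triangular numbers are symmetric under
\<open>i \<mapsto> - 1 - i\<close>.\<close>

definition tcoeff :: "real list list" where
  "tcoeff = [[1], [-1/6, 1/6], [1/30, -1/12, 1/20], [-1/105, 1/24, -1/20, 1/56],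
    [1/210, -1/36, 11/240, -5/168, 1/144], [-1/231, 1/36, -5/96, 29/672, -5/288, 1/352]]"

definition tri_power_sum :: "nat \<Rightarrow> real \<Rightarrow> real" where
  "tri_power_sum j x = (\<Sum>i\<le>j. tcoeff ! j ! i * x ^ (2 * i + 1))"

lemma tri_power_sum_odd: "tri_power_sum j (- x) = - tri_power_sum j x" unfolding tri_power_sum_def by (simp add: sum_negf)

lemma tri_power_sum_step:
  assumes "j \<le> 5"
  shows "tri_power_sum j (x + 1) = tri_power_sum j x + (x * (x + 1) / 2) ^ j"
proof -
  consider "j = 0" | "j = 1" | "j = 2" | "j = 3" | "j = 4" | "j = 5" using assms by linarith
  then show ?thesis
    by cases (simp_all add: tri_power_sum_def tcoeff_def atMost_Suc eval_nat_numeral field_simps)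
qed

lemma sum_tri_power:
  assumes "j \<le> 5"
  shows "(\<Sum>i<m. tri i ^ j) = tri_power_sum j (real m)"
proof (induction m)
  case 0
  show ?case by (simp add: tri_power_sum_def)
next
  case (Suc m)
  then show ?case using tri_power_sum_step[OF assms, of "real m"] by (simp add: tri_def add.commute)
qed

definition tri_sum_pol :: "nat \<Rightarrow> real \<Rightarrow> real \<Rightarrow> real" where
  "tri_sum_pol k J m = (\<Sum>j\<le>k. real (k choose j) * tri_power_sum j m * J ^ (k - j))"

lemma tri_sum_tri_sum_pol: "k \<le> 5 \<Longrightarrow> tri_sum k J M = tri_sum_pol k J (real M)"
proof -
  assume k: "k \<le> 5"
  have "tri_sum k J M = (\<Sum>i<M. \<Sum>j\<le>k. real (k choose j) * tri i ^ j * J ^ (k - j))"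
    unfolding tri_sum_def by (simp add: add.commute[of J] binomial_ring)
  also have "\<dots> = (\<Sum>j\<le>k. \<Sum>i<M. real (k choose j) * tri i ^ j * J ^ (k - j))" by (rule sum.swap)
  also have "\<dots> = tri_sum_pol k J (real M)"
    unfolding tri_sum_pol_def using k
    by (intro sum.cong refl) (simp add: sum_tri_power[symmetric] sum_distrib_left sum_distrib_right mult_ac)
  finally show ?thesis .
qed

lemma tri_sum_pol_odd: "tri_sum_pol k J (- m) = - tri_sum_pol k J m"
  unfolding tri_sum_pol_def tri_power_sum_odd by (simp add: sum_negf)

definition size_stat :: "nat \<Rightarrow> stat \<Rightarrow> real" where
  "size_stat k s = (tri_sum_pol k (q_stat s + l_stat s) (cm s) + tri_sum_pol k (q_stat s - l_stat s) (cm s)) / 2"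

lemma size_stat_sgn_flip: "size_stat k (sgn_flip s) = - size_stat k s"
  unfolding size_stat_def q_stat_def l_stat_def map_coords by (simp add: tri_sum_pol_odd algebra_simps)

lemma size_stat_stat0: "size_stat k stat0 = 0"
  unfolding size_stat_def q_stat_def l_stat_def by (simp add: tri_sum_pol_def tri_power_sum_def)

lemma weighted_tri_sum_pol:
  assumes J: "weighted 6 J"
  shows "weighted (6 * k + 3) (\<lambda>s. tri_sum_pol k (J s) (cm s))"
proof -
  have t: "weighted (6 * j + 3) (\<lambda>s. tri_power_sum j (cm s))" for j
    unfolding tri_power_sum_def
  proof (rule weighted_sum)
    fix i assume "i \<in> {..j}"
    then show "weighted (6 * j + 3) (\<lambda>s. tcoeff ! j ! i * cm s ^ (2 * i + 1))"
      using weighted_mono[OF weighted_cmult[OF weighted_power[OF weighted_coords(2), of "2 * i + 1"]], of "6 * j + 3"] by simp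
  qed
  show ?thesis unfolding tri_sum_pol_def
  proof (rule weighted_sum)
    fix j assume "j \<in> {..k}"
    then show "weighted (6 * k + 3) (\<lambda>s. real (k choose j) * tri_power_sum j (cm s) * J s ^ (k - j))"
      using weighted_mono[OF weighted_mult[OF weighted_cmult[OF t[of j], of "real (k choose j)"] weighted_power[OF J, of "k - j"]], of "6 * k + 3"] by (simp add: algebra_simps)
  qed
qed

lemma weighted_size_stat: "weighted (6 * k + 3) (size_stat k)"
proof -
  have q: "weighted 6 q_stat"
  proof -
    have "weighted 6 (\<lambda>s. cl s * ce s - cm s * cm s)"
      using weighted_diff[OF weighted_mult[OF weighted_coords(1,4)], of "\<lambda>s. cm s * cm s"] weighted_mult[OF weighted_coords(2,2)] by simp
    then show ?thesis unfolding q_stat_def[abs_def] .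
  qed
  have "weighted 5 l_stat"
  proof -
    have "weighted 5 (\<lambda>s. cn s - 1 / 2 * (cl s * cm s))"
      using weighted_diff[OF weighted_coords(3) weighted_cmult, of "\<lambda>s. cl s * cm s" "1 / 2"] weighted_mult[OF weighted_coords(1,2)] by simp
    then show ?thesis unfolding l_stat_def[abs_def] .
  qed
  then have l: "weighted 6 l_stat" by (rule weighted_mono) simp
  have "weighted (6 * k + 3) (\<lambda>s. 1 / 2 * (tri_sum_pol k (q_stat s + l_stat s) (cm s) + tri_sum_pol k (q_stat s - l_stat s) (cm s)))"
    by (intro weighted_cmult weighted_add weighted_tri_sum_pol weighted_diff q l)
  then show ?thesis unfolding size_stat_def[abs_def] by simp
qed

lemma sum_half: "(\<Sum>A\<in>S. (a A + b A) / 2) = ((\<Sum>A\<in>S. a A) + (\<Sum>A\<in>S. b A)) / (2 :: real)"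
  by (simp add: sum_divide_distrib[symmetric] sum.distrib)

text \<open>Of the two families of label sets that survive the telescoping, the subtracted one consists of the
cell sets without a cell in column \<open>w - 1\<close>, and reflection turns these into the ones without a cell in column 1.
Averaging with the reflected sums replaces the drift by its even part in \<open>l_stat\<close>.\<close>

theorem sum_core_hooks:
  assumes n: "1 \<le> n" and k: "k \<le> 5"
  shows "(\<Sum>X\<in>core_hooks n. (drift X + tri (card X)) ^ k) = signed_sum (size_stat k) n"
proof -
  define w where "w = 2 * n + 2"
  have w: "2 \<le> w" unfolding w_def by simp
  let ?I = "cell_sets (w + 1)"
  let ?P = "\<lambda>A. tri_sum_pol k (q_stat (cell_stat w A) + l_stat (cell_stat w A)) (cm (cell_stat w A))"
  let ?M = "\<lambda>A. tri_sum_pol k (q_stat (cell_stat w A) - l_stat (cell_stat w A)) (cm (cell_stat w A))"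
  have g: "tri_sum k (drift (label w ` A)) (card (label w ` A)) = ?P A" if "A \<in> cell_sets t" "t \<le> w + 1" for A t
    using label_stats[OF that] tri_sum_tri_sum_pol[OF k] by (simp add: cell_stat_def)
  have i1: "inj_on ((`) (label w)) ?I" using bij_label[OF w, of "w + 1"] bij_betw_def by blast
  have fin: "finite ?I" by (rule finite_cell_sets)
  have one: "{Z \<in> label_sets w (w + 1). 1 \<in> Z} = (`) (label w) ` {A \<in> ?I. (0, 1) \<in> A}"
  proof -
    have "1 \<in> label w ` A \<longleftrightarrow> (0, 1) \<in> A" if "A \<in> ?I" for A
      using label_mem[OF that, of w 1 0] w by simp
    moreover have "label_sets w (w + 1) = (`) (label w) ` ?I" using bij_label[OF w, of "w + 1"] by (simp add: bij_betw_def)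
    ultimately show ?thesis by auto
  qed
  have a: "(\<Sum>Z\<in>Phi ` {X \<in> core_hooks n. 2 * n \<notin> X}. tri_sum k (drift Z) (card Z)) = (\<Sum>A\<in>{A \<in> ?I. (0, 1) \<in> A}. ?P A)"
    unfolding Phi_core_hooks_eq_label_sets[OF n w_def] one
    by (subst sum.reindex[OF inj_on_subset[OF i1]]) (auto intro!: sum.cong simp: g)
  have Iw: "cell_sets w = {A \<in> ?I. (0, w - 1) \<notin> A}"
  proof (intro equalityI subsetI)
    fix A assume "A \<in> cell_sets w"
    then show "A \<in> {A \<in> ?I. (0, w - 1) \<notin> A}" using w unfolding cell_sets_def by fastforce
  next
    fix A assume A: "A \<in> {A \<in> ?I. (0, w - 1) \<notin> A}"
    have "c + 2 \<le> w" if c: "(0, c) \<in> A" for c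
    proof -
      have "c + 2 \<le> w + 1" using c A unfolding cell_sets_def by blast
      moreover have "c \<noteq> w - 1" using c A by auto
      ultimately show ?thesis by simp
    qed
    then show "A \<in> cell_sets w" using A unfolding cell_sets_def by blast
  qed
  have rv: "bij_betw (mirror w) {A \<in> ?I. Q (mirror w A)} {A \<in> ?I. Q A}" for Q
    by (rule bij_betw_byWitness[where f' = "mirror w"]) (auto simp: mirror_cell_sets[simplified])
  have rs: "(\<Sum>A\<in>{A \<in> ?I. Q (mirror w A)}. ?P A) = (\<Sum>A\<in>{A \<in> ?I. Q A}. ?M A)" for Q
  proof -
    have "(\<Sum>A\<in>{A \<in> ?I. Q A}. ?M A) = (\<Sum>A\<in>{A \<in> ?I. Q (mirror w A)}. ?M (mirror w A))"
      by (rule sum.reindex_bij_betw[OF rv, symmetric])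
    also have "\<dots> = (\<Sum>A\<in>{A \<in> ?I. Q (mirror w A)}. ?P A)"
      by (rule sum.cong) (simp_all add: mirror_stats)
    finally show ?thesis by simp
  qed
  have "(\<Sum>X\<in>{X \<in> core_hooks n. w \<notin> X}. tri_sum k (drift X) (card X)) = (\<Sum>A\<in>cell_sets w. ?P A)"
  proof -
    have "label_sets w w = (`) (label w) ` cell_sets w" "inj_on ((`) (label w)) (cell_sets w)" using bij_label[OF w, of w] by (simp_all add: bij_betw_def)
    then show ?thesis unfolding core_hooks_eq_label_sets[OF n w_def]
      by (simp add: sum.reindex) (rule sum.cong, simp_all add: g)
  qed
  also have "cell_sets w = {A \<in> ?I. (0, 1) \<notin> mirror w A}" unfolding Iw using mirror_cell_sets(3) by blast
  also have "(\<Sum>A\<in>\<dots>. ?P A) = (\<Sum>A\<in>{A \<in> ?I. (0, 1) \<notin> A}. ?M A)" by (rule rs)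
  finally have d: "(\<Sum>X\<in>{X \<in> core_hooks n. w \<notin> X}. tri_sum k (drift X) (card X)) = (\<Sum>A\<in>{A \<in> ?I. (0, 1) \<notin> A}. ?M A)" .
  \<comment> \<open>The reflection permutes the whole family, so over it both versions of the summand have the same sum.\<close>
  have all: "(\<Sum>A\<in>{A \<in> ?I. (0, 1) \<in> A}. ?P A) + (\<Sum>A\<in>{A \<in> ?I. (0, 1) \<notin> A}. ?P A) =
      (\<Sum>A\<in>{A \<in> ?I. (0, 1) \<in> A}. ?M A) + (\<Sum>A\<in>{A \<in> ?I. (0, 1) \<notin> A}. ?M A)"
    using rs[of "\<lambda>_. True"] sum_split_mem[OF fin, of ?P "\<lambda>A. (0, 1) \<in> A"] sum_split_mem[OF fin, of ?M "\<lambda>A. (0, 1) \<in> A"] by simp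
  have W: "w + 1 = 2 * n + 3" "w = 2 * Suc n" unfolding w_def by simp_all
  have "signed_sum (size_stat k) n = (\<Sum>A\<in>{A \<in> ?I. (0, 1) \<in> A}. size_stat k (cell_stat w A)) - (\<Sum>A\<in>{A \<in> ?I. (0, 1) \<notin> A}. size_stat k (cell_stat w A))"
    unfolding W(1) unfolding W(2) by (rule sum_cell_sets_signed[symmetric])
  also have "\<dots> = ((\<Sum>A\<in>{A \<in> ?I. (0, 1) \<in> A}. ?P A) + (\<Sum>A\<in>{A \<in> ?I. (0, 1) \<in> A}. ?M A)) / 2 -
      ((\<Sum>A\<in>{A \<in> ?I. (0, 1) \<notin> A}. ?P A) + (\<Sum>A\<in>{A \<in> ?I. (0, 1) \<notin> A}. ?M A)) / 2"
    unfolding size_stat_def sum_half ..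
  finally have "signed_sum (size_stat k) n = (\<Sum>A\<in>{A \<in> ?I. (0, 1) \<in> A}. ?P A) - (\<Sum>A\<in>{A \<in> ?I. (0, 1) \<notin> A}. ?M A)"
    using all by (simp add: field_simps)
  then show ?thesis using telescope[OF n, of k] a d unfolding w_def[symmetric] by linarith
qed

section \<open>Lattice walks\<close>

text \<open>Statistics of lattice walks that spend one column per step; a step between the heights \<open>y - 1\<close> and \<open>y\<close> has
label \<open>y\<close>. The amounts are those for which raising a walk by one is \<open>lift\<close>, so that a hill goes up, follows
the raised walk of the block inside and goes down. The label 0 belongs to level steps at height zero; a dip
is enclosed by two of them.\<close>

definition edge :: "nat \<Rightarrow> stat" where
  "edge y = (1, real y / 2, real y / 4, (real y)\<^sup>2 / 4)"

fun walk_sum :: "nat \<Rightarrow> nat \<Rightarrow> (stat \<Rightarrow> real) \<Rightarrow> real" where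
  "walk_sum 0 g f = (if g = 0 then f stat0 else 0)"
| "walk_sum (Suc m) 0 f = walk_sum m 1 (\<lambda>t. f (cat (edge 1) t)) + walk_sum m 0 (\<lambda>t. f (cat (edge 0) t))"
| "walk_sum (Suc m) (Suc g) f = walk_sum m (Suc (Suc g)) (\<lambda>t. f (cat (edge (Suc (Suc g))) t)) +
    walk_sum m g (\<lambda>t. f (cat (edge (Suc g)) t))"

abbreviation "liftn k \<equiv> lift ^^ k"

lemma lift_cat: "lift (cat a b) = cat (lift a) (lift b)"
  by (cases a; cases b) (simp add: power2_eq_square field_simps)
lemma liftn_cat: "liftn k (cat a b) = cat (liftn k a) (liftn k b)"
  by (induction k) (simp_all add: lift_cat)
lemma lift_edge: "lift (edge y) = edge (Suc y)"
  by (simp add: edge_def power2_eq_square field_simps)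
lemma liftn_edge: "liftn k (edge y) = edge (y + k)"
  by (induction k) (simp_all add: lift_edge)
lemma liftn_stat0: "liftn k stat0 = stat0" by (induction k) simp_all
lemma dip_edges: "dip s = cat (edge 0) (cat s (edge 0))"
  by (cases s) (simp add: edge_def)
lemma hill_edges: "hill s = cat (edge 1) (cat (lift s) (edge 1))"
  unfolding hill_def dip_edges lift_cat lift_edge by simp
lemma liftn_hill: "liftn (Suc g) (hill s) = cat (edge (Suc (Suc g))) (cat (liftn (Suc (Suc g)) s) (edge (Suc (Suc g))))"
  unfolding hill_edges liftn_cat liftn_edge by (simp add: funpow_swap1)

text \<open>A walk from height \<open>g + 1\<close> to zero stays at or above \<open>g + 1\<close> for an excursion, steps down for the first
time and continues from \<open>g\<close>.\<close>

theorem first_passage: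
  "walk_sum m (Suc g) f = (\<Sum>i\<in>{i. 2 * i + 1 \<le> m}. \<Sum>s\<leftarrow>arches i.
    walk_sum (m - (2 * i + 1)) g (\<lambda>t. f (cat (liftn (Suc g) s) (cat (edge (Suc g)) t))))"
proof (induction m arbitrary: g f rule: less_induct)
  case (less m)
  show ?case
  proof (cases m)
    case 0
    then show ?thesis by simp
  next
    case (Suc k)
    \<comment> \<open>The contribution of all walks whose excursion above \<open>g + 1\<close> is \<open>x\<close> and that have \<open>r\<close> steps left after the
      first step down.\<close>
    define H where "H = (\<lambda>x r. walk_sum r g (\<lambda>t. f (cat (liftn (Suc g) x) (cat (edge (Suc g)) t))))"
    let ?G = "\<lambda>i j. \<Sum>s\<leftarrow>arches i. \<Sum>s'\<leftarrow>arches j. H (cat (hill s) s') (k - (2 * i + 1) - (2 * j + 1))"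
    have fin: "finite {i. 2 * i + 1 \<le> l}" for l :: nat
      by (rule finite_subset[of _ "{..l}"]) auto
    have a: "walk_sum k (Suc (Suc g)) (\<lambda>t. f (cat (edge (Suc (Suc g))) t)) =
        (\<Sum>i\<in>{i. 2 * i + 1 \<le> k}. \<Sum>s\<leftarrow>arches i. walk_sum (k - (2 * i + 1)) (Suc g) (\<lambda>t. f (cat (liftn (Suc g) (hill s)) t)))"
      unfolding less.IH[of k "Suc g", unfolded Suc, OF lessI] liftn_hill cat_assoc ..
    have b: "walk_sum (k - (2 * i + 1)) (Suc g) (\<lambda>t. f (cat (liftn (Suc g) (hill s)) t)) =
        (\<Sum>j\<in>{j. 2 * j + 1 \<le> k - (2 * i + 1)}. \<Sum>s'\<leftarrow>arches j. H (cat (hill s) s') (k - (2 * i + 1) - (2 * j + 1)))" for i s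
    proof -
      have "k - (2 * i + 1) < m" using Suc by simp
      from less.IH[OF this, of g "\<lambda>t. f (cat (liftn (Suc g) (hill s)) t)"] show ?thesis
        unfolding H_def liftn_cat cat_assoc .
    qed
    have "walk_sum m (Suc g) f = (\<Sum>i\<in>{i. 2 * i + 1 \<le> k}. \<Sum>j\<in>{j. 2 * j + 1 \<le> k - (2 * i + 1)}. ?G i j) + H stat0 k"
      unfolding Suc walk_sum.simps a b sum_list_sum_swap H_def liftn_stat0 cat_stat0 ..
    also have "(\<Sum>i\<in>{i. 2 * i + 1 \<le> k}. \<Sum>j\<in>{j. 2 * j + 1 \<le> k - (2 * i + 1)}. ?G i j) =
        (\<Sum>(i, j)\<in>Sigma {i. 2 * i + 1 \<le> k} (\<lambda>i. {j. 2 * j + 1 \<le> k - (2 * i + 1)}). ?G i j)"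
      by (rule sum.Sigma) (use fin in auto)
    also have "\<dots> = (\<Sum>(K, i)\<in>Sigma {K. 2 * K + 2 \<le> k} (\<lambda>K. {..K}). ?G i (K - i))"
      by (rule sum.reindex_bij_witness[where i = "\<lambda>(K, i). (i, K - i)" and j = "\<lambda>(i, j). (i + j, i)"]) auto
    also have "\<dots> = (\<Sum>K\<in>{K. 2 * K + 2 \<le> k}. \<Sum>i\<le>K. ?G i (K - i))"
    proof -
      have "finite {K. 2 * K + 2 \<le> k}" by (rule finite_subset[of _ "{..k}"]) auto
      then show ?thesis by (intro sum.Sigma[symmetric]) auto
    qed
    also have "\<dots> = (\<Sum>K\<in>{K. 2 * K + 2 \<le> k}. \<Sum>x\<leftarrow>arches (Suc K). H x (k - (2 * K + 2)))"
    proof (rule sum.cong[OF refl])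
      fix K assume "K \<in> {K. 2 * K + 2 \<le> k}"
      have "k - (2 * i + 1) - (2 * (K - i) + 1) = k - (2 * K + 2)" if "i \<le> K" for i using that by simp
      then show "(\<Sum>i\<le>K. ?G i (K - i)) = (\<Sum>x\<leftarrow>arches (Suc K). H x (k - (2 * K + 2)))"
        unfolding sum_arches_Suc by (intro sum.cong refl) simp
    qed
    also have "\<dots> = (\<Sum>K\<in>Suc ` {K. 2 * K + 2 \<le> k}. \<Sum>x\<leftarrow>arches K. H x (m - (2 * K + 1)))"
      unfolding Suc by (subst sum.reindex) (simp_all add: o_def)
    also have "\<dots> + H stat0 k = (\<Sum>K\<in>insert 0 (Suc ` {K. 2 * K + 2 \<le> k}). \<Sum>x\<leftarrow>arches K. H x (m - (2 * K + 1)))"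
    proof -
      have "finite (Suc ` {K. 2 * K + 2 \<le> k})" by (rule finite_subset[of _ "{..Suc k}"]) auto
      then show ?thesis by (subst sum.insert) (auto simp: Suc)
    qed
    also have "insert 0 (Suc ` {K. 2 * K + 2 \<le> k}) = {i. 2 * i + 1 \<le> m}"
    proof (intro set_eqI)
      fix i show "i \<in> insert 0 (Suc ` {K. 2 * K + 2 \<le> k}) \<longleftrightarrow> i \<in> {i. 2 * i + 1 \<le> m}"
        unfolding Suc by (cases i) auto
    qed
    finally show ?thesis unfolding H_def .
  qed
qed

lemma liftn_1: "liftn (Suc 0) s = lift s" by simp

lemma first_passage_1:
  "walk_sum (2 * n + 1) 1 (\<lambda>t. f (cat (edge 1) t)) = (\<Sum>i\<le>n. \<Sum>s\<leftarrow>arches i. walk_sum (2 * (n - i)) 0 (\<lambda>t. f (cat (hill s) t)))"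
proof -
  have "{i. 2 * i + 1 \<le> 2 * n + 1} = {..n}" by auto
  moreover have "2 * n + 1 - (2 * i + 1) = 2 * (n - i)" for i by simp
  ultimately show ?thesis
    using first_passage[of "2 * n + 1" 0 "\<lambda>t. f (cat (edge 1) t)"]
    by (simp only: One_nat_def liftn_1 cat_assoc hill_edges)
qed

lemma walk_sum_odd:
  "walk_sum (2 * n + 1) 0 f = (\<Sum>i\<le>n. \<Sum>s\<leftarrow>arches i. walk_sum (2 * (n - i)) 0 (\<lambda>t. f (cat s (cat (edge 0) t))))"
proof (induction n arbitrary: f rule: less_induct)
  case (less n)
  show ?case
  proof (cases n)
    case 0
    then show ?thesis by simp
  next
    case (Suc k)
    define H where "H = (\<lambda>x r. walk_sum (2 * r) 0 (\<lambda>t. f (cat x (cat (edge 0) t))))"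
    let ?g = "\<lambda>i j r. \<Sum>s\<leftarrow>arches i. \<Sum>s'\<leftarrow>arches j. H (cat (hill s) s') r"
    have "walk_sum (2 * n) 1 (\<lambda>t. f (cat (edge 1) t)) =
        (\<Sum>i\<in>{i. 2 * i + 1 \<le> 2 * n}. \<Sum>s\<leftarrow>arches i. walk_sum (2 * n - (2 * i + 1)) 0 (\<lambda>t. f (cat (hill s) t)))"
      using first_passage[of "2 * n" 0 "\<lambda>t. f (cat (edge 1) t)"]
      by (simp only: One_nat_def liftn_1 cat_assoc hill_edges)
    also have "{i. 2 * i + 1 \<le> 2 * n} = {..k}" using Suc by auto
    also have "(\<Sum>i\<le>k. \<Sum>s\<leftarrow>arches i. walk_sum (2 * n - (2 * i + 1)) 0 (\<lambda>t. f (cat (hill s) t))) = (\<Sum>i\<le>k. \<Sum>j\<le>k - i. ?g i j (k - i - j))"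
    proof (rule sum.cong[OF refl])
      fix i assume "i \<in> {..k}"
      then have i: "2 * n - (2 * i + 1) = 2 * (k - i) + 1" "k - i < n" using Suc by auto
      show "(\<Sum>s\<leftarrow>arches i. walk_sum (2 * n - (2 * i + 1)) 0 (\<lambda>t. f (cat (hill s) t))) = (\<Sum>j\<le>k - i. ?g i j (k - i - j))"
        unfolding i(1) less.IH[OF i(2)] sum_list_sum_swap H_def cat_assoc ..
    qed
    also have "\<dots> = (\<Sum>K\<le>k. \<Sum>i\<le>K. ?g i (K - i) (k - K))" by (rule triple_reindex)
    also have "\<dots> = (\<Sum>K\<le>k. \<Sum>x\<leftarrow>arches (Suc K). H x (k - K))" unfolding sum_arches_Suc ..
    finally have "walk_sum (2 * n) 1 (\<lambda>t. f (cat (edge 1) t)) = (\<Sum>K\<le>k. \<Sum>x\<leftarrow>arches (Suc K). H x (n - Suc K))"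
      unfolding Suc by simp
    moreover have "walk_sum (2 * n) 0 (\<lambda>t. f (cat (edge 0) t)) = (\<Sum>x\<leftarrow>arches 0. H x (n - 0))"
      by (simp add: H_def)
    moreover have "(\<Sum>K\<le>n. \<Sum>x\<leftarrow>arches K. H x (n - K)) = (\<Sum>x\<leftarrow>arches 0. H x (n - 0)) + (\<Sum>K\<le>k. \<Sum>x\<leftarrow>arches (Suc K). H x (n - Suc K))"
      by (simp only: Suc sum.atMost_Suc_shift)
    moreover have "walk_sum (2 * n + 1) 0 f = walk_sum (2 * n) 1 (\<lambda>t. f (cat (edge 1) t)) + walk_sum (2 * n) 0 (\<lambda>t. f (cat (edge 0) t))"
      by simp
    ultimately have "walk_sum (2 * n + 1) 0 f = (\<Sum>K\<le>n. \<Sum>x\<leftarrow>arches K. H x (n - K))" by linarith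
    then show ?thesis unfolding H_def .
  qed
qed

lemma walk_sum_odd_dip:
  "walk_sum (2 * n + 1) 0 (\<lambda>t. f (cat (edge 0) t)) = (\<Sum>i\<le>n. \<Sum>s\<leftarrow>arches i. walk_sum (2 * (n - i)) 0 (\<lambda>t. f (cat (dip s) t)))"
  unfolding walk_sum_odd dip_edges cat_assoc ..

theorem walk_sum_even: "walk_sum (2 * n) 0 f = (\<Sum>s\<leftarrow>chains n. f s)"
proof (induction n arbitrary: f rule: less_induct)
  case (less n)
  show ?case
  proof (cases n)
    case 0
    then show ?thesis by simp
  next
    case (Suc k)
    have i: "(\<Sum>i\<le>k. \<Sum>s\<leftarrow>arches i. walk_sum (2 * (k - i)) 0 (\<lambda>t. f (cat (h s) t))) = (\<Sum>i\<le>k. \<Sum>s\<leftarrow>arches i. \<Sum>t\<leftarrow>chains (k - i). f (cat (h s) t))" for h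
      by (intro sum.cong refl arg_cong[where f = sum_list] map_cong less.IH) (use Suc in auto)
    have "walk_sum (2 * n) 0 f = walk_sum (2 * k + 1) 1 (\<lambda>t. f (cat (edge 1) t)) + walk_sum (2 * k + 1) 0 (\<lambda>t. f (cat (edge 0) t))"
      unfolding Suc by simp
    also have "\<dots> = (\<Sum>s\<leftarrow>chains n. f s)"
      unfolding Suc sum_chains_Suc first_passage_1 walk_sum_odd_dip i by (simp add: sum_list_addf sum.distrib)
    finally show ?thesis .
  qed
qed

theorem signed_sum_walk_sum: "signed_sum f n = walk_sum (2 * n + 1) 1 (\<lambda>t. f (cat (edge 1) t)) - walk_sum (2 * n + 1) 0 (\<lambda>t. f (cat (edge 0) t))"
  unfolding first_passage_1 walk_sum_odd_dip walk_sum_even signed_sum_def by (simp add: sum_list_subtractf sum_subtractf)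

text \<open>Half of the label of a step between two heights is the mean of \<open>half_height\<close> at its ends, and its square
is the sum of \<open>tri_height\<close> at its ends. Thus all contributions can be moved from steps to vertices, where
they are integers and do not depend on the direction in which the vertex is left.\<close>

definition half_height :: "nat \<Rightarrow> nat" where "half_height g = (g + 1) div 2"
definition tri_height :: "nat \<Rightarrow> nat" where "tri_height g = g * (g + 1) div 2"

lemma half_height_Suc: "real (half_height g) + real (half_height (Suc g)) = real g + 1"
proof -
  have "half_height g + half_height (Suc g) = g + 1" unfolding half_height_def by presburger
  then show ?thesis by linarith
qed

lemma real_tri_height: "real (tri_height g) = real g * (real g + 1) / 2"
proof -
  have "2 * tri_height g = g * (g + 1)" unfolding tri_height_def by simp
  then have "2 * real (tri_height g) = real g * (real g + 1)" by (metis of_nat_mult of_nat_numeral of_nat_add of_nat_1)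
  then show ?thesis by simp
qed

definition bump :: "nat \<Rightarrow> nat \<Rightarrow> nat \<Rightarrow> nat \<times> nat \<times> nat \<Rightarrow> nat \<times> nat \<times> nat" where
  "bump a b c = (\<lambda>(x, y, z). (x + a, y + b, z + c))"

fun walks :: "nat \<Rightarrow> nat \<Rightarrow> (nat \<times> nat \<times> nat) list" where
  "walks 0 g = (if g = 0 then [(0, 0, 0)] else [])"
| "walks (Suc m) g = map (bump (half_height g) (Suc m * half_height g) (tri_height g)) (walks m (Suc g) @ walks m (g - 1))"

text \<open>The vertex sums count the starting vertex in full, whereas only half of it belongs to the steps. The second
entry of the triple measures positions from the end of the walk, which makes the contribution of a new first
vertex a constant.\<close>

definition walk_stat :: "nat \<Rightarrow> nat \<Rightarrow> nat \<times> nat \<times> nat \<Rightarrow> stat" where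
  "walk_stat m g = (\<lambda>(x, y, z). (real m, real x - real (half_height g) / 2,
     real m * (real x - real (half_height g) / 2) - (real y - (real m + 1 / 2) * real (half_height g) / 2),
     (real z - real (tri_height g) / 2) / 2))"

lemma walk_stat_step: "cat (edge (Suc g)) (walk_stat m g x) = walk_stat (Suc m) (Suc g) (bump (half_height (Suc g)) (Suc m * half_height (Suc g)) (tri_height (Suc g)) x)"
  "cat (edge (Suc g)) (walk_stat m (Suc g) x) = walk_stat (Suc m) g (bump (half_height g) (Suc m * half_height g) (tri_height g) x)"
  "cat (edge 0) (walk_stat m 0 x) = walk_stat (Suc m) 0 (bump (half_height 0) (Suc m * half_height 0) (tri_height 0) x)"
proof -
  obtain a b c where x: "x = (a, b, c)" by (cases x)
  have c: "real (half_height (Suc g)) = real g + 1 - real (half_height g)" using half_height_Suc[of g] by simp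
  show "cat (edge (Suc g)) (walk_stat m g x) = walk_stat (Suc m) (Suc g) (bump (half_height (Suc g)) (Suc m * half_height (Suc g)) (tri_height (Suc g)) x)"
    "cat (edge (Suc g)) (walk_stat m (Suc g) x) = walk_stat (Suc m) g (bump (half_height g) (Suc m * half_height g) (tri_height g) x)"
    unfolding x by (simp_all add: edge_def walk_stat_def bump_def c real_tri_height power2_eq_square field_simps)
  show "cat (edge 0) (walk_stat m 0 x) = walk_stat (Suc m) 0 (bump (half_height 0) (Suc m * half_height 0) (tri_height 0) x)"
    unfolding x by (simp add: edge_def walk_stat_def bump_def half_height_def tri_height_def algebra_simps)
qed

theorem walk_sum_walks: "walk_sum m g f = (\<Sum>x\<leftarrow>walks m g. f (walk_stat m g x))"
proof (induction m arbitrary: g f)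
  case 0
  show ?case by (simp add: walk_stat_def half_height_def tri_height_def)
next
  case (Suc m)
  show ?case
  proof (cases g)
    case 0
    then show ?thesis using walk_stat_step(2)[of 0 m] walk_stat_step(3)[of m] by (simp add: Suc o_def)
  next
    case (Suc h)
    show ?thesis unfolding Suc using walk_stat_step(2)[of "Suc h" m] walk_stat_step(1)[of h m] by (simp add: Suc.IH o_def)
  qed
qed

definition final_stat :: "real \<Rightarrow> nat \<times> nat \<times> nat \<Rightarrow> stat" where
  "final_stat l = (\<lambda>(x, y, z). (l, real x, l * real x - real y, real z / 2))"

theorem signed_sum_walks: "signed_sum f n = (\<Sum>x\<leftarrow>walks (2 * n + 1) 1. f (final_stat (2 * real n + 2) x)) - (\<Sum>x\<leftarrow>walks (2 * n + 1) 0. f (final_stat (2 * real n + 2) x))"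
proof -
  have b: "bump (half_height 0) (Suc m * half_height 0) (tri_height 0) x = x" for m x by (cases x) (simp add: bump_def half_height_def tri_height_def)
  have z: "walk_stat (Suc (2 * n + 1)) 0 x = final_stat (2 * real n + 2) x" for x
    by (cases x) (simp add: walk_stat_def final_stat_def half_height_def tri_height_def)
  have 1: "cat (edge 1) (walk_stat (2 * n + 1) 1 x) = final_stat (2 * real n + 2) x" for x
    using walk_stat_step(2)[of 0 "2 * n + 1" x] unfolding b z by simp
  have 0: "cat (edge 0) (walk_stat (2 * n + 1) 0 x) = final_stat (2 * real n + 2) x" for x
    using walk_stat_step(3)[of "2 * n + 1" x] unfolding b z by simp
  show ?thesis unfolding signed_sum_walk_sum walk_sum_walks 0 1 ..
qed

section \<open>Moment tables\<close>

fun step_list :: "('a \<Rightarrow> 'a \<Rightarrow> 'a) \<Rightarrow> 'a \<Rightarrow> 'a list \<Rightarrow> 'a list" where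
  "step_list op x [] = []"
| "step_list op x (y # ys) = op x y # step_list op y ys"

lemma length_step_list [simp]: "length (step_list op x ys) = length ys"
  by (induction ys arbitrary: x) auto

function shift_list :: "('a \<Rightarrow> 'a \<Rightarrow> 'a) \<Rightarrow> 'a list \<Rightarrow> 'a list" where
  "shift_list op [] = []"
| "shift_list op (x # xs) = x # shift_list op (step_list op x xs)"
  by pat_completeness auto
termination by (relation "measure (\<lambda>(op, xs). length xs)") auto

lemma step_list_map:
  assumes "\<And>q. op (\<phi> q i) (\<phi> (Suc q) i) = \<phi> q (Suc i)"
  shows "step_list op (\<phi> a i) (map (\<lambda>q. \<phi> q i) [Suc a..<Suc a + n]) = map (\<lambda>q. \<phi> q (Suc i)) [a..<a + n]"
proof (induction n arbitrary: a)
  case (Suc n)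
  have "[Suc a..<Suc a + Suc n] = Suc a # [Suc (Suc a)..<Suc (Suc a) + n]" "[a..<a + Suc n] = a # [Suc a..<Suc a + n]"
    by (simp_all add: upt_conv_Cons)
  then show ?case using Suc[of "Suc a"] assms by simp
qed simp

text \<open>Passing from the moments of a variable to those of its translate is a triangular scheme: applying one step
\<open>x, y \<mapsto> y + k * x\<close> to the tail replaces one factor \<open>x\<close> by \<open>x + k\<close>.\<close>

lemma shift_list_map:
  assumes "\<And>q i. op (\<phi> q i) (\<phi> (Suc q) i) = \<phi> q (Suc i)"
  shows "shift_list op (map (\<lambda>q. \<phi> q i) [0..<n]) = map (\<lambda>q. \<phi> 0 (i + q)) [0..<n]"
proof (induction n arbitrary: i)
  case (Suc n)
  have "[0..<Suc n] = 0 # [Suc 0..<Suc 0 + n]" by (simp add: upt_conv_Cons)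
  then have 1: "map (\<lambda>q. F q) [0..<Suc n] = F 0 # map F [Suc 0..<Suc 0 + n]" for F :: "nat \<Rightarrow> 'b" by simp
  have "map (\<lambda>q. \<phi> 0 (i + q)) [Suc 0..<Suc 0 + n] = map (\<lambda>q. \<phi> 0 (Suc i + q)) [0..<n]"
    by (rule nth_equalityI) (simp_all del: upt_Suc)
  then show ?case unfolding 1 shift_list.simps using step_list_map[of op \<phi> i 0 n, OF assms] Suc[of "Suc i"] by simp
qed simp

definition axp :: "nat \<Rightarrow> nat \<Rightarrow> nat \<Rightarrow> nat" where "axp k x y = y + k * x"
fun zip2 :: "('a \<Rightarrow> 'a \<Rightarrow> 'a) \<Rightarrow> 'a list \<Rightarrow> 'a list \<Rightarrow> 'a list" where
  "zip2 op (x # xs) (y # ys) = op x y # zip2 op xs ys"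
| "zip2 op [] ys = []"
| "zip2 op xs [] = []"

lemma zip2_map: "b \<le> a \<Longrightarrow> zip2 op (map f [0..<a]) (map g [0..<b]) = map (\<lambda>p. op (f p) (g p)) [0..<b]"
proof (induction b arbitrary: a f g)
  case 0
  then show ?case by (cases "map f [0..<a]") simp_all
next
  case (Suc b)
  then obtain a' where a: "a = Suc a'" "b \<le> a'" by (cases a) auto
  have 1: "map F [0..<Suc k] = F 0 # map (\<lambda>p. F (Suc p)) [0..<k]" for F :: "nat \<Rightarrow> 'c" and k
    by (simp add: upt_conv_Cons map_Suc_upt[symmetric] del: upt_Suc)
  show ?case unfolding a(1) 1 zip2.simps Suc.IH[OF a(2)] ..
qed

type_synonym tab = "nat list list list"

definition mom :: "(nat \<times> nat \<times> nat) list \<Rightarrow> (nat \<Rightarrow> nat \<Rightarrow> nat \<Rightarrow> nat) \<Rightarrow> nat" where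
  "mom xs w = (\<Sum>(x, y, z)\<leftarrow>xs. w x y z)"

text \<open>The moments \<open>x ^ p * y ^ q * z ^ r\<close> with \<open>p + 2 * q + 2 * r \<le> 11\<close>, outermost index \<open>r\<close>: all monomials of
the statistic for fifth powers are among them. The set of exponents is closed under decreasing any of them, as
translations require.\<close>

definition tab :: "(nat \<times> nat \<times> nat) list \<Rightarrow> tab" where
  "tab xs = map (\<lambda>r. map (\<lambda>q. map (\<lambda>p. mom xs (\<lambda>x y z. x ^ p * y ^ q * z ^ r)) [0..<12 - 2 * (q + r)]) [0..<6 - r]) [0..<6]"

definition translate :: "nat \<Rightarrow> nat \<Rightarrow> nat \<Rightarrow> tab \<Rightarrow> tab" where
  "translate a b c t = shift_list (zip2 (zip2 (axp c))) (map (shift_list (zip2 (axp b))) (map (map (shift_list (axp a))) t))"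

lemma mom_add: "mom xs (\<lambda>x y z. w x y z + k * w' x y z) = mom xs w + k * mom xs w'"
  unfolding mom_def by (simp add: case_prod_unfold sum_list_addf sum_list_const_mult)

lemma axp_mom:
  assumes "\<And>x y z. w'' x y z = w' x y z + k * w x y z"
  shows "axp k (mom xs w) (mom xs w') = mom xs w''"
  unfolding axp_def assms mom_add ..

lemma translate_tab: "translate a b c (tab xs) = tab (map (bump a b c) xs)"
proof -
  let ?A = "\<lambda>p i q j r k. mom xs (\<lambda>x y z. x ^ p * (x + a) ^ i * (y ^ q * (y + b) ^ j) * (z ^ r * (z + c) ^ k))"
  have 1: "shift_list (axp a) (map (\<lambda>p. ?A p 0 q 0 r 0) [0..<n]) = map (\<lambda>p. ?A 0 p q 0 r 0) [0..<n]" for q r n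
    using shift_list_map[where op = "axp a" and \<phi> = "\<lambda>p i. ?A p i q 0 r 0" and i = 0 and n = n]
    by (simp add: axp_mom algebra_simps del: One_nat_def)
  have 2: "shift_list (zip2 (axp b)) (map (\<lambda>q. map (\<lambda>p. ?A 0 p q 0 r 0) [0..<12 - 2 * (q + r)]) [0..<n]) =
      map (\<lambda>q. map (\<lambda>p. ?A 0 p 0 q r 0) [0..<12 - 2 * (q + r)]) [0..<n]" for r n
  proof -
    let ?\<phi> = "\<lambda>q j. map (\<lambda>p. ?A 0 p q j r 0) [0..<12 - 2 * (q + j + r)]"
    have "zip2 (axp b) (?\<phi> q j) (?\<phi> (Suc q) j) = ?\<phi> q (Suc j)" for q j
      by (subst zip2_map) (auto simp: intro!: axp_mom simp: algebra_simps)
    from shift_list_map[where op = "zip2 (axp b)" and \<phi> = ?\<phi> and i = 0 and n = n, OF this]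
    show ?thesis by simp
  qed
  have 3: "shift_list (zip2 (zip2 (axp c))) (map (\<lambda>r. map (\<lambda>q. map (\<lambda>p. ?A 0 p 0 q r 0) [0..<12 - 2 * (q + r)]) [0..<6 - r]) [0..<n]) =
      map (\<lambda>r. map (\<lambda>q. map (\<lambda>p. ?A 0 p 0 q 0 r) [0..<12 - 2 * (q + r)]) [0..<6 - r]) [0..<n]" for n
  proof -
    let ?\<phi> = "\<lambda>r k. map (\<lambda>q. map (\<lambda>p. ?A 0 p 0 q r k) [0..<12 - 2 * (q + (r + k))]) [0..<6 - (r + k)]"
    have "zip2 (zip2 (axp c)) (?\<phi> r k) (?\<phi> (Suc r) k) = ?\<phi> r (Suc k)" for r k
    proof -
      have "zip2 (axp c) (map (\<lambda>p. ?A 0 p 0 q r k) [0..<12 - 2 * (q + (r + k))]) (map (\<lambda>p. ?A 0 p 0 q (Suc r) k) [0..<12 - 2 * (q + (Suc r + k))])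
         = map (\<lambda>p. ?A 0 p 0 q r (Suc k)) [0..<12 - 2 * (q + (r + Suc k))]" for q
        by (subst zip2_map) (auto intro!: axp_mom simp: algebra_simps)
      then show ?thesis by (subst zip2_map) auto
    qed
    from shift_list_map[where op = "zip2 (zip2 (axp c))" and \<phi> = ?\<phi> and i = 0 and n = n, OF this]
    show ?thesis by simp
  qed
  have t1: "tab xs = map (\<lambda>r. map (\<lambda>q. map (\<lambda>p. ?A p 0 q 0 r 0) [0..<12 - 2 * (q + r)]) [0..<6 - r]) [0..<6]"
    unfolding tab_def by simp
  have m: "mom (map (bump a b c) xs) w = mom xs (\<lambda>x y z. w (x + a) (y + b) (z + c))" for w
    unfolding mom_def by (simp add: bump_def case_prod_unfold o_def)
  have t2: "tab (map (bump a b c) xs) = map (\<lambda>r. map (\<lambda>q. map (\<lambda>p. ?A 0 p 0 q 0 r) [0..<12 - 2 * (q + r)]) [0..<6 - r]) [0..<6]"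
    unfolding tab_def m by simp
  show ?thesis unfolding t2 translate_def t1 by (simp only: list.map_comp o_def 1 2 3)
qed

abbreviation "tadd \<equiv> zip2 (zip2 (zip2 (+)))"

lemma tadd_tab: "tadd (tab xs) (tab ys) = tab (xs @ ys)"
proof -
  have "mom (xs @ ys) w = mom xs w + mom ys w" for w by (simp add: mom_def)
  then show ?thesis unfolding tab_def by (simp only: zip2_map[OF order_refl])
qed

definition moments :: "nat \<Rightarrow> nat \<Rightarrow> tab" where "moments m g = tab (walks m g)"

text \<open>Both kinds of first steps lead to the same translation, so the tables of the two neighbouring heights are
added before they are translated.\<close>

lemma moments_rec: "moments (Suc m) (Suc g) = translate (half_height (Suc g)) (Suc m * half_height (Suc g)) (tri_height (Suc g)) (tadd (moments m (Suc (Suc g))) (moments m g))"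
  unfolding moments_def tadd_tab translate_tab by simp

lemma walks_empty: "m < g \<Longrightarrow> walks m g = []"
  by (induction m arbitrary: g) auto

lemma moments_edge: "moments (Suc m) (Suc m) = translate (half_height (Suc m)) (Suc m * half_height (Suc m)) (tri_height (Suc m)) (moments m m)"
  unfolding moments_def translate_tab by (simp add: walks_empty)

lemma moments_rec_0: "moments (Suc m) 0 = tadd (moments m 1) (moments m 0)"
proof -
  have "map (bump (half_height 0) k (tri_height 0)) xs = xs" if "k = 0" for k xs
    using that by (induction xs) (auto simp: bump_def half_height_def tri_height_def)
  then have "walks (Suc m) 0 = walks m 1 @ walks m 0" by (simp add: half_height_def)
  then show ?thesis unfolding moments_def tadd_tab by simp
qed

fun dot :: "('a \<Rightarrow> 'b \<Rightarrow> real) \<Rightarrow> 'a list \<Rightarrow> 'b list \<Rightarrow> real" where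
  "dot op (x # xs) (y # ys) = op x y + dot op xs ys"
| "dot op [] ys = 0"
| "dot op xs [] = 0"

abbreviation "dot3 \<equiv> dot (dot (dot (\<lambda>c (y :: nat). c * real y)))"

lemma dot_map_mom:
  assumes "\<And>c r. op c (f xs r) = (\<Sum>x\<leftarrow>xs. op c (f [x] r))"
  shows "dot op ks (map (f xs) rs) = (\<Sum>x\<leftarrow>xs. dot op ks (map (f [x]) rs))"
proof (induction rs arbitrary: ks)
  case Nil
  then show ?case by (cases ks) simp_all
next
  case (Cons r rs)
  show ?case
  proof (cases ks)
    case (Cons c ks')
    show ?thesis unfolding Cons list.map dot.simps Cons.IH by (subst assms) (simp add: sum_list_addf)
  qed simp
qed

text \<open>Contracting a table with coefficients is additive over the walks, so polynomial identities need to be checked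
for a single walk only.\<close>

lemma dot3_tab: "dot3 ks (tab xs) = (\<Sum>x\<leftarrow>xs. dot3 ks (tab [x]))"
  unfolding tab_def
proof (intro dot_map_mom[where f = "\<lambda>xs r. map (\<lambda>q. map (\<lambda>p. mom xs (\<lambda>x y z. x ^ p * y ^ q * z ^ r)) [0..<12 - 2 * (q + r)]) [0..<6 - r]"]
    dot_map_mom[where f = "\<lambda>xs q. map (\<lambda>p. mom xs (\<lambda>x y z. x ^ p * y ^ q * z ^ r)) [0..<12 - 2 * (q + r)]" for r]
    dot_map_mom[where f = "\<lambda>xs p. mom xs (\<lambda>x y z. x ^ p * y ^ q * z ^ r)" for q r])
  fix c :: real and r q p
  show "c * real (mom xs (\<lambda>x y z. x ^ p * y ^ q * z ^ r)) = (\<Sum>x\<leftarrow>xs. c * real (mom [x] (\<lambda>x y z. x ^ p * y ^ q * z ^ r)))"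
    by (induction xs) (auto simp: mom_def algebra_simps)
qed

fun ups :: "nat \<Rightarrow> (nat \<times> nat) list \<Rightarrow> tab list \<Rightarrow> tab list" where
  "ups m ((c, e) # hs) (a # b # d # ts) = translate c (m * c) e (tadd d a) # ups m hs (b # d # ts)"
| "ups m ((c, e) # (c', e') # hs) [a, b] = [translate c (m * c) e a, translate c' (m * c') e' b]"
| "ups m hs ts = []"

fun downs :: "nat \<Rightarrow> (nat \<times> nat) list \<Rightarrow> tab list \<Rightarrow> tab list" where
  "downs m ((c, e) # hs) (a # b # d # ts) = translate c (m * c) e (tadd d a) # downs m hs (b # d # ts)"
| "downs m hs ts = []"

definition heights :: "(nat \<times> nat) list" where
  "heights = [(1, 1), (1, 3), (2, 6), (2, 10), (3, 15), (3, 21), (4, 28), (4, 36), (5, 45), (5, 55),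
    (6, 66), (6, 78), (7, 91), (7, 105), (8, 120), (8, 136)]"

lemma cs_eq: "heights = map (\<lambda>g. (half_height g, tri_height g)) [1..<17]"
  by (simp add: heights_def half_height_def tri_height_def upt_rec)

text \<open>A layer consists of the tables of all starting heights for a fixed number of steps. While the number of
steps is at most 16 all heights are kept; afterwards one height is dropped per step, because only the
heights 0 and 1 are needed after 31 steps.\<close>

definition layer_up :: "nat \<Rightarrow> tab list \<Rightarrow> bool" where
  "layer_up m ts \<longleftrightarrow> ts = map (moments m) [0..<Suc m]"
definition layer_down :: "nat \<Rightarrow> tab list \<Rightarrow> bool" where
  "layer_down m ts \<longleftrightarrow> ts = map (moments m) [0..<length ts] \<and> length ts \<le> 17"

fun upl :: "nat \<Rightarrow> tab list \<Rightarrow> tab list" where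
  "upl m (a # b # ts) = tadd b a # ups m heights (a # b # ts)"
| "upl m ts = []"
fun downl :: "nat \<Rightarrow> tab list \<Rightarrow> tab list" where
  "downl m (a # b # ts) = tadd b a # downs m heights (a # b # ts)"
| "downl m ts = []"

lemma upt_2: "map f [g..<Suc (Suc g) + k] = f g # f (Suc g) # map f [Suc (Suc g)..<Suc (Suc g) + k]"
  by (simp add: upt_conv_Cons del: upt_Suc)

lemma upt_3: "map f [g..<Suc (Suc g) + Suc k] = f g # f (Suc g) # f (Suc (Suc g)) # map f [Suc (Suc (Suc g))..<Suc (Suc (Suc g)) + k]"
  by (simp add: upt_conv_Cons del: upt_Suc)

lemma ups_moments:
  assumes "m = Suc g + k" "g + k \<le> 14"
  shows "ups (Suc m) (map (\<lambda>g. (half_height g, tri_height g)) [Suc g..<17]) (map (moments m) [g..<Suc (Suc g) + k]) =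
    map (moments (Suc m)) [Suc g..<Suc m + 1]"
  using assms
proof (induction k arbitrary: g)
  case 0
  have "[Suc g..<17] = Suc g # Suc (Suc g) # [Suc (Suc (Suc g))..<17]" using 0 by (simp add: upt_conv_Cons)
  moreover have "map (moments m) [g..<Suc (Suc g) + 0] = [moments m g, moments m (Suc g)]" by (simp add: upt_2)
  moreover have "[Suc g..<Suc m + 1] = [Suc g, Suc (Suc g)]" using 0 by (simp add: upt_conv_Cons)
  moreover have "moments (Suc m) (Suc g) = translate (half_height (Suc g)) (Suc m * half_height (Suc g)) (tri_height (Suc g)) (moments m g)"
    unfolding moments_def translate_tab using 0 by (simp add: walks_empty)
  moreover have "moments (Suc m) (Suc (Suc g)) = translate (half_height (Suc (Suc g))) (Suc m * half_height (Suc (Suc g))) (tri_height (Suc (Suc g))) (moments m (Suc g))"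
    using moments_edge[of m] 0 by simp
  ultimately show ?case by simp
next
  case (Suc k)
  have "[Suc g..<17] = Suc g # [Suc (Suc g)..<17]" using Suc.prems by (simp add: upt_conv_Cons)
  moreover have "[Suc g..<Suc m + 1] = Suc g # [Suc (Suc g)..<Suc m + 1]" using Suc.prems by (simp add: upt_conv_Cons del: upt_Suc)
  moreover have "ups (Suc m) (map (\<lambda>g. (half_height g, tri_height g)) [Suc (Suc g)..<17]) (map (moments m) [Suc g..<Suc (Suc (Suc g)) + k]) =
    map (moments (Suc m)) [Suc (Suc g)..<Suc m + 1]" using Suc by simp
  ultimately show ?case unfolding upt_3 upt_2[of "moments m" "Suc g"] by (simp add: moments_rec del: upt_Suc)
qed

lemma downs_moments:
  assumes "g + k \<le> 15"
  shows "downs (Suc m) (map (\<lambda>g. (half_height g, tri_height g)) [Suc g..<17]) (map (moments m) [g..<Suc (Suc g) + k]) =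
    map (moments (Suc m)) [Suc g..<Suc g + k]"
  using assms
proof (induction k arbitrary: g)
  case 0
  then show ?case by (cases "map (\<lambda>g. (half_height g, tri_height g)) [Suc g..<17]") (simp_all add: upt_2)
next
  case (Suc k)
  have "[Suc g..<17] = Suc g # [Suc (Suc g)..<17]" using Suc.prems by (simp add: upt_conv_Cons)
  moreover have "[Suc g..<Suc g + Suc k] = Suc g # [Suc (Suc g)..<Suc (Suc g) + k]" by (simp add: upt_conv_Cons del: upt_Suc)
  moreover have "downs (Suc m) (map (\<lambda>g. (half_height g, tri_height g)) [Suc (Suc g)..<17]) (map (moments m) [Suc g..<Suc (Suc (Suc g)) + k]) =
    map (moments (Suc m)) [Suc (Suc g)..<Suc (Suc g) + k]" using Suc.IH[of "Suc g"] Suc.prems by (simp del: upt_Suc)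
  ultimately show ?case unfolding upt_3 upt_2[of "moments m" "Suc g"] by (simp add: moments_rec del: upt_Suc)
qed

lemma layer_up_up:
  assumes "layer_up m ts" "1 \<le> m" "m \<le> 15"
  shows "layer_up (m + 1) (upl (m + 1) ts)"
proof -
  obtain k where k: "m = Suc 0 + k" "k \<le> 14" using assms(2,3) by (metis One_nat_def add.commute le_Suc_ex Suc_le_mono add_Suc numeral_eq_Suc plus_1_eq_Suc pred_numeral_simps(3) add_le_imp_le_left eval_nat_numeral(3))
  have ts: "ts = map (moments m) [0..<Suc (Suc 0) + k]" using assms(1) k unfolding layer_up_def by simp
  have 1: "map (moments (Suc m)) [0..<Suc m + 1] = moments (Suc m) 0 # map (moments (Suc m)) [Suc 0..<Suc m + 1]"
    by (simp add: upt_conv_Cons del: upt_Suc)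
  have 2: "upl (Suc m) ts = moments (Suc m) 0 # map (moments (Suc m)) [Suc 0..<Suc m + 1]"
    using ups_moments[of m 0 k] k unfolding ts upt_2 cs_eq upl.simps by (simp add: moments_rec_0 del: upt_Suc)
  show ?thesis unfolding layer_up_def using 1 2 by (simp del: upt_Suc)
qed

lemma layer_down_down:
  assumes "layer_down m (a # b # ts)"
  shows "layer_down (m + 1) (downl (m + 1) (a # b # ts))"
proof -
  define k where "k = length ts"
  have k: "k \<le> 15" using assms unfolding layer_down_def k_def by simp
  have ts: "a # b # ts = map (moments m) [0..<Suc (Suc 0) + k]" using assms unfolding layer_down_def k_def by simp
  have "downl (Suc m) (a # b # ts) = moments (Suc m) 0 # map (moments (Suc m)) [Suc 0..<Suc 0 + k]"
    using downs_moments[of 0 k m] k unfolding ts upt_2 cs_eq downl.simps k_def[symmetric] by (simp add: moments_rec_0 del: upt_Suc)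
  also have "\<dots> = map (moments (Suc m)) [0..<Suc k]" by (simp add: upt_conv_Cons del: upt_Suc)
  finally show ?thesis unfolding layer_down_def using k by (simp del: upt_Suc)
qed

lemma layer_up_layer_down: "layer_up m ts \<Longrightarrow> m \<le> 16 \<Longrightarrow> layer_down m ts" unfolding layer_up_def layer_down_def by simp

definition "moments0 m = moments m 0"
definition "moments1 m = moments m 1"

lemma layer_down_moments: "layer_down m (a # b # ts) \<Longrightarrow> moments0 m = a" "layer_down m (a # b # ts) \<Longrightarrow> moments1 m = b"
  unfolding layer_down_def moments0_def moments1_def by (simp_all add: upt_conv_Cons del: upt_Suc)

lemma layer_up_1: "layer_up 1 [tab [(0, 0, 0)], translate 1 1 1 (tab [(0, 0, 0)])]"
  unfolding layer_up_def moments_def translate_tab by (simp add: half_height_def tri_height_def bump_def)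

lemma tab_0: "tab [(0, 0, 0)] = [[[1,0,0,0,0,0,0,0,0,0,0,0],[0,0,0,0,0,0,0,0,0,0],[0,0,0,0,0,0,0,0],[0,0,0,0,0,0],[0,0,0,0],[0,0]],
  [[0,0,0,0,0,0,0,0,0,0],[0,0,0,0,0,0,0,0],[0,0,0,0,0,0],[0,0,0,0],[0,0]], [[0,0,0,0,0,0,0,0],[0,0,0,0,0,0],[0,0,0,0],[0,0]],
  [[0,0,0,0,0,0],[0,0,0,0],[0,0]], [[0,0,0,0],[0,0]], [[0,0]]]"
  by (simp add: tab_def mom_def upt_rec)

section \<open>Evaluation of the moment tables\<close>

text \<open>Rewriting with the equations \<open>evl\<close> alone computes a layer from the previous one in binary arithmetic, so the
tables need not be written down. Every second layer is kept for the final evaluation.\<close>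

lemma le1: "1 \<le> (1 :: nat)" "1 \<le> (2 :: nat)" "1 \<le> (3 :: nat)" "1 \<le> (4 :: nat)" "1 \<le> (5 :: nat)" "1 \<le> (6 :: nat)" "1 \<le> (7 :: nat)" "1 \<le> (8 :: nat)" "1 \<le> (9 :: nat)" "1 \<le> (10 :: nat)" "1 \<le> (11 :: nat)" "1 \<le> (12 :: nat)" "1 \<le> (13 :: nat)" "1 \<le> (14 :: nat)" "1 \<le> (15 :: nat)" by simp_all
lemma le15: "1 \<le> (15 :: nat)" "2 \<le> (15 :: nat)" "3 \<le> (15 :: nat)" "4 \<le> (15 :: nat)" "5 \<le> (15 :: nat)" "6 \<le> (15 :: nat)" "7 \<le> (15 :: nat)" "8 \<le> (15 :: nat)" "9 \<le> (15 :: nat)" "10 \<le> (15 :: nat)" "11 \<le> (15 :: nat)" "12 \<le> (15 :: nat)" "13 \<le> (15 :: nat)" "14 \<le> (15 :: nat)" "15 \<le> (15 :: nat)" by simp_all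
lemma le16: "1 \<le> (16 :: nat)" "2 \<le> (16 :: nat)" "3 \<le> (16 :: nat)" "4 \<le> (16 :: nat)" "5 \<le> (16 :: nat)" "6 \<le> (16 :: nat)" "7 \<le> (16 :: nat)" "8 \<le> (16 :: nat)" "9 \<le> (16 :: nat)" "10 \<le> (16 :: nat)" "11 \<le> (16 :: nat)" "12 \<le> (16 :: nat)" "13 \<le> (16 :: nat)" "14 \<le> (16 :: nat)" "15 \<le> (16 :: nat)" "16 \<le> (16 :: nat)" by simp_all
lemmas num = arith_simps one_add_one numeral_plus_one one_plus_numeral mult_1 mult_1_right add_0 add_0_right mult_zero_left mult_zero_right
lemmas evl = upl.simps ups.simps downl.simps downs.simps heights_def translate_def shift_list.simps step_list.simps zip2.simps axp_def list.map num
lemmas A1 = layer_up_1[unfolded tab_0 evl]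
lemmas A2 = layer_up_up[OF A1 le1(1) le15(1), unfolded evl]
lemmas A3 = layer_up_up[OF A2 le1(2) le15(2), unfolded evl]
lemmas A4 = layer_up_up[OF A3 le1(3) le15(3), unfolded evl]
lemmas A5 = layer_up_up[OF A4 le1(4) le15(4), unfolded evl]
lemmas A6 = layer_up_up[OF A5 le1(5) le15(5), unfolded evl]
lemmas A7 = layer_up_up[OF A6 le1(6) le15(6), unfolded evl]
lemmas A8 = layer_up_up[OF A7 le1(7) le15(7), unfolded evl]
lemmas A9 = layer_up_up[OF A8 le1(8) le15(8), unfolded evl]
lemmas A10 = layer_up_up[OF A9 le1(9) le15(9), unfolded evl]
lemmas A11 = layer_up_up[OF A10 le1(10) le15(10), unfolded evl]
lemmas A12 = layer_up_up[OF A11 le1(11) le15(11), unfolded evl]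
lemmas A13 = layer_up_up[OF A12 le1(12) le15(12), unfolded evl]
lemmas A14 = layer_up_up[OF A13 le1(13) le15(13), unfolded evl]
lemmas A15 = layer_up_up[OF A14 le1(14) le15(14), unfolded evl]
lemmas A16 = layer_up_up[OF A15 le1(15) le15(15), unfolded evl]
lemmas A17 = layer_down_down[OF layer_up_layer_down[OF A16 le16(16)], unfolded evl]
lemmas A18 = layer_down_down[OF A17, unfolded evl]
lemmas A19 = layer_down_down[OF A18, unfolded evl]
lemmas A20 = layer_down_down[OF A19, unfolded evl]
lemmas A21 = layer_down_down[OF A20, unfolded evl]
lemmas A22 = layer_down_down[OF A21, unfolded evl]
lemmas A23 = layer_down_down[OF A22, unfolded evl]
lemmas A24 = layer_down_down[OF A23, unfolded evl]
lemmas A25 = layer_down_down[OF A24, unfolded evl]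
lemmas A26 = layer_down_down[OF A25, unfolded evl]
lemmas A27 = layer_down_down[OF A26, unfolded evl]
lemmas A28 = layer_down_down[OF A27, unfolded evl]
lemmas A29 = layer_down_down[OF A28, unfolded evl]
lemmas A30 = layer_down_down[OF A29, unfolded evl]
lemmas A31 = layer_down_down[OF A30, unfolded evl]
lemmas P1 = layer_down_moments[OF layer_up_layer_down[OF A1 le16(1)]]
lemmas P3 = layer_down_moments[OF layer_up_layer_down[OF A3 le16(3)]]
lemmas P5 = layer_down_moments[OF layer_up_layer_down[OF A5 le16(5)]]
lemmas P7 = layer_down_moments[OF layer_up_layer_down[OF A7 le16(7)]]
lemmas P9 = layer_down_moments[OF layer_up_layer_down[OF A9 le16(9)]]
lemmas P11 = layer_down_moments[OF layer_up_layer_down[OF A11 le16(11)]]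
lemmas P13 = layer_down_moments[OF layer_up_layer_down[OF A13 le16(13)]]
lemmas P15 = layer_down_moments[OF layer_up_layer_down[OF A15 le16(15)]]
lemmas P17 = layer_down_moments[OF A17]
lemmas P19 = layer_down_moments[OF A19]
lemmas P21 = layer_down_moments[OF A21]
lemmas P23 = layer_down_moments[OF A23]
lemmas P25 = layer_down_moments[OF A25]
lemmas P27 = layer_down_moments[OF A27]
lemmas P29 = layer_down_moments[OF A29]
lemmas P31 = layer_down_moments[OF A31]

section \<open>The raw moments and the fifth central moment\<close>

text \<open>The coefficients of the statistic \<open>size_stat k\<close> in the monomials of the moment tables, as polynomials in the
length \<open>l\<close> and cleared of the denominators 1, 6, 60, 840, 5040 and 22176 for \<open>k = 0, \<dots>, 5\<close>.\<close>

definition C0 :: "real \<Rightarrow> real list list list" where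
  "C0 l = [[[0, 1]]]"

definition C1 :: "real \<Rightarrow> real list list list" where
  "C1 l = [[[0, -1, 0, -5],
     [0, 0]],
    [[0, l * 3]]]"

definition C2 :: "real \<Rightarrow> real list list list" where
  "C2 l = [[[0, 2, 0, 15 + l * (l * 15), 0, 43],
     [0, 0, l * (-60), 0],
     [0, 60]],
    [[0, l * (-10), 0, l * (-50)],
     [0, 0]],
    [[0, l * (l * 15)]]]"

definition C3 :: "real \<Rightarrow> real list list list" where
  "C3 l = [[[0, -8, 0, -49 + l * (l * (-105)), 0, -252 + l * (l * (-525)), 0, -531],
     [0, 0, l * 420, 0, l * 2100, 0],
     [0, -420, 0, -2100],
     [0, 0]],
    [[0, l * 42, 0, l * (315 + l * (l * 315)), 0, l * 903],
     [0, 0, l * (l * (-1260)), 0],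
     [0, l * 1260]],
    [[0, l * (l * (-105)), 0, l * (l * (-525))],
     [0, 0]],
    [[0, l * (l * (l * 105))]]]"

definition C4 :: "real \<Rightarrow> real list list list" where
  "C4 l = [[[0, 24, 0, 52 + l * (l * 252), 0, 399 + l * (l * (1890 + l * (l * 315))), 0, 1698 + l * (l * 5418), 0, 2867],
     [0, 0, l * (-1008), 0, l * (-7560 + l * (l * (-2520))), 0, l * (-21672), 0],
     [0, 1008, 0, 7560 + l * (l * 7560), 0, 21672],
     [0, 0, l * (-10080), 0],
     [0, 5040]],
    [[0, l * (-96), 0, l * (-588 + l * (l * (-1260))), 0, l * (-3024 + l * (l * (-6300))), 0, l * (-6372)],
     [0, 0, l * (l * 5040), 0, l * (l * 25200), 0],
     [0, l * (-5040), 0, l * (-25200)],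
     [0, 0]],
    [[0, l * (l * 252), 0, l * (l * (1890 + l * (l * 1890))), 0, l * (l * 5418)],
     [0, 0, l * (l * (l * (-7560))), 0],
     [0, l * (l * 7560)]],
    [[0, l * (l * (l * (-420))), 0, l * (l * (l * (-2100)))],
     [0, 0]],
    [[0, l * (l * (l * (l * 315)))]]]"

definition C5 :: "real \<Rightarrow> real list list list" where
  "C5 l = [[[0, -96, 0, 88 + l * (l * (-528)), 0, -187 + l * (l * (-3234 + l * (l * (-1155)))), 0, -2277 + l * (l * (-16632 + l * (l * (-5775)))), 0, -8173 + l * (l * (-35046)), 0, -11531],
     [0, 0, l * 2112, 0, l * (12936 + l * (l * 9240)), 0, l * (66528 + l * (l * 46200)), 0, l * 140184, 0],
     [0, -2112, 0, -12936 + l * (l * (-27720)), 0, -66528 + l * (l * (-138600)), 0, -140184],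
     [0, 0, l * 36960, 0, l * 184800, 0],
     [0, -18480, 0, -92400],
     [0, 0]],
    [[0, l * 264, 0, l * (572 + l * (l * 2772)), 0, l * (4389 + l * (l * (20790 + l * (l * 3465)))), 0, l * (18678 + l * (l * 59598)), 0, l * 31537],
     [0, 0, l * (l * (-11088)), 0, l * (l * (-83160 + l * (l * (-27720)))), 0, l * (l * (-238392)), 0],
     [0, l * 11088, 0, l * (83160 + l * (l * 83160)), 0, l * 238392],
     [0, 0, l * (l * (-110880)), 0],
     [0, l * 55440]],
    [[0, l * (l * (-528)), 0, l * (l * (-3234 + l * (l * (-6930)))), 0, l * (l * (-16632 + l * (l * (-34650)))), 0, l * (l * (-35046))],
     [0, 0, l * (l * (l * 27720)), 0, l * (l * (l * 138600)), 0],
     [0, l * (l * (-27720)), 0, l * (l * (-138600))],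
     [0, 0]],
    [[0, l * (l * (l * 924)), 0, l * (l * (l * (6930 + l * (l * 6930)))), 0, l * (l * (l * 19866))],
     [0, 0, l * (l * (l * (l * (-27720)))), 0],
     [0, l * (l * (l * 27720))]],
    [[0, l * (l * (l * (l * (-1155)))), 0, l * (l * (l * (l * (-5775))))],
     [0, 0]],
    [[0, l * (l * (l * (l * (l * 693))))]]]"

lemma tab_single: "tab [(x, y, z)] = map (\<lambda>r. map (\<lambda>q. map (\<lambda>p. x ^ p * y ^ q * z ^ r) [0..<12 - 2 * (q + r)]) [0..<6 - r]) [0..<6]"
  unfolding tab_def mom_def by simp

lemma even_parts:
  fixes q b :: real
  shows "(q + b) ^ 2 + (q - b) ^ 2 = 2 * (q * q + b * b)"
    "(q + b) ^ 3 + (q - b) ^ 3 = 2 * (q * q * q + 3 * q * (b * b))"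
    "(q + b) ^ 4 + (q - b) ^ 4 = 2 * (q * q * q * q + 6 * (q * q) * (b * b) + b * b * (b * b))"
    "(q + b) ^ 5 + (q - b) ^ 5 = 2 * (q * q * q * q * q + 10 * (q * q * q) * (b * b) + 5 * q * (b * b * (b * b)))"
  by (simp_all add: eval_nat_numeral algebra_simps)

lemma size_stat_expand:
  "size_stat k s = (\<Sum>j\<le>k. real (k choose j) * tri_power_sum j (cm s) * (((q_stat s + l_stat s) ^ (k - j) + (q_stat s - l_stat s) ^ (k - j)) / 2))"
  unfolding size_stat_def tri_sum_pol_def by (simp add: sum.distrib[symmetric] sum_divide_distrib algebra_simps add_divide_distrib)

lemma fin_cell_stat_parts: "cm (final_stat l (x, y, z)) = real x" "q_stat (final_stat l (x, y, z)) = l * real z / 2 - real x * real x"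
  "l_stat (final_stat l (x, y, z)) = l * real x / 2 - real y"
  by (simp_all add: final_stat_def q_stat_def l_stat_def)

text \<open>In terms of the doubled statistics and after multiplication by the common denominator, all
coefficients are integers, which keeps the polynomial identities behind the coefficient tables cheap.\<close>

lemma size_stat_int_0:
  assumes "Q = 2 * q_stat s" "R = 2 * l_stat s" "x = cm s"
  shows "1 * size_stat 0 s = (1 * x) * 1"
  unfolding assms size_stat_expand
  by (simp add: atMost_Suc eval_nat_numeral tri_power_sum_def tcoeff_def even_parts[unfolded eval_nat_numeral, simplified] field_simps)

lemma C0_size_stat: "dot3 (C0 l) (tab [x]) = 1 * size_stat 0 (final_stat l x)"
proof -
  obtain a b c where x: "x = (a, b, c)" by (cases x)
  have "l * real c - 2 * real a ^ 2 = 2 * q_stat (final_stat l (a, b, c))" "l * real a - 2 * real b = 2 * l_stat (final_stat l (a, b, c))"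
    "real a = cm (final_stat l (a, b, c))"
    by (simp_all add: fin_cell_stat_parts power2_eq_square)
  note f = size_stat_int_0[OF this]
  show ?thesis
    unfolding x tab_single f
    by (simp add: C0_def upt_rec eval_nat_numeral algebra_simps)
qed

lemma size_stat_int_1:
  assumes "Q = 2 * q_stat s" "R = 2 * l_stat s" "x = cm s"
  shows "6 * size_stat 1 s = (3 * x) * Q +
    (-1 * x + 1 * x ^ 3) * 1"
  unfolding assms size_stat_expand
  by (simp add: atMost_Suc eval_nat_numeral tri_power_sum_def tcoeff_def even_parts[unfolded eval_nat_numeral, simplified] field_simps)

lemma C1_size_stat: "dot3 (C1 l) (tab [x]) = 6 * size_stat 1 (final_stat l x)"
proof -
  obtain a b c where x: "x = (a, b, c)" by (cases x)
  have "l * real c - 2 * real a ^ 2 = 2 * q_stat (final_stat l (a, b, c))" "l * real a - 2 * real b = 2 * l_stat (final_stat l (a, b, c))"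
    "real a = cm (final_stat l (a, b, c))"
    by (simp_all add: fin_cell_stat_parts power2_eq_square)
  note f = size_stat_int_1[OF this]
  show ?thesis
    unfolding x tab_single f
    by (simp add: C1_def upt_rec eval_nat_numeral algebra_simps)
qed

lemma size_stat_int_2:
  assumes "Q = 2 * q_stat s" "R = 2 * l_stat s" "x = cm s"
  shows "60 * size_stat 2 s = (15 * x) * (Q ^ 2 + R ^ 2) +
    (-10 * x + 10 * x ^ 3) * Q +
    (2 * x + -5 * x ^ 3 + 3 * x ^ 5) * 1"
  unfolding assms size_stat_expand
  by (simp add: atMost_Suc eval_nat_numeral tri_power_sum_def tcoeff_def even_parts[unfolded eval_nat_numeral, simplified] field_simps)

lemma C2_size_stat: "dot3 (C2 l) (tab [x]) = 60 * size_stat 2 (final_stat l x)"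
proof -
  obtain a b c where x: "x = (a, b, c)" by (cases x)
  have "l * real c - 2 * real a ^ 2 = 2 * q_stat (final_stat l (a, b, c))" "l * real a - 2 * real b = 2 * l_stat (final_stat l (a, b, c))"
    "real a = cm (final_stat l (a, b, c))"
    by (simp_all add: fin_cell_stat_parts power2_eq_square)
  note f = size_stat_int_2[OF this]
  show ?thesis
    unfolding x tab_single f
    by (simp add: C2_def upt_rec eval_nat_numeral algebra_simps)
qed

lemma size_stat_int_3:
  assumes "Q = 2 * q_stat s" "R = 2 * l_stat s" "x = cm s"
  shows "840 * size_stat 3 s = (105 * x) * (Q ^ 3 + 3 * Q * R ^ 2) +
    (-105 * x + 105 * x ^ 3) * (Q ^ 2 + R ^ 2) +
    (42 * x + -105 * x ^ 3 + 63 * x ^ 5) * Q +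
    (-8 * x + 35 * x ^ 3 + -42 * x ^ 5 + 15 * x ^ 7) * 1"
  unfolding assms size_stat_expand
  by (simp add: atMost_Suc eval_nat_numeral tri_power_sum_def tcoeff_def even_parts[unfolded eval_nat_numeral, simplified] field_simps)

lemma C3_size_stat: "dot3 (C3 l) (tab [x]) = 840 * size_stat 3 (final_stat l x)"
proof -
  obtain a b c where x: "x = (a, b, c)" by (cases x)
  have "l * real c - 2 * real a ^ 2 = 2 * q_stat (final_stat l (a, b, c))" "l * real a - 2 * real b = 2 * l_stat (final_stat l (a, b, c))"
    "real a = cm (final_stat l (a, b, c))"
    by (simp_all add: fin_cell_stat_parts power2_eq_square)
  note f = size_stat_int_3[OF this]
  show ?thesis
    unfolding x tab_single f
    by (simp add: C3_def upt_rec eval_nat_numeral algebra_simps)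
qed

lemma size_stat_int_4:
  assumes "Q = 2 * q_stat s" "R = 2 * l_stat s" "x = cm s"
  shows "5040 * size_stat 4 s = (315 * x) * (Q ^ 4 + 6 * Q ^ 2 * R ^ 2 + R ^ 4) +
    (-420 * x + 420 * x ^ 3) * (Q ^ 3 + 3 * Q * R ^ 2) +
    (252 * x + -630 * x ^ 3 + 378 * x ^ 5) * (Q ^ 2 + R ^ 2) +
    (-96 * x + 420 * x ^ 3 + -504 * x ^ 5 + 180 * x ^ 7) * Q +
    (24 * x + -140 * x ^ 3 + 231 * x ^ 5 + -150 * x ^ 7 + 35 * x ^ 9) * 1"
  unfolding assms size_stat_expand
  by (simp add: atMost_Suc eval_nat_numeral tri_power_sum_def tcoeff_def even_parts[unfolded eval_nat_numeral, simplified] field_simps)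

lemma C4_size_stat: "dot3 (C4 l) (tab [x]) = 5040 * size_stat 4 (final_stat l x)"
proof -
  obtain a b c where x: "x = (a, b, c)" by (cases x)
  have "l * real c - 2 * real a ^ 2 = 2 * q_stat (final_stat l (a, b, c))" "l * real a - 2 * real b = 2 * l_stat (final_stat l (a, b, c))"
    "real a = cm (final_stat l (a, b, c))"
    by (simp_all add: fin_cell_stat_parts power2_eq_square)
  note f = size_stat_int_4[OF this]
  show ?thesis
    unfolding x tab_single f
    by (simp add: C4_def upt_rec eval_nat_numeral algebra_simps)
qed

lemma size_stat_int_5:
  assumes "Q = 2 * q_stat s" "R = 2 * l_stat s" "x = cm s"
  shows "22176 * size_stat 5 s = (693 * x) * (Q ^ 5 + 10 * Q ^ 3 * R ^ 2 + 5 * Q * R ^ 4) +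
    (-1155 * x + 1155 * x ^ 3) * (Q ^ 4 + 6 * Q ^ 2 * R ^ 2 + R ^ 4) +
    (924 * x + -2310 * x ^ 3 + 1386 * x ^ 5) * (Q ^ 3 + 3 * Q * R ^ 2) +
    (-528 * x + 2310 * x ^ 3 + -2772 * x ^ 5 + 990 * x ^ 7) * (Q ^ 2 + R ^ 2) +
    (264 * x + -1540 * x ^ 3 + 2541 * x ^ 5 + -1650 * x ^ 7 + 385 * x ^ 9) * Q +
    (-96 * x + 616 * x ^ 3 + -1155 * x ^ 5 + 957 * x ^ 7 + -385 * x ^ 9 + 63 * x ^ 11) * 1"
  unfolding assms size_stat_expand
  by (simp add: atMost_Suc eval_nat_numeral tri_power_sum_def tcoeff_def even_parts[unfolded eval_nat_numeral, simplified] field_simps)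

lemma C5_size_stat: "dot3 (C5 l) (tab [x]) = 22176 * size_stat 5 (final_stat l x)"
proof -
  obtain a b c where x: "x = (a, b, c)" by (cases x)
  have "l * real c - 2 * real a ^ 2 = 2 * q_stat (final_stat l (a, b, c))" "l * real a - 2 * real b = 2 * l_stat (final_stat l (a, b, c))"
    "real a = cm (final_stat l (a, b, c))"
    by (simp_all add: fin_cell_stat_parts power2_eq_square)
  note f = size_stat_int_5[OF this]
  show ?thesis
    unfolding x tab_single f
    by (simp add: C5_def upt_rec eval_nat_numeral algebra_simps)
qed

lemma signed_sum_dot:
  assumes C: "\<And>l x. dot3 (C l) (tab [x]) = d * size_stat k (final_stat l x)" and m: "m = 2 * n + 1"
  shows "d * signed_sum (size_stat k) n = dot3 (C (2 * real n + 2)) (moments1 m) - dot3 (C (2 * real n + 2)) (moments0 m)"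
proof -
  have "dot3 (C l) (moments m g) = d * (\<Sum>x\<leftarrow>walks m g. size_stat k (final_stat l x))" for l g
    unfolding moments_def dot3_tab[of _ "walks m g"] C by (simp add: sum_list_const_mult)
  then show ?thesis unfolding moments0_def moments1_def signed_sum_walks m by (simp add: right_diff_distrib)
qed

text \<open>The raw moments of the size as polynomials in \<open>n\<close>, each the interpolation polynomial of its values at
\<open>0, \<dots>, 3 * k\<close>.\<close>

definition raw0 :: "real poly" where
  "raw0 = [:1:]"

definition raw1 :: "real poly" where
  "raw1 = [:0, 19/32, 27/32, 5/16:]"

definition raw2 :: "real poly" where
  "raw2 = [:0, 253/2560, 11671/15360, 5179/3072, 5267/3072, 12787/15360, 1217/7680:]"

definition raw3 :: "real poly" where
  "raw3 = [:0, -27037/573440, 125711/6881280, 6964889/6881280, 12936823/3932160, 2070919/393216, 9729479/1966080, 4779469/1720320, 23859809/27525120, 1601353/13762560:]"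

definition raw4 :: "real poly" where
  "raw4 = [:0, 5743943/75694080, 42938219/1513881600, -93711109/353894400, 731628997/990904320, 1480876507/283115520, 5859184919/471859200, 9672596243/550502400, 341072737/20643840, 2963333411/283115520, 42692240063/9909043200, 4062541211/3892838400, 3264219/28835840:]"

definition raw5 :: "real poly" where
  "raw5 = [:0, -941102495/1574436864, -124146913573/188932423680, 2546434977041/2267189084160, 680613214711/523197480960, -1534627291/2972712960, 853356867499/190253629440, 3442503866771/152202903552, 3941129972027/84557168640, 2231131191097/36238786560, 44478587524471/761014517760, 341542940276477/8371159695360, 171527076114451/8371159695360, 761089235076097/108825076039680, 52578094362149/36275025346560, 226724203201/1648864788480:]"

lemma v0_0: "signed_sum (size_stat 0) 0 = 4 ^ 0 * poly raw0 0"
  using signed_sum_dot[where C = C0 and m = 1 and n = 0, OF C0_size_stat] by (simp add: P1 dot.simps C0_def raw0_def del: One_nat_def)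
lemma v1_0: "signed_sum (size_stat 1) 0 = 4 ^ 0 * poly raw1 0"
  using signed_sum_dot[where C = C1 and m = 1 and n = 0, OF C1_size_stat] by (simp add: P1 dot.simps C1_def raw1_def del: One_nat_def)
lemma v1_1: "signed_sum (size_stat 1) 1 = 4 ^ 1 * poly raw1 1"
  using signed_sum_dot[where C = C1 and m = 3 and n = 1, OF C1_size_stat] by (simp add: P3 dot.simps C1_def raw1_def del: One_nat_def)
lemma v1_2: "signed_sum (size_stat 1) 2 = 4 ^ 2 * poly raw1 2"
  using signed_sum_dot[where C = C1 and m = 5 and n = 2, OF C1_size_stat] by (simp add: P5 dot.simps C1_def raw1_def del: One_nat_def)
lemma v1_3: "signed_sum (size_stat 1) 3 = 4 ^ 3 * poly raw1 3"
  using signed_sum_dot[where C = C1 and m = 7 and n = 3, OF C1_size_stat] by (simp add: P7 dot.simps C1_def raw1_def del: One_nat_def)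
lemma v2_0: "signed_sum (size_stat 2) 0 = 4 ^ 0 * poly raw2 0"
  using signed_sum_dot[where C = C2 and m = 1 and n = 0, OF C2_size_stat] by (simp add: P1 dot.simps C2_def raw2_def del: One_nat_def)
lemma v2_1: "signed_sum (size_stat 2) 1 = 4 ^ 1 * poly raw2 1"
  using signed_sum_dot[where C = C2 and m = 3 and n = 1, OF C2_size_stat] by (simp add: P3 dot.simps C2_def raw2_def del: One_nat_def)
lemma v2_2: "signed_sum (size_stat 2) 2 = 4 ^ 2 * poly raw2 2"
  using signed_sum_dot[where C = C2 and m = 5 and n = 2, OF C2_size_stat] by (simp add: P5 dot.simps C2_def raw2_def del: One_nat_def)
lemma v2_3: "signed_sum (size_stat 2) 3 = 4 ^ 3 * poly raw2 3"
  using signed_sum_dot[where C = C2 and m = 7 and n = 3, OF C2_size_stat] by (simp add: P7 dot.simps C2_def raw2_def del: One_nat_def)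
lemma v2_4: "signed_sum (size_stat 2) 4 = 4 ^ 4 * poly raw2 4"
  using signed_sum_dot[where C = C2 and m = 9 and n = 4, OF C2_size_stat] by (simp add: P9 dot.simps C2_def raw2_def del: One_nat_def)
lemma v2_5: "signed_sum (size_stat 2) 5 = 4 ^ 5 * poly raw2 5"
  using signed_sum_dot[where C = C2 and m = 11 and n = 5, OF C2_size_stat] by (simp add: P11 dot.simps C2_def raw2_def del: One_nat_def)
lemma v2_6: "signed_sum (size_stat 2) 6 = 4 ^ 6 * poly raw2 6"
  using signed_sum_dot[where C = C2 and m = 13 and n = 6, OF C2_size_stat] by (simp add: P13 dot.simps C2_def raw2_def del: One_nat_def)
lemma v3_0: "signed_sum (size_stat 3) 0 = 4 ^ 0 * poly raw3 0"
  using signed_sum_dot[where C = C3 and m = 1 and n = 0, OF C3_size_stat] by (simp add: P1 dot.simps C3_def raw3_def del: One_nat_def)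
lemma v3_1: "signed_sum (size_stat 3) 1 = 4 ^ 1 * poly raw3 1"
  using signed_sum_dot[where C = C3 and m = 3 and n = 1, OF C3_size_stat] by (simp add: P3 dot.simps C3_def raw3_def del: One_nat_def)
lemma v3_2: "signed_sum (size_stat 3) 2 = 4 ^ 2 * poly raw3 2"
  using signed_sum_dot[where C = C3 and m = 5 and n = 2, OF C3_size_stat] by (simp add: P5 dot.simps C3_def raw3_def del: One_nat_def)
lemma v3_3: "signed_sum (size_stat 3) 3 = 4 ^ 3 * poly raw3 3"
  using signed_sum_dot[where C = C3 and m = 7 and n = 3, OF C3_size_stat] by (simp add: P7 dot.simps C3_def raw3_def del: One_nat_def)
lemma v3_4: "signed_sum (size_stat 3) 4 = 4 ^ 4 * poly raw3 4"
  using signed_sum_dot[where C = C3 and m = 9 and n = 4, OF C3_size_stat] by (simp add: P9 dot.simps C3_def raw3_def del: One_nat_def)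
lemma v3_5: "signed_sum (size_stat 3) 5 = 4 ^ 5 * poly raw3 5"
  using signed_sum_dot[where C = C3 and m = 11 and n = 5, OF C3_size_stat] by (simp add: P11 dot.simps C3_def raw3_def del: One_nat_def)
lemma v3_6: "signed_sum (size_stat 3) 6 = 4 ^ 6 * poly raw3 6"
  using signed_sum_dot[where C = C3 and m = 13 and n = 6, OF C3_size_stat] by (simp add: P13 dot.simps C3_def raw3_def del: One_nat_def)
lemma v3_7: "signed_sum (size_stat 3) 7 = 4 ^ 7 * poly raw3 7"
  using signed_sum_dot[where C = C3 and m = 15 and n = 7, OF C3_size_stat] by (simp add: P15 dot.simps C3_def raw3_def del: One_nat_def)
lemma v3_8: "signed_sum (size_stat 3) 8 = 4 ^ 8 * poly raw3 8"
  using signed_sum_dot[where C = C3 and m = 17 and n = 8, OF C3_size_stat] by (simp add: P17 dot.simps C3_def raw3_def del: One_nat_def)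
lemma v3_9: "signed_sum (size_stat 3) 9 = 4 ^ 9 * poly raw3 9"
  using signed_sum_dot[where C = C3 and m = 19 and n = 9, OF C3_size_stat] by (simp add: P19 dot.simps C3_def raw3_def del: One_nat_def)
lemma v4_0: "signed_sum (size_stat 4) 0 = 4 ^ 0 * poly raw4 0"
  using signed_sum_dot[where C = C4 and m = 1 and n = 0, OF C4_size_stat] by (simp add: P1 dot.simps C4_def raw4_def del: One_nat_def)
lemma v4_1: "signed_sum (size_stat 4) 1 = 4 ^ 1 * poly raw4 1"
  using signed_sum_dot[where C = C4 and m = 3 and n = 1, OF C4_size_stat] by (simp add: P3 dot.simps C4_def raw4_def del: One_nat_def)
lemma v4_2: "signed_sum (size_stat 4) 2 = 4 ^ 2 * poly raw4 2"
  using signed_sum_dot[where C = C4 and m = 5 and n = 2, OF C4_size_stat] by (simp add: P5 dot.simps C4_def raw4_def del: One_nat_def)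
lemma v4_3: "signed_sum (size_stat 4) 3 = 4 ^ 3 * poly raw4 3"
  using signed_sum_dot[where C = C4 and m = 7 and n = 3, OF C4_size_stat] by (simp add: P7 dot.simps C4_def raw4_def del: One_nat_def)
lemma v4_4: "signed_sum (size_stat 4) 4 = 4 ^ 4 * poly raw4 4"
  using signed_sum_dot[where C = C4 and m = 9 and n = 4, OF C4_size_stat] by (simp add: P9 dot.simps C4_def raw4_def del: One_nat_def)
lemma v4_5: "signed_sum (size_stat 4) 5 = 4 ^ 5 * poly raw4 5"
  using signed_sum_dot[where C = C4 and m = 11 and n = 5, OF C4_size_stat] by (simp add: P11 dot.simps C4_def raw4_def del: One_nat_def)
lemma v4_6: "signed_sum (size_stat 4) 6 = 4 ^ 6 * poly raw4 6"
  using signed_sum_dot[where C = C4 and m = 13 and n = 6, OF C4_size_stat] by (simp add: P13 dot.simps C4_def raw4_def del: One_nat_def)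
lemma v4_7: "signed_sum (size_stat 4) 7 = 4 ^ 7 * poly raw4 7"
  using signed_sum_dot[where C = C4 and m = 15 and n = 7, OF C4_size_stat] by (simp add: P15 dot.simps C4_def raw4_def del: One_nat_def)
lemma v4_8: "signed_sum (size_stat 4) 8 = 4 ^ 8 * poly raw4 8"
  using signed_sum_dot[where C = C4 and m = 17 and n = 8, OF C4_size_stat] by (simp add: P17 dot.simps C4_def raw4_def del: One_nat_def)
lemma v4_9: "signed_sum (size_stat 4) 9 = 4 ^ 9 * poly raw4 9"
  using signed_sum_dot[where C = C4 and m = 19 and n = 9, OF C4_size_stat] by (simp add: P19 dot.simps C4_def raw4_def del: One_nat_def)
lemma v4_10: "signed_sum (size_stat 4) 10 = 4 ^ 10 * poly raw4 10"
  using signed_sum_dot[where C = C4 and m = 21 and n = 10, OF C4_size_stat] by (simp add: P21 dot.simps C4_def raw4_def del: One_nat_def)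
lemma v4_11: "signed_sum (size_stat 4) 11 = 4 ^ 11 * poly raw4 11"
  using signed_sum_dot[where C = C4 and m = 23 and n = 11, OF C4_size_stat] by (simp add: P23 dot.simps C4_def raw4_def del: One_nat_def)
lemma v4_12: "signed_sum (size_stat 4) 12 = 4 ^ 12 * poly raw4 12"
  using signed_sum_dot[where C = C4 and m = 25 and n = 12, OF C4_size_stat] by (simp add: P25 dot.simps C4_def raw4_def del: One_nat_def)
lemma v5_0: "signed_sum (size_stat 5) 0 = 4 ^ 0 * poly raw5 0"
  using signed_sum_dot[where C = C5 and m = 1 and n = 0, OF C5_size_stat] by (simp add: P1 dot.simps C5_def raw5_def del: One_nat_def)
lemma v5_1: "signed_sum (size_stat 5) 1 = 4 ^ 1 * poly raw5 1"
  using signed_sum_dot[where C = C5 and m = 3 and n = 1, OF C5_size_stat] by (simp add: P3 dot.simps C5_def raw5_def del: One_nat_def)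
lemma v5_2: "signed_sum (size_stat 5) 2 = 4 ^ 2 * poly raw5 2"
  using signed_sum_dot[where C = C5 and m = 5 and n = 2, OF C5_size_stat] by (simp add: P5 dot.simps C5_def raw5_def del: One_nat_def)
lemma v5_3: "signed_sum (size_stat 5) 3 = 4 ^ 3 * poly raw5 3"
  using signed_sum_dot[where C = C5 and m = 7 and n = 3, OF C5_size_stat] by (simp add: P7 dot.simps C5_def raw5_def del: One_nat_def)
lemma v5_4: "signed_sum (size_stat 5) 4 = 4 ^ 4 * poly raw5 4"
  using signed_sum_dot[where C = C5 and m = 9 and n = 4, OF C5_size_stat] by (simp add: P9 dot.simps C5_def raw5_def del: One_nat_def)
lemma v5_5: "signed_sum (size_stat 5) 5 = 4 ^ 5 * poly raw5 5"
  using signed_sum_dot[where C = C5 and m = 11 and n = 5, OF C5_size_stat] by (simp add: P11 dot.simps C5_def raw5_def del: One_nat_def)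
lemma v5_6: "signed_sum (size_stat 5) 6 = 4 ^ 6 * poly raw5 6"
  using signed_sum_dot[where C = C5 and m = 13 and n = 6, OF C5_size_stat] by (simp add: P13 dot.simps C5_def raw5_def del: One_nat_def)
lemma v5_7: "signed_sum (size_stat 5) 7 = 4 ^ 7 * poly raw5 7"
  using signed_sum_dot[where C = C5 and m = 15 and n = 7, OF C5_size_stat] by (simp add: P15 dot.simps C5_def raw5_def del: One_nat_def)
lemma v5_8: "signed_sum (size_stat 5) 8 = 4 ^ 8 * poly raw5 8"
  using signed_sum_dot[where C = C5 and m = 17 and n = 8, OF C5_size_stat] by (simp add: P17 dot.simps C5_def raw5_def del: One_nat_def)
lemma v5_9: "signed_sum (size_stat 5) 9 = 4 ^ 9 * poly raw5 9"
  using signed_sum_dot[where C = C5 and m = 19 and n = 9, OF C5_size_stat] by (simp add: P19 dot.simps C5_def raw5_def del: One_nat_def)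
lemma v5_10: "signed_sum (size_stat 5) 10 = 4 ^ 10 * poly raw5 10"
  using signed_sum_dot[where C = C5 and m = 21 and n = 10, OF C5_size_stat] by (simp add: P21 dot.simps C5_def raw5_def del: One_nat_def)
lemma v5_11: "signed_sum (size_stat 5) 11 = 4 ^ 11 * poly raw5 11"
  using signed_sum_dot[where C = C5 and m = 23 and n = 11, OF C5_size_stat] by (simp add: P23 dot.simps C5_def raw5_def del: One_nat_def)
lemma v5_12: "signed_sum (size_stat 5) 12 = 4 ^ 12 * poly raw5 12"
  using signed_sum_dot[where C = C5 and m = 25 and n = 12, OF C5_size_stat] by (simp add: P25 dot.simps C5_def raw5_def del: One_nat_def)
lemma v5_13: "signed_sum (size_stat 5) 13 = 4 ^ 13 * poly raw5 13"
  using signed_sum_dot[where C = C5 and m = 27 and n = 13, OF C5_size_stat] by (simp add: P27 dot.simps C5_def raw5_def del: One_nat_def)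
lemma v5_14: "signed_sum (size_stat 5) 14 = 4 ^ 14 * poly raw5 14"
  using signed_sum_dot[where C = C5 and m = 29 and n = 14, OF C5_size_stat] by (simp add: P29 dot.simps C5_def raw5_def del: One_nat_def)
lemma v5_15: "signed_sum (size_stat 5) 15 = 4 ^ 15 * poly raw5 15"
  using signed_sum_dot[where C = C5 and m = 31 and n = 15, OF C5_size_stat] by (simp add: P31 dot.simps C5_def raw5_def del: One_nat_def)

lemma vals_0:
  assumes "n \<le> 3 * 0"
  shows "signed_sum (size_stat 0) n = 4 ^ n * poly raw0 (real n)"
proof -
  have "set [0..<Suc (3 * 0)] = {0}" by (simp add: upt_rec numeral_eq_Suc)
  moreover have "n \<in> set [0..<Suc (3 * 0)]" using assms by (simp del: upt_Suc)
  ultimately have "n \<in> {0}" by (simp only:)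
  then show ?thesis by (elim insertE emptyE) (simp_all only: v0_0 of_nat_numeral of_nat_0 of_nat_1)
qed

lemma vals_1:
  assumes "n \<le> 3 * 1"
  shows "signed_sum (size_stat 1) n = 4 ^ n * poly raw1 (real n)"
proof -
  have "set [0..<Suc (3 * 1)] = {0, 1, 2, 3}" by (simp add: upt_rec numeral_eq_Suc)
  moreover have "n \<in> set [0..<Suc (3 * 1)]" using assms by (simp del: upt_Suc)
  ultimately have "n \<in> {0, 1, 2, 3}" by (simp only:)
  then show ?thesis by (elim insertE emptyE) (simp_all only: v1_0 v1_1 v1_2 v1_3 of_nat_numeral of_nat_0 of_nat_1)
qed

lemma vals_2:
  assumes "n \<le> 3 * 2"
  shows "signed_sum (size_stat 2) n = 4 ^ n * poly raw2 (real n)"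
proof -
  have "set [0..<Suc (3 * 2)] = {0, 1, 2, 3, 4, 5, 6}" by (simp add: upt_rec numeral_eq_Suc)
  moreover have "n \<in> set [0..<Suc (3 * 2)]" using assms by (simp del: upt_Suc)
  ultimately have "n \<in> {0, 1, 2, 3, 4, 5, 6}" by (simp only:)
  then show ?thesis by (elim insertE emptyE) (simp_all only: v2_0 v2_1 v2_2 v2_3 v2_4 v2_5 v2_6 of_nat_numeral of_nat_0 of_nat_1)
qed

lemma vals_3:
  assumes "n \<le> 3 * 3"
  shows "signed_sum (size_stat 3) n = 4 ^ n * poly raw3 (real n)"
proof -
  have "set [0..<Suc (3 * 3)] = {0, 1, 2, 3, 4, 5, 6, 7, 8, 9}" by (simp add: upt_rec numeral_eq_Suc)
  moreover have "n \<in> set [0..<Suc (3 * 3)]" using assms by (simp del: upt_Suc)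
  ultimately have "n \<in> {0, 1, 2, 3, 4, 5, 6, 7, 8, 9}" by (simp only:)
  then show ?thesis by (elim insertE emptyE) (simp_all only: v3_0 v3_1 v3_2 v3_3 v3_4 v3_5 v3_6 v3_7 v3_8 v3_9 of_nat_numeral of_nat_0 of_nat_1)
qed

lemma vals_4:
  assumes "n \<le> 3 * 4"
  shows "signed_sum (size_stat 4) n = 4 ^ n * poly raw4 (real n)"
proof -
  have "set [0..<Suc (3 * 4)] = {0, 1, 2, 3, 4, 5, 6, 7, 8, 9, 10, 11, 12}" by (simp add: upt_rec numeral_eq_Suc)
  moreover have "n \<in> set [0..<Suc (3 * 4)]" using assms by (simp del: upt_Suc)
  ultimately have "n \<in> {0, 1, 2, 3, 4, 5, 6, 7, 8, 9, 10, 11, 12}" by (simp only:)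
  then show ?thesis by (elim insertE emptyE) (simp_all only: v4_0 v4_1 v4_2 v4_3 v4_4 v4_5 v4_6 v4_7 v4_8 v4_9 v4_10 v4_11 v4_12 of_nat_numeral of_nat_0 of_nat_1)
qed

lemma vals_5:
  assumes "n \<le> 3 * 5"
  shows "signed_sum (size_stat 5) n = 4 ^ n * poly raw5 (real n)"
proof -
  have "set [0..<Suc (3 * 5)] = {0, 1, 2, 3, 4, 5, 6, 7, 8, 9, 10, 11, 12, 13, 14, 15}" by (simp add: upt_rec numeral_eq_Suc)
  moreover have "n \<in> set [0..<Suc (3 * 5)]" using assms by (simp del: upt_Suc)
  ultimately have "n \<in> {0, 1, 2, 3, 4, 5, 6, 7, 8, 9, 10, 11, 12, 13, 14, 15}" by (simp only:)
  then show ?thesis by (elim insertE emptyE) (simp_all only: v5_0 v5_1 v5_2 v5_3 v5_4 v5_5 v5_6 v5_7 v5_8 v5_9 v5_10 v5_11 v5_12 v5_13 v5_14 v5_15 of_nat_numeral of_nat_0 of_nat_1)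
qed

text \<open>The weight \<open>6 * k + 3\<close> of \<open>size_stat k\<close> bounds the degree by \<open>3 * k\<close>, so \<open>3 * k + 1\<close> values suffice.\<close>

lemma interpolate:
  assumes v: "\<And>n. n \<le> 3 * k \<Longrightarrow> signed_sum (size_stat k) n = 4 ^ n * poly M (real n)" and d: "degree M \<le> 3 * k"
  shows "signed_sum (size_stat k) n = 4 ^ n * poly M (real n)"
proof -
  have "(6 * k + 3 - 3) div 2 = 3 * k" by simp
  then obtain p :: "real poly" where p: "degree p \<le> 3 * k" "\<And>n. signed_sum (size_stat k) n = 4 ^ n * poly p (real n)"
    using signed_sum_polynomial[OF weighted_size_stat size_stat_stat0 _ size_stat_sgn_flip, of k] by auto
  have "p = M"
  proof (rule poly_eqI_degree)
    have "card (real ` {..3 * k}) = Suc (3 * k)" by (subst card_image) (auto simp: inj_on_def)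
    then show "degree p < card (real ` {..3 * k})" "degree M < card (real ` {..3 * k})" using p(1) d by simp_all
    show "poly p x = poly M x" if "x \<in> real ` {..3 * k}" for x
      using that v p(2) by auto
  qed
  then show ?thesis using p(2) by simp
qed

theorem raw_moments:
  assumes n: "1 \<le> n"
  defines "S \<equiv> distinct_cores (2 * n + 1) (2 * n + 3)"
  shows "(\<Sum>xs\<in>S. real (psize xs) ^ 0) = 4 ^ n * poly raw0 (real n)"
    "(\<Sum>xs\<in>S. real (psize xs) ^ 1) = 4 ^ n * poly raw1 (real n)"
    "(\<Sum>xs\<in>S. real (psize xs) ^ 2) = 4 ^ n * poly raw2 (real n)"
    "(\<Sum>xs\<in>S. real (psize xs) ^ 3) = 4 ^ n * poly raw3 (real n)"
    "(\<Sum>xs\<in>S. real (psize xs) ^ 4) = 4 ^ n * poly raw4 (real n)"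
    "(\<Sum>xs\<in>S. real (psize xs) ^ 5) = 4 ^ n * poly raw5 (real n)"
proof -
  have s: "(\<Sum>xs\<in>S. real (psize xs) ^ k) = signed_sum (size_stat k) n" if "k \<le> 5" for k
    using sum_distinct_cores[of "2 * n + 1" "2 * n + 3" "\<lambda>x. x ^ k"] sum_core_hooks[OF n that] unfolding S_def by simp
  have "degree raw0 \<le> 3 * 0" "degree raw1 \<le> 3 * 1" "degree raw2 \<le> 3 * 2" "degree raw3 \<le> 3 * 3" "degree raw4 \<le> 3 * 4" "degree raw5 \<le> 3 * 5"
    by (simp_all add: raw0_def raw1_def raw2_def raw3_def raw4_def raw5_def)
  note i = interpolate[OF vals_0 this(1)] interpolate[OF vals_1 this(2)] interpolate[OF vals_2 this(3)]
    interpolate[OF vals_3 this(4)] interpolate[OF vals_4 this(5)] interpolate[OF vals_5 this(6)]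
  show "(\<Sum>xs\<in>S. real (psize xs) ^ 0) = 4 ^ n * poly raw0 (real n)" by (subst s) (simp, rule i)
  show "(\<Sum>xs\<in>S. real (psize xs) ^ 1) = 4 ^ n * poly raw1 (real n)" by (subst s) (simp, rule i)
  show "(\<Sum>xs\<in>S. real (psize xs) ^ 2) = 4 ^ n * poly raw2 (real n)" by (subst s) (simp, rule i)
  show "(\<Sum>xs\<in>S. real (psize xs) ^ 3) = 4 ^ n * poly raw3 (real n)" by (subst s) (simp, rule i)
  show "(\<Sum>xs\<in>S. real (psize xs) ^ 4) = 4 ^ n * poly raw4 (real n)" by (subst s) (simp, rule i)
  show "(\<Sum>xs\<in>S. real (psize xs) ^ 5) = 4 ^ n * poly raw5 (real n)" by (subst s) (simp, rule i)
qed

text \<open>The central moment depends only on the raw ones, for any finite uniform distribution.\<close>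

lemma central_moment_5:
  fixes X :: "'a \<Rightarrow> real"
  assumes r: "real (card S) = N" "(\<Sum>x\<in>S. X x) = N * c1" "(\<Sum>x\<in>S. X x ^ 2) = N * c2" "(\<Sum>x\<in>S. X x ^ 3) = N * c3"
    "(\<Sum>x\<in>S. X x ^ 4) = N * c4" "(\<Sum>x\<in>S. X x ^ 5) = N * c5" and N: "N \<noteq> 0"
  shows "central_moment 5 S X = c5 - 5 * (c1 * c4) + 10 * (c1 * c1 * c3) - 10 * (c1 * c1 * c1 * c2) + 4 * (c1 * c1 * c1 * c1 * c1)"
proof -
  have mean: "uniform_mean S X = c1" unfolding uniform_mean_def r(1,2) using N by simp
  have e: "(x - c1) ^ 5 = x ^ 5 - 5 * c1 * x ^ 4 + 10 * (c1 * c1) * x ^ 3 - 10 * (c1 * c1 * c1) * x ^ 2 +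
      5 * (c1 * c1 * c1 * c1) * x - c1 * c1 * c1 * c1 * c1" for x
    by (simp add: eval_nat_numeral algebra_simps)
  have "(\<Sum>x\<in>S. (X x - c1) ^ 5) = N * c5 - 5 * c1 * (N * c4) + 10 * (c1 * c1) * (N * c3) - 10 * (c1 * c1 * c1) * (N * c2) +
      5 * (c1 * c1 * c1 * c1) * (N * c1) - N * (c1 * c1 * c1 * c1 * c1)"
    unfolding e by (simp only: sum_subtractf sum.distrib sum_distrib_left[symmetric] r(2-) sum_constant r(1))
      (simp add: algebra_simps)
  then show ?thesis unfolding central_moment_def mean uniform_mean_def[of S "\<lambda>a. (X a - c1) ^ 5"] r(1)
    using N by (simp add: field_simps)
qed

lemma moment_polynomial:
  "raw5 - smult 5 (raw1 * raw4) + smult 10 (raw1 * raw1 * raw3) - smult 10 (raw1 * raw1 * raw1 * raw2) + smult 4 (raw1 * raw1 * raw1 * raw1 * raw1) =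
    smult (1 / 108825076039680) ([:0, 1:] * [:1, 1:] * [:-65049004454400, -30975685518528, 91113907956144, 43165327777096, -105409116317640, -95604599727502, 42586120680111, 115227024155664, 126787455814599, 154511084293844, 153901186416765, 93240357590320, 30331407775461, 4115597238066:])"
  by (simp add: raw1_def raw2_def raw3_def raw4_def raw5_def)

theorem theorem5:
  fixes n :: nat
  assumes "n \<ge> 1"
  shows "central_moment 5 (distinct_cores (2 * n + 1) (2 * n + 3)) (\<lambda>xs. real (psize xs)) =
    real n * (real n + 1) / 108825076039680 *
      (4115597238066 * real n ^ 13 + 30331407775461 * real n ^ 12
       + 93240357590320 * real n ^ 11 + 153901186416765 * real n ^ 10
       + 154511084293844 * real n ^ 9 + 126787455814599 * real n ^ 8
       + 115227024155664 * real n ^ 7 + 42586120680111 * real n ^ 6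
       - 95604599727502 * real n ^ 5 - 105409116317640 * real n ^ 4
       + 43165327777096 * real n ^ 3 + 91113907956144 * real n ^ 2
       - 30975685518528 * real n - 65049004454400)"
proof -
  note r = raw_moments[OF assms]
  have c: "real (card (distinct_cores (2 * n + 1) (2 * n + 3))) = 4 ^ n" using r(1) by (simp add: raw0_def)
  have "central_moment 5 (distinct_cores (2 * n + 1) (2 * n + 3)) (\<lambda>xs. real (psize xs)) =
      poly (raw5 - smult 5 (raw1 * raw4) + smult 10 (raw1 * raw1 * raw3) - smult 10 (raw1 * raw1 * raw1 * raw2) + smult 4 (raw1 * raw1 * raw1 * raw1 * raw1)) (real n)"
    by (subst central_moment_5[OF c r(2)[unfolded power_one_right] r(3-)]) simp_all
  also have "\<dots> = real n * (real n + 1) / 108825076039680 *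
      (4115597238066 * real n ^ 13 + 30331407775461 * real n ^ 12
       + 93240357590320 * real n ^ 11 + 153901186416765 * real n ^ 10
       + 154511084293844 * real n ^ 9 + 126787455814599 * real n ^ 8
       + 115227024155664 * real n ^ 7 + 42586120680111 * real n ^ 6
       - 95604599727502 * real n ^ 5 - 105409116317640 * real n ^ 4
       + 43165327777096 * real n ^ 3 + 91113907956144 * real n ^ 2
       - 30975685518528 * real n - 65049004454400)"
  proof -
    have "poly [:-65049004454400, -30975685518528, 91113907956144, 43165327777096, -105409116317640, -95604599727502, 42586120680111, 115227024155664, 126787455814599, 154511084293844, 153901186416765, 93240357590320, 30331407775461, 4115597238066:] x = 4115597238066 * x ^ 13 + 30331407775461 * x ^ 12
       + 93240357590320 * x ^ 11 + 153901186416765 * x ^ 10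
       + 154511084293844 * x ^ 9 + 126787455814599 * x ^ 8
       + 115227024155664 * x ^ 7 + 42586120680111 * x ^ 6
       - 95604599727502 * x ^ 5 - 105409116317640 * x ^ 4
       + 43165327777096 * x ^ 3 + 91113907956144 * x ^ 2
       - 30975685518528 * x - 65049004454400" for x :: real
      by (simp add: eval_nat_numeral algebra_simps)
    then show ?thesis unfolding moment_polynomial poly_smult poly_mult by (simp add: add.commute)
  qed
  finally show ?thesis .
qed

end
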